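(* Consider the quantized Riemannian gradient descent algorithm described in the context. Let $p\in(0,1)$, let the initial point $x^{(0)}$ be chosen uniformly at random on $\mathbb{S}^{d-1}$, and run the algorithm with $$\eta=\frac{c\,p}{\sqrt d\,\gamma},\qquad D=\arccos\Big(c\,\frac{p}{\sqrt d}\Big),$$ where $c>0$ is the universal constant described in the context. Then, with probability at least $1-p$, the total number of bits communicated by the algorithm to reach an iterate $x^{(T)}$ with $\mathrm{dist}(x^{(T)},x^* )\le\epsilon$ is at most $$b=O\left(n\,\frac{d^2}{p^2}\,\frac{\gamma}{\delta}\,\log\Big(\frac{n\,d\,\gamma}{p\,\delta}\Big)\,\log\Big(\frac{D}{\epsilon}\Big)\right).$$
   Context: Setting. A data matrix $M\in\mathbb{R}^{m\times d}$ is partitioned row-wise among $n$ machines; machine $i$ holds $M_i$. Put $A_i=M_i^TM_i$, $A=M^TM=\sum_{i=1}^nA_i$, $f_i(x)=-x^TA_ix$ and $f(x)=-x^TAx=\sum_{i=1}^n f_i(x)$ on the unit sphere $\mathbb{S}^{d-1}\subset\mathbb{R}^d$. Let $\lambda_1\ge\lambda_2\ge\dots$ be the eigenvalues of $A$, assume $\delta=\lambda_1-\lambda_2>0$, and put $\mu=\delta/2$. Let $\gamma_i=2\lambda_{\max}(A_i)$ and $\gamma=n\max_i\gamma_i$. The initial point $x^{(0)}\in\mathbb{S}^{d-1}$ is known to all machines, and $x^*\in\{v_1,-v_1\}$ is the unit leading eigenvector of $A$ closest to $x^{(0)}$. Constant $c$. $c>0$ is a universal constant such that, for every $d$, every $p\in(0,1)$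 and $x$ uniform on $\mathbb{S}^{d-1}$, $|\langle x,v_1\rangle|\ge c\,p/\sqrt d$ with probability at least $1-p$ (equivalently, $\mathrm{dist}(x,\{v_1,-v_1\})\le\arccos(c\,p/\sqrt d)$). Sphere notation. $T_x\mathbb{S}^{d-1}=x^\perp$; $\mathrm{grad}f(x)=(I-xx^T)\nabla f(x)$; $\mathrm{dist}(p,q)=\arccos\langle p,q\rangle$; $\exp_p(v)=\cos(\|v\|)p+\sin(\|v\|)v/\|v\|$ (with $\exp_p(0)=p$); $\Gamma_{x^{(t)}}^{x^{(t+1)}}$ is parallel transport from $T_{x^{(t)}}\mathbb{S}^{d-1}$ to $T_{x^{(t+1)}}\mathbb{S}^{d-1}$ along the geodesic joining the two points. Quantization. $Q:\mathbb{R}^{d-1}\times\mathbb{R}^{d-1}\times\mathbb{R}_+\times\mathbb{R}_+\to\mathbb{R}^{d-1}$ is a fixed (deterministic lattice) quantization function: for $y,w>0$ there are an encoder $\mathrm{enc}_{w,y}:\mathbb{R}^{d-1}\to\{0,1\}^b$ and a decoder $\mathrm{dec}_{w,y}:\{0,1\}^b\times\mathbb{R}^{d-1}\to\mathbb{R}^{d-1}$ such that whenever $\|x-x'\|\le y$, $\mathrm{dec}_{w,y}(\mathrm{enc}_{w,y}(x),x')=Q(x,x',y,w)$ and $\|Q(x,x',y,w)-x\|\le w$; if $y/w>1$ the number of bits used by each machine to communicate the vector is $b=O(d\log(y/w))$. The decoded vector is the lattice point closest to $x$, so it is the same for all admissible $x'$. $Q_x$ denotes $Q$ applied in $T_x\mathbb{S}^{d-1}$,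 identified with $\mathbb{R}^{d-1}$ by a linear isometry. Parameters. $\sigma=1-\cos(D)\mu\eta$ if $\cos(D)\mu\eta\le\frac12$ and $\sigma=\frac12$ otherwise; $K=\frac{2}{\sqrt\sigma}$; $\theta=\frac{\sqrt\sigma(1-\sqrt\sigma)}{4}$; $\sqrt\xi=\theta K+\sqrt\sigma$; $R^{(t)}=\gamma K(\sqrt\xi)^tD$. A master machine $i_0$ is fixed. Algorithm. Initialization at $x^{(0)}$: each machine $i$ encodes its gradient and the master decodes $q_i^{(0)}=Q_{x^{(0)}}\big(\mathrm{grad}f_i(x^{(0)}),\mathrm{grad}f_{i_0}(x^{(0)}),2\gamma\pi,\frac{\theta R^{(0)}}{2n}\big)$; the master sums $r^{(0)}=\sum_{i=1}^nq_i^{(0)}$, encodes the sum, and each machine $i$ decodes $q^{(0)}=Q_{x^{(0)}}\big(r^{(0)},\mathrm{grad}f_i(x^{(0)}),\frac{\theta R^{(0)}}{2}+2\gamma\pi,\frac{\theta R^{(0)}}{2}\big)$. For $t\ge0$: $x^{(t+1)}=\exp_{x^{(t)}}(-\eta q^{(t)})$; the master decodes $q_i^{(t+1)}=Q_{x^{(t+1)}}\big(\mathrm{grad}f_i(x^{(t+1)}),\Gamma_{x^{(t)}}^{x^{(t+1)}}q_i^{(t)},\frac{R^{(t+1)}}{n},\frac{\theta R^{(t+1)}}{2n}\big)$ for each $i$ and sums $r^{(t+1)}=\sum_{i=1}^nq_i^{(t+1)}$; it encodes the sum and each machine decodes $q^{(t+1)}=Q_{x^{(t+1)}}\big(r^{(t+1)},\Gamma_{x^{(t)}}^{x^{(t+1)}}q^{(t)},(1+\frac\theta2)R^{(t+1)},\frac{\theta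 R^{(t+1)}}{2}\big)$. The total communication is the number of bits sent for all encodings (machines to master and master to machines) over all rounds. $O(\cdot)$ hides an absolute constant, in the usual asymptotic regime where the logarithms are bounded below by a positive constant (so $\epsilon<D$). *)

theory Defs
  imports
    "HOL-Analysis.Analysis"
    "Jordan_Normal_Form.Spectral_Radius"
    "Jordan_Normal_Form.DL_Submatrix"
begin

(* The asymptotic constants must not depend on the dimension d, so d has to be a value rather
   than a type: vectors and matrices are those of Jordan_Normal_Form. *)

hide_type (open) Finite_Cartesian_Product.vec
hide_const (open) Finite_Cartesian_Product.vec
no_notation inner (infix "\<bullet>" 70)
no_notation vec_nth (infixl "$" 90)

subsection \<open>Geometry of the unit sphere\<close>

definition vnorm :: "real vec \<Rightarrow> real" where
  "vnorm x = sqrt (x \<bullet> x)"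

definition usphere :: "nat \<Rightarrow> real vec set" where
  "usphere d = {x \<in> carrier_vec d. vnorm x = 1}"

definition tangent :: "nat \<Rightarrow> real vec \<Rightarrow> real vec set" where
  "tangent d x = {v \<in> carrier_vec d. x \<bullet> v = 0}"

definition tproj :: "real vec \<Rightarrow> real vec \<Rightarrow> real vec" where
  "tproj x u = u - (x \<bullet> u) \<cdot>\<^sub>v x"

definition sdist :: "real vec \<Rightarrow> real vec \<Rightarrow> real" where
  "sdist x y = arccos (x \<bullet> y)"

definition sexp :: "real vec \<Rightarrow> real vec \<Rightarrow> real vec" where
  "sexp x v = (if vnorm v = 0 then x
               else cos (vnorm v) \<cdot>\<^sub>v x + (sin (vnorm v) / vnorm v) \<cdot>\<^sub>v v)"

definition nabla :: "nat \<Rightarrow> (real vec \<Rightarrow> real) \<Rightarrow> real vec \<Rightarrow> real vec" where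
  "nabla d f x = Matrix.vec d (\<lambda>k. deriv (\<lambda>s. f (x + s \<cdot>\<^sub>v unit_vec d k)) 0)"

definition rgrad :: "nat \<Rightarrow> (real vec \<Rightarrow> real) \<Rightarrow> real vec \<Rightarrow> real vec" where
  "rgrad d f x = tproj x (nabla d f x)"

(* V is a tangent field along the curve \<gamma> on [0,1] whose covariant derivative, that is the
   tangential part of its componentwise derivative, vanishes. *)
definition parallel_along ::
    "nat \<Rightarrow> (real \<Rightarrow> real vec) \<Rightarrow> (real \<Rightarrow> real vec) \<Rightarrow> bool" where
  "parallel_along d \<gamma> V \<longleftrightarrow>
     (\<forall>s\<in>{0..1}. V s \<in> tangent d (\<gamma> s) \<and>
        (\<exists>w\<in>carrier_vec d.
           (\<forall>k<d. ((\<lambda>r. V r $ k) has_real_derivative w $ k) (at s within {0..1})) \<and>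
           tproj (\<gamma> s) w = 0\<^sub>v d))"

(* Parallel transport along the minimal geodesic s \<mapsto> sexp x (s l) from x to y. The geodesic
   and the transported vector are unique unless y = - x. *)
definition transport :: "nat \<Rightarrow> real vec \<Rightarrow> real vec \<Rightarrow> real vec \<Rightarrow> real vec" where
  "transport d x y v = (THE u. \<exists>l V. l \<in> tangent d x \<and> vnorm l = sdist x y \<and> sexp x l = y \<and>
     parallel_along d (\<lambda>s. sexp x (s \<cdot>\<^sub>v l)) V \<and> V 0 = v \<and> V 1 = u)"

subsection \<open>The uniform distribution on the sphere\<close>

definition sphere_coords :: "nat \<Rightarrow> real vec \<Rightarrow> nat \<Rightarrow> real" where
  "sphere_coords d x = (\<lambda>k\<in>{..<d}. x $ k)"

definition sphere_borel :: "nat \<Rightarrow> real vec measure" where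
  "sphere_borel d = vimage_algebra (usphere d) (sphere_coords d) (\<Pi>\<^sub>M k\<in>{..<d}. borel)"

(* The value at the origin only makes the projection total; it concerns a null set. *)
definition radial_proj :: "nat \<Rightarrow> (nat \<Rightarrow> real) \<Rightarrow> real vec" where
  "radial_proj d g =
     (let v = Matrix.vec d g in if vnorm v = 0 then unit_vec d 0 else (1 / vnorm v) \<cdot>\<^sub>v v)"

(* Normalised surface measure, obtained as the cone measure: the image under radial projection
   of the uniform distribution on the unit ball. *)
definition uniform_sphere :: "nat \<Rightarrow> real vec measure" where
  "uniform_sphere d =
     distr (uniform_measure (\<Pi>\<^sub>M k\<in>{..<d}. lborel)
              {g \<in> space (\<Pi>\<^sub>M k\<in>{..<d}. lborel). (\<Sum>k<d. (g k)\<^sup>2) \<le> 1})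
           (sphere_borel d) (radial_proj d)"

definition universal_overlap :: "real \<Rightarrow> bool" where
  "universal_overlap c \<longleftrightarrow> c > 0 \<and>
     (\<forall>d\<ge>1. \<forall>v\<in>usphere d. \<forall>p. 0 < p \<and> p < 1 \<longrightarrow>
        measure (uniform_sphere d)
          {x \<in> usphere d. \<bar>x \<bullet> v\<bar> \<ge> c * p / sqrt (real d)} \<ge> 1 - p)"

subsection \<open>Distributed principal component analysis\<close>

definition row_partition :: "nat \<Rightarrow> nat \<Rightarrow> (nat \<Rightarrow> nat set) \<Rightarrow> bool" where
  "row_partition n m P \<longleftrightarrow> disjoint_family_on P {..<n} \<and> (\<Union>i<n. P i) = {..<m}"

definition local_data :: "real mat \<Rightarrow> (nat \<Rightarrow> nat set) \<Rightarrow> nat \<Rightarrow> real mat" where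
  "local_data M P i = submatrix M (P i) UNIV"

definition gram :: "real mat \<Rightarrow> real mat" where
  "gram M = transpose_mat M * M"

definition pca_obj :: "real mat \<Rightarrow> real vec \<Rightarrow> real" where
  "pca_obj A x = - (x \<bullet> (A *\<^sub>v x))"

(* All eigenvalues, with multiplicity, in decreasing order. *)
definition eigenvalue_list :: "real mat \<Rightarrow> real list \<Rightarrow> bool" where
  "eigenvalue_list A ls \<longleftrightarrow>
     sorted_wrt (\<ge>) ls \<and> char_poly A = (\<Prod>l\<leftarrow>ls. [:- l, 1:])"

definition lambda_max :: "real mat \<Rightarrow> real" where
  "lambda_max A = Max (spectrum A)"

definition total_smoothness :: "nat \<Rightarrow> (nat \<Rightarrow> real mat) \<Rightarrow> real" where
  "total_smoothness n A = real n * Max ((\<lambda>i. 2 * lambda_max (A i)) ` {..<n})"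

subsection \<open>Lattice quantization\<close>

definition int_lattice :: "nat \<Rightarrow> real vec set \<Rightarrow> bool" where
  "int_lattice k L \<longleftrightarrow> (\<exists>B\<in>carrier_mat k k. invertible_mat B \<and>
     L = {B *\<^sub>v z | z. z \<in> carrier_vec k \<and> (\<forall>i<k. z $ i \<in> \<int>)})"

(* N is the nearest lattice point with ties broken independently of the reference x'. Near
   y/w = 1 the bound O(d log (y/w)) would force b = 0, which no quantizer achieves, so the
   logarithm is kept away from 0; a constant threshold as in y/w \<ge> 2 suffices. *)
definition quantizer ::
    "nat \<Rightarrow> real \<Rightarrow> (real vec \<Rightarrow> real vec \<Rightarrow> real \<Rightarrow> real \<Rightarrow> real vec) \<Rightarrow>
     (real \<Rightarrow> real \<Rightarrow> real vec \<Rightarrow> bool list) \<Rightarrow>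
     (real \<Rightarrow> real \<Rightarrow> bool list \<Rightarrow> real vec \<Rightarrow> real vec) \<Rightarrow>
     (real \<Rightarrow> real \<Rightarrow> nat) \<Rightarrow> bool" where
  "quantizer d C Q enc dec b \<longleftrightarrow> (\<forall>y>0. \<forall>w>0.
     (\<forall>x\<in>carrier_vec (d - 1). length (enc w y x) = b y w) \<and>
     (\<exists>L N. int_lattice (d - 1) L \<and>
        (\<forall>x\<in>carrier_vec (d - 1).
           N x \<in> L \<and> (\<forall>l\<in>L. vnorm (N x - x) \<le> vnorm (l - x)) \<and>
           (\<forall>x'\<in>carrier_vec (d - 1). vnorm (x - x') \<le> y \<longrightarrow>
              dec w y (enc w y x) x' = Q x x' y w \<and>
              vnorm (Q x x' y w - x) \<le> w \<and>
              Q x x' y w = N x))) \<and>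
     (y / w \<ge> 2 \<longrightarrow> real (b y w) \<le> C * real d * log 2 (y / w)))"

definition tangent_isometry :: "nat \<Rightarrow> real vec \<Rightarrow> (real vec \<Rightarrow> real vec) \<Rightarrow> bool" where
  "tangent_isometry d x \<phi> \<longleftrightarrow> bij_betw \<phi> (tangent d x) (carrier_vec (d - 1)) \<and>
     (\<forall>u\<in>tangent d x. \<forall>v\<in>tangent d x. \<phi> (u + v) = \<phi> u + \<phi> v) \<and>
     (\<forall>a. \<forall>u\<in>tangent d x. \<phi> (a \<cdot>\<^sub>v u) = a \<cdot>\<^sub>v \<phi> u) \<and>
     (\<forall>u\<in>tangent d x. vnorm (\<phi> u) = vnorm u)"

definition tangent_Q ::
    "nat \<Rightarrow> (real vec \<Rightarrow> real vec \<Rightarrow> real vec) \<Rightarrow>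
     (real vec \<Rightarrow> real vec \<Rightarrow> real \<Rightarrow> real \<Rightarrow> real vec) \<Rightarrow>
     real vec \<Rightarrow> real vec \<Rightarrow> real vec \<Rightarrow> real \<Rightarrow> real \<Rightarrow> real vec" where
  "tangent_Q d \<phi> Q x u u' y w = inv_into (tangent d x) (\<phi> x) (Q (\<phi> x u) (\<phi> x u') y w)"

subsection \<open>Quantized Riemannian gradient descent\<close>

definition par_sigma :: "real \<Rightarrow> real \<Rightarrow> real \<Rightarrow> real" where
  "par_sigma D \<mu> \<eta> = (if cos D * \<mu> * \<eta> \<le> 1/2 then 1 - cos D * \<mu> * \<eta> else 1/2)"

definition par_K :: "real \<Rightarrow> real" where
  "par_K \<sigma> = 2 / sqrt \<sigma>"

definition par_theta :: "real \<Rightarrow> real" where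
  "par_theta \<sigma> = sqrt \<sigma> * (1 - sqrt \<sigma>) / 4"

definition par_sqrt_xi :: "real \<Rightarrow> real" where
  "par_sqrt_xi \<sigma> = par_theta \<sigma> * par_K \<sigma> + sqrt \<sigma>"

definition par_R :: "real \<Rightarrow> real \<Rightarrow> real \<Rightarrow> nat \<Rightarrow> real" where
  "par_R \<gamma> D \<sigma> t = \<gamma> * par_K \<sigma> * par_sqrt_xi \<sigma> ^ t * D"

(* Quantization parameters y and w of round t, for the messages to the master (up) and for the
   messages from the master (down). *)
definition up_y :: "nat \<Rightarrow> real \<Rightarrow> (nat \<Rightarrow> real) \<Rightarrow> nat \<Rightarrow> real" where
  "up_y n \<gamma> R t = (if t = 0 then 2 * \<gamma> * pi else R t / real n)"

definition up_w :: "nat \<Rightarrow> real \<Rightarrow> (nat \<Rightarrow> real) \<Rightarrow> nat \<Rightarrow> real" where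
  "up_w n \<theta> R t = \<theta> * R t / (2 * real n)"

definition down_y :: "real \<Rightarrow> real \<Rightarrow> (nat \<Rightarrow> real) \<Rightarrow> nat \<Rightarrow> real" where
  "down_y \<gamma> \<theta> R t = (if t = 0 then \<theta> * R 0 / 2 + 2 * \<gamma> * pi else (1 + \<theta> / 2) * R t)"

definition down_w :: "real \<Rightarrow> (nat \<Rightarrow> real) \<Rightarrow> nat \<Rightarrow> real" where
  "down_w \<theta> R t = \<theta> * R t / 2"

(* x t and q t are the iterates and the decoded total gradients, qm t i is what the master
   decodes from machine i. The condition on q 0 says that every machine i, which uses its own
   gradient as reference, decodes the same vector q 0. *)
definition qrgd_run ::
    "nat \<Rightarrow> nat \<Rightarrow> nat \<Rightarrow> (nat \<Rightarrow> real vec \<Rightarrow> real) \<Rightarrow>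
     (real vec \<Rightarrow> real vec \<Rightarrow> real vec \<Rightarrow> real \<Rightarrow> real \<Rightarrow> real vec) \<Rightarrow>
     real \<Rightarrow> real \<Rightarrow> real \<Rightarrow> (nat \<Rightarrow> real) \<Rightarrow> real vec \<Rightarrow>
     (nat \<Rightarrow> real vec) \<Rightarrow> (nat \<Rightarrow> nat \<Rightarrow> real vec) \<Rightarrow> (nat \<Rightarrow> real vec) \<Rightarrow> bool" where
  "qrgd_run d n i\<^sub>0 f QT \<gamma> \<eta> \<theta> R x\<^sub>0 x qm q \<longleftrightarrow>
     (let r = (\<lambda>t. finsum_vec TYPE(real) d (qm t) {..<n}) in
       x 0 = x\<^sub>0 \<and>
       (\<forall>i<n. qm 0 i = QT (x 0) (rgrad d (f i) (x 0)) (rgrad d (f i\<^sub>0) (x 0))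
                         (up_y n \<gamma> R 0) (up_w n \<theta> R 0)) \<and>
       (\<forall>i<n. q 0 = QT (x 0) (r 0) (rgrad d (f i) (x 0)) (down_y \<gamma> \<theta> R 0) (down_w \<theta> R 0)) \<and>
       (\<forall>t. x (Suc t) = sexp (x t) ((- \<eta>) \<cdot>\<^sub>v q t) \<and>
          (\<forall>i<n. qm (Suc t) i =
             QT (x (Suc t)) (rgrad d (f i) (x (Suc t))) (transport d (x t) (x (Suc t)) (qm t i))
                (up_y n \<gamma> R (Suc t)) (up_w n \<theta> R (Suc t))) \<and>
          q (Suc t) =
             QT (x (Suc t)) (r (Suc t)) (transport d (x t) (x (Suc t)) (q t))
                (down_y \<gamma> \<theta> R (Suc t)) (down_w \<theta> R (Suc t))))"

(* Computing x T takes the rounds t < T; in each of them all n machines send one message to the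
   master and the master sends one message to each of the n machines. *)
definition qrgd_bits ::
    "nat \<Rightarrow> (real \<Rightarrow> real \<Rightarrow> nat) \<Rightarrow> real \<Rightarrow> real \<Rightarrow> (nat \<Rightarrow> real) \<Rightarrow> nat \<Rightarrow> nat" where
  "qrgd_bits n b \<gamma> \<theta> R T =
     (\<Sum>t<T. n * b (up_y n \<gamma> R t) (up_w n \<theta> R t) + n * b (down_y \<gamma> \<theta> R t) (down_w \<theta> R t))"

end

(* Comparing a geodesic triangle of the sphere with a Euclidean one, a gradient step of length
   a / \<gamma> multiplies the angle to the leading eigenvector by at most sqrt \<sigma> as long as the overlap
   with it is at least a = c p / sqrt d, and an error e in the gradient adds at most (a / \<gamma>) e.
   The gradient moves by at most a multiple of the step under parallel transport, so the
   transported old vector is a good enough reference for decoding the new one, and by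
   induction both the angle and the quantization errors decay like par_sqrt_xi ^ t. Since
   1 - par_sqrt_xi is at least of order a^2 \<delta> / \<gamma>, this takes O(\<gamma> / (a^2 \<delta>) log (D / \<epsilon>)) rounds,
   in which all ratios y / w are polynomial in n d \<gamma> / (p \<delta>). *)

theory Submission
  imports Defs
begin

section \<open>Geodesics of the unit sphere of an inner product space\<close>

text \<open>Beyond the angle pi/4 the objective is in general not geodesically convex, and D is
  never smaller than that. In place of convexity, write \<Delta> for the suboptimality
  \<open>l - inner x z\<close>: the squared gradient is at most 2 \<gamma> \<Delta>, and the inner
  product of the negative gradient with the direction to the eigenvector is at least 2 \<Delta>
  times the overlap. With overlap at least a, the step a / \<gamma> makes the quadratic term of the
  squared new distance at most half of the linear one, and the gap bounds \<Delta> below by the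
  squared angle. The overlap stays at least a because the angle never exceeds D and cos D = a. Which
  of the two unit eigenvectors is the limit depends on the random start, so the analysis is carried
  out for a fixed one and applied to either sign; the event only bounds the absolute overlap. Half
  of the margin 1 - sqrt \<sigma> pays for the quantization errors, hence the rate
  \<open>par_sqrt_xi\<close>, which equals 1 - (1 - sqrt \<sigma>) / 2.\<close>

lemma sin_ge_chord:
  fixes p r :: real
  assumes "0 \<le> p" "p \<le> r" "0 < r" "r \<le> pi"
  shows "p * sin r \<le> r * sin p"
proof -
  have "convex_on {0..pi} (\<lambda>x. - sin x)"
  proof (rule convex_on_realI)
    show "connected {0..pi}" by simp
    show "((\<lambda>x. - sin x) has_real_derivative - cos x) (at x)" for x
      by (auto intro!: derivative_eq_intros)
    show "- cos x \<le> - cos y" if "x \<in> {0..pi}" "y \<in> {0..pi}" "x \<le> y" for x y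
      using that by (simp add: cos_monotone_0_pi_le)
  qed
  from convex_onD[OF this, of "p / r" 0 r] have "(p / r) * sin r \<le> sin p"
    using assms by simp
  then show ?thesis using assms by (simp add: field_simps)
qed

text \<open>Weaker than the sharp constant 2 / pi, but squared it is exactly what turns the gap
  \<delta> into the \<mu> = \<delta> / 2 of \<open>par_sigma\<close>.\<close>

lemma sin_ge_half:
  fixes \<phi> :: real
  assumes "0 \<le> \<phi>" "\<phi> \<le> pi / 2"
  shows "\<phi> / 2 \<le> sin \<phi>"
proof -
  have "\<phi> \<le> (pi / 2) * sin \<phi>" using sin_ge_chord[of \<phi> "pi / 2"] assms by simp
  also have "\<dots> \<le> 2 * sin \<phi>"
    by (rule mult_right_mono) (use pi_less_4 sin_ge_zero[of \<phi>] assms pi_gt_zero in auto)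
  finally show ?thesis by simp
qed

text \<open>The tangent line of the convex function \<open>z \<mapsto> cos (sqrt z)\<close> at \<open>r\<^sup>2\<close>.\<close>

lemma cos_ge_tangent:
  fixes p r :: real
  assumes "0 \<le> p" "p \<le> pi" "0 < r" "r \<le> pi"
  shows "cos r - sin r / (2 * r) * (p\<^sup>2 - r\<^sup>2) \<le> cos p"
proof -
  define k where "k = (\<lambda>p. cos p + sin r / (2 * r) * p\<^sup>2)"
  have der: "(k has_real_derivative (sin r * s / r - sin s)) (at s)" for s
    unfolding k_def using assms(3) by (auto intro!: derivative_eq_intros simp: field_simps)
  have "k r \<le> k p"
  proof (cases "p \<le> r")
    case True
    show ?thesis
    proof (rule DERIV_nonpos_imp_nonincreasing[OF True, of k])
      fix s assume "p \<le> s" "s \<le> r"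
      then have "sin r * s / r - sin s \<le> 0"
        using sin_ge_chord[of s r] assms by (simp add: field_simps)
      then show "\<exists>y. (k has_real_derivative y) (at s) \<and> y \<le> 0" using der by blast
    qed
  next
    case False
    show ?thesis
    proof (rule DERIV_nonneg_imp_nondecreasing[of r p k])
      show "r \<le> p" using False by simp
    next
      fix s assume "r \<le> s" "s \<le> p"
      then have "sin r * s / r - sin s \<ge> 0"
        using sin_ge_chord[of r s] assms by (simp add: field_simps)
      then show "\<exists>y. (k has_real_derivative y) (at s) \<and> 0 \<le> y" using der by blast
    qed
  qed
  then show ?thesis unfolding k_def by (simp add: algebra_simps)
qed

text \<open>Toponogov's comparison with the Euclidean law of cosines: both sides agree for
  \<open>c = 1\<close> and \<open>c = - 1\<close>, the right one is affine in \<open>c\<close> and the left one convex.\<close>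

lemma cos_law_comparison:
  fixes a b c :: real
  assumes "0 \<le> a" "0 \<le> b" "a + b \<le> pi" "\<bar>c\<bar> \<le> 1"
  shows "cos (sqrt (a\<^sup>2 + b\<^sup>2 - 2 * a * b * c)) \<le> cos a * cos b + c * (sin a * sin b)"
proof -
  define r where "r = sqrt (a\<^sup>2 + b\<^sup>2 - 2 * a * b * c)"
  define t where "t = (1 + c) / 2"
  have c: "c = 2 * t - 1" and t: "0 \<le> t" "t \<le> 1" using assms(4) by (auto simp: t_def field_simps)
  have ab: "0 \<le> a * b" using assms by simp
  have "a * b * c \<le> a * b * 1" by (rule mult_left_mono) (use assms ab in auto)
  moreover have "(a - b)\<^sup>2 = a\<^sup>2 + b\<^sup>2 - 2 * (a * b)" by (simp add: power2_eq_square algebra_simps)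
  ultimately have ge: "a\<^sup>2 + b\<^sup>2 - 2 * a * b * c \<ge> (a - b)\<^sup>2" by simp
  then have ge0: "a\<^sup>2 + b\<^sup>2 - 2 * a * b * c \<ge> 0" by (smt (verit) zero_le_power2)
  have r2: "r\<^sup>2 = a\<^sup>2 + b\<^sup>2 - 2 * a * b * c" using ge0 by (simp add: r_def)
  have r2': "r\<^sup>2 = t * (a - b)\<^sup>2 + (1 - t) * (a + b)\<^sup>2"
    unfolding r2 c by (simp add: power2_eq_square algebra_simps)
  have rhs: "cos a * cos b + c * (sin a * sin b) = t * cos (a - b) + (1 - t) * cos (a + b)"
    unfolding c by (simp add: cos_add cos_diff algebra_simps)
  show ?thesis
  proof (cases "r = 0")
    case True
    then have "(a - b)\<^sup>2 \<le> 0" using ge r2 by simp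
    then have "a = b" by simp
    with r2 True have "a * a * (1 - c) = 0" by (simp add: power2_eq_square algebra_simps)
    then have "c = 1 \<or> a = 0" by auto
    then show ?thesis using \<open>a = b\<close> r2 True unfolding r_def[symmetric]
      by (auto simp: power2_eq_square[symmetric])
  next
    case False
    have "- (a * b) * 1 \<le> a * b * c" using mult_left_mono[of "-1" c "a * b"] ab assms by simp
    then have "r\<^sup>2 \<le> (a + b)\<^sup>2" unfolding r2 by (simp add: power2_eq_square algebra_simps)
    then have r_le: "r \<le> pi" using assms by (meson add_nonneg_nonneg order_trans power2_le_imp_le)
    have r: "0 < r" using False ge0 by (simp add: r_def)
    have 1: "cos r - sin r / (2 * r) * ((a - b)\<^sup>2 - r\<^sup>2) \<le> cos (a - b)"
      using cos_ge_tangent[of "\<bar>a - b\<bar>" r] r r_le assms by (simp add: abs_le_iff)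
    have 2: "cos r - sin r / (2 * r) * ((a + b)\<^sup>2 - r\<^sup>2) \<le> cos (a + b)"
      using cos_ge_tangent[of "a + b" r] r r_le assms by simp
    \<comment> \<open>Average the two tangent-line inequalities with weights \<open>t\<close> and
      \<open>1 - t\<close>: by \<open>r2'\<close> these weights make \<open>r\<^sup>2\<close> the
      mean of the two squares, so the linear terms cancel.\<close>
    have id: "u = t * (u - k * (x - z)) + (1 - t) * (u - k * (y - z)) + k * (t * x + (1 - t) * y - z)"
      for u k x y z :: real by (simp add: algebra_simps)
    have "cos r = t * (cos r - sin r / (2 * r) * ((a - b)\<^sup>2 - r\<^sup>2))
        + (1 - t) * (cos r - sin r / (2 * r) * ((a + b)\<^sup>2 - r\<^sup>2))
        + sin r / (2 * r) * (t * (a - b)\<^sup>2 + (1 - t) * (a + b)\<^sup>2 - r\<^sup>2)"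
      by (rule id)
    also have "\<dots> \<le> t * cos (a - b) + (1 - t) * cos (a + b)"
      using mult_left_mono[OF 1 t(1)] mult_left_mono[OF 2, of "1 - t"] t r2' by simp
    finally show ?thesis unfolding rhs r_def .
  qed
qed

text \<open>At \<open>u = 0\<close> the junk value \<open>x / 0 = 0\<close> makes this \<open>x\<close>.\<close>

definition gexp :: "'a::real_inner \<Rightarrow> 'a \<Rightarrow> 'a" where
  "gexp x u = cos (norm u) *\<^sub>R x + (sin (norm u) / norm u) *\<^sub>R u"

lemma inner_gexp:
  assumes "norm x = 1" "inner x u = 0" "inner x w = 0"
  shows "inner (gexp x u) (gexp x w) =
    cos (norm u) * cos (norm w) + (sin (norm u) / norm u) * (sin (norm w) / norm w) * inner u w"
  using assms unfolding gexp_def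
  by (simp add: inner_simps inner_commute[of u x] norm_eq_1 mult_ac)

lemma norm_gexp:
  assumes "norm x = 1" "inner x u = 0"
  shows "norm (gexp x u) = 1"
proof -
  have "inner (gexp x u) (gexp x u) = 1"
  proof (cases "u = 0")
    case False
    then show ?thesis using inner_gexp[OF assms assms(2)]
      by (simp add: dot_square_norm power2_eq_square[symmetric] power_divide)
  qed (use assms in \<open>simp add: gexp_def norm_eq_1\<close>)
  then show ?thesis by (simp add: norm_eq_1)
qed

text \<open>Positive curvature makes the exponential map non-expanding: this is the comparison above
  for the hinge at \<open>x\<close> with sides \<open>norm u\<close>, \<open>norm w\<close> and
  \<open>c\<close> the cosine of the enclosed angle.\<close>

lemma arccos_inner_gexp_le:
  assumes "norm x = 1" "inner x u = 0" "inner x w = 0" "norm u + norm w \<le> pi"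
  shows "arccos (inner (gexp x u) (gexp x w)) \<le> norm (u - w)"
proof -
  \<comment> \<open>If a side vanishes, division by zero gives \<open>c = 0\<close>, and
    \<open>uw\<close> still holds because both of its sides are 0.\<close>
  define c where "c = inner u w / (norm u * norm w)"
  have uw: "inner u w = norm u * norm w * c"
    by (cases "u = 0 \<or> w = 0") (auto simp: c_def)
  have c: "\<bar>c\<bar> \<le> 1"
    unfolding c_def abs_divide abs_mult abs_norm_cancel
    by (rule divide_le_eq_1[THEN iffD2]) (use Cauchy_Schwarz_ineq2[of u w] in \<open>auto simp: less_le\<close>)
  have "(norm (u - w))\<^sup>2 = (norm u)\<^sup>2 + (norm w)\<^sup>2 - 2 * norm u * norm w * c"
    unfolding power2_norm_eq_inner
    by (simp add: inner_diff_left inner_diff_right inner_commute[of w u] uw)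
  then have nrm: "norm (u - w) = sqrt ((norm u)\<^sup>2 + (norm w)\<^sup>2 - 2 * norm u * norm w * c)"
    using real_sqrt_unique by fastforce
  have "cos (norm (u - w)) \<le> cos (norm u) * cos (norm w) + c * (sin (norm u) * sin (norm w))"
    unfolding nrm by (rule cos_law_comparison) (use assms c in auto)
  also have "\<dots> = inner (gexp x u) (gexp x w)"
    unfolding inner_gexp[OF assms(1-3)] uw by (cases "u = 0 \<or> w = 0") auto
  finally have le: "cos (norm (u - w)) \<le> inner (gexp x u) (gexp x w)" .
  have n: "norm (u - w) \<le> pi" using norm_triangle_ineq4[of u w] assms by linarith
  have "\<bar>inner (gexp x u) (gexp x w)\<bar> \<le> 1"
    using Cauchy_Schwarz_ineq2[of "gexp x u" "gexp x w"] norm_gexp[OF assms(1,2)]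
      norm_gexp[OF assms(1,3)] by simp
  then have "arccos (inner (gexp x u) (gexp x w)) \<le> arccos (cos (norm (u - w)))"
    using le by (intro arccos_le_arccos) auto
  then show ?thesis using n by (simp add: arccos_cos)
qed

text \<open>\<open>w\<close> is the Riemannian logarithm of \<open>v\<close> at \<open>x\<close>:
  the tangential part of \<open>v\<close> times phi / sin phi. This factor is at least 1, so passing
  from \<open>v\<close> to \<open>w\<close> can only increase a nonnegative inner product with a
  tangent vector. The nonnegative overlap keeps \<open>v\<close> away from the antipode of
  \<open>x\<close>.\<close>

lemma gexp_log:
  fixes x v :: "'a::real_inner"
  assumes "norm x = 1" "norm v = 1" "0 \<le> inner x v"
  obtains w where "inner x w = 0" "gexp x w = v" "norm w = arccos (inner x v)"
    "\<And>g. inner x g = 0 \<Longrightarrow> 0 \<le> inner g v \<Longrightarrow> inner g v \<le> inner g w"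
proof -
  define \<phi> where "\<phi> = arccos (inner x v)"
  have le1: "inner x v \<le> 1" using norm_cauchy_schwarz[of x v] assms by simp
  have cos: "cos \<phi> = inner x v" unfolding \<phi>_def using le1 assms by (intro cos_arccos) auto
  have \<phi>: "0 \<le> \<phi>" "\<phi> \<le> pi" unfolding \<phi>_def using le1 assms by (auto intro: arccos_lbound arccos_ubound)
  show thesis
  proof (cases "\<phi> = 0")
    case True
    then have "inner x v = 1" using cos by simp
    then have "norm (x - v) ^ 2 = 0" using assms unfolding power2_norm_eq_inner norm_eq_1
      by (simp add: inner_diff_left inner_diff_right inner_commute[of v x])
    then have "v = x" by simp
    show thesis
      by (rule that[of 0]) (use \<open>v = x\<close> True assms in \<open>auto simp: gexp_def \<phi>_def inner_commute\<close>)
  next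
    case False
    have "\<phi> \<le> pi / 2" unfolding \<phi>_def using assms le1 by (intro arccos_le_pi2) auto
    then have s: "0 < sin \<phi>" using \<phi> False by (intro sin_gt_zero) auto
    define y where "y = v - cos \<phi> *\<^sub>R x"
    define w where "w = (\<phi> / sin \<phi>) *\<^sub>R y"
    have xy: "inner x y = 0" unfolding y_def using assms cos by (simp add: inner_simps norm_eq_1)
    have "inner y y = 1 - (cos \<phi>)\<^sup>2" unfolding y_def using assms cos
      by (simp add: inner_simps norm_eq_1 inner_commute[of v x] power2_eq_square)
    then have "inner y y = (sin \<phi>)\<^sup>2" by (simp add: sin_squared_eq)
    then have ny: "norm y = sin \<phi>" using s by (simp add: norm_eq_sqrt_inner)
    have nw: "norm w = \<phi>" unfolding w_def using ny s \<phi> by simp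
    show thesis
    proof (rule that[of w])
      show "inner x w = 0" unfolding w_def using xy by simp
      show "gexp x w = v" unfolding gexp_def nw using s False by (simp add: w_def y_def)
      show "norm w = arccos (inner x v)" using nw \<phi>_def by simp
      fix g assume g: "inner x g = 0" "0 \<le> inner g v"
      have "inner g w = (\<phi> / sin \<phi>) * inner g v"
        unfolding w_def y_def using g by (simp add: inner_simps inner_commute[of g x])
      moreover have "1 \<le> \<phi> / sin \<phi>" using s sin_x_le_x[OF \<phi>(1)] by simp
      ultimately show "inner g v \<le> inner g w" using mult_right_mono[OF _ g(2), of 1 "\<phi> / sin \<phi>"] by simp
    qed
  qed
qed

text \<open>The Riemannian gradient at \<open>x\<close> of \<open>x \<mapsto> - (A x \<bullet> x)\<close>, where \<open>z\<close> is \<open>A x\<close>.\<close>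

definition rayleigh_grad :: "'a::real_inner \<Rightarrow> 'a \<Rightarrow> 'a" where
  "rayleigh_grad x z = - 2 *\<^sub>R (z - inner x z *\<^sub>R x)"

lemma inner_rayleigh_grad: "norm x = 1 \<Longrightarrow> inner x (rayleigh_grad x z) = 0"
  by (simp add: rayleigh_grad_def inner_simps norm_eq_1)

lemma norm_rayleigh_grad_sq:
  assumes "norm x = 1"
  shows "(norm (rayleigh_grad x z))\<^sup>2 = 4 * (inner z z - (inner x z)\<^sup>2)"
  unfolding power2_norm_eq_inner rayleigh_grad_def using assms
  by (simp add: inner_simps norm_eq_1 inner_commute[of z x] power2_eq_square algebra_simps)

lemma norm_rayleigh_grad_le:
  assumes "norm x = 1"
  shows "norm (rayleigh_grad x z) \<le> 2 * norm z"
proof (rule power2_le_imp_le)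
  show "(norm (rayleigh_grad x z))\<^sup>2 \<le> (2 * norm z)\<^sup>2"
    unfolding norm_rayleigh_grad_sq[OF assms] by (simp add: power_mult_distrib dot_square_norm)
qed simp

text \<open>Collects the scalar consequences of the spectrum of a matrix A at a single point,
  \<open>z\<close> standing for A x, so that the estimates of one step involve no matrices.
  \<open>rayleigh_step_of_gap\<close> derives them from the spectral gap.\<close>

locale rayleigh_step =
  fixes x v z :: "'a::real_inner" and l \<delta> \<gamma> :: real
  assumes unit: "norm x = 1" "norm v = 1"
    and overlap: "0 \<le> inner x v"
    and eigen: "inner z v = l * inner x v"
    and gap: "\<delta> * (1 - (inner x v)\<^sup>2) \<le> l - inner x z"
    and psd: "l * (inner x v)\<^sup>2 \<le> inner x z" "inner z z \<le> l * inner x z"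
    and l: "0 \<le> l" "2 * l \<le> \<gamma>" and \<delta>: "0 < \<delta>"
begin

definition "\<phi> = arccos (inner x v)"

lemma overlap_le: "inner x v \<le> 1" using norm_cauchy_schwarz[of x v] unit by simp

lemma cos_\<phi>: "cos \<phi> = inner x v"
  unfolding \<phi>_def using overlap overlap_le by (intro cos_arccos) auto

lemma \<phi>: "0 \<le> \<phi>" "\<phi> \<le> pi / 2"
  unfolding \<phi>_def using overlap overlap_le arccos_le_pi2[of "inner x v"] arccos_lbound[of "inner x v"] by auto

lemma sin2: "1 - (inner x v)\<^sup>2 = (sin \<phi>)\<^sup>2"
  using sin_squared_eq[of \<phi>] cos_\<phi> by simp

lemma deficit_nonneg: "0 \<le> l - inner x z"
proof -
  have "0 \<le> \<delta> * (1 - (inner x v)\<^sup>2)" unfolding sin2 using \<delta> by simp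
  then show ?thesis using gap by linarith
qed

text \<open>The squared gradient of a smooth function is controlled by the suboptimality. Here this
  comes from \<open>psd(2)\<close>: subtracting \<open>(inner x z)^2\<close> from both sides leaves
  \<open>inner x z\<close> times the deficit.\<close>

lemma norm_grad_sq_le: "(norm (rayleigh_grad x z))\<^sup>2 \<le> 4 * l * (l - inner x z)"
proof -
  have "inner z z - (inner x z)\<^sup>2 \<le> inner x z * (l - inner x z)"
    using psd(2) by (simp add: power2_eq_square algebra_simps)
  also have "\<dots> \<le> l * (l - inner x z)"
    using deficit_nonneg by (intro mult_right_mono) auto
  finally show ?thesis unfolding norm_rayleigh_grad_sq[OF unit(1)] by simp
qed

text \<open>By \<open>psd(1)\<close> the deficit is at most l times the squared sine of the angle.
  Bounding the gradient by the angle lets the quantization radii shrink together with the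
  angle.\<close>

lemma norm_grad_le: "norm (rayleigh_grad x z) \<le> \<gamma> * \<phi>"
proof (rule power2_le_imp_le)
  have "l - inner x z \<le> l * (1 - (inner x v)\<^sup>2)" using psd(1) by (simp add: algebra_simps)
  then have "4 * l * (l - inner x z) \<le> 4 * l * (l * (sin \<phi>)\<^sup>2)"
    unfolding sin2 using l by (intro mult_left_mono) auto
  also have "\<dots> = (2 * l * sin \<phi>)\<^sup>2" by (simp add: power2_eq_square)
  also have "\<dots> \<le> (\<gamma> * \<phi>)\<^sup>2"
    using l \<phi> sin_x_le_x[OF \<phi>(1)] sin_ge_zero[of \<phi>] pi_gt_zero
    by (intro power_mono mult_mono) auto
  finally show "(norm (rayleigh_grad x z))\<^sup>2 \<le> (\<gamma> * \<phi>)\<^sup>2" using norm_grad_sq_le by linarith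
  show "0 \<le> \<gamma> * \<phi>" using l \<phi> by simp
qed

text \<open>Compare the triangle with vertices \<open>x\<close>, \<open>v\<close> and the next iterate with a Euclidean one.\<close>

lemma contraction:
  assumes a: "0 \<le> a" "a \<le> inner x v" and \<eta>: "0 \<le> \<eta>" "\<eta> * \<gamma> = a"
    and q: "inner x q = 0" and small: "\<eta> * norm q + \<phi> \<le> pi"
  shows "arccos (inner (gexp x (- \<eta> *\<^sub>R q)) v) \<le>
    sqrt (1 - a * (\<delta> / 2) * \<eta>) * \<phi> + \<eta> * norm (q - rayleigh_grad x z)"
proof -
  define g where "g = - rayleigh_grad x z"
  define \<Delta> where "\<Delta> = l - inner x z"
  have \<Delta>: "0 \<le> \<Delta>" using deficit_nonneg \<Delta>_def by simp
  have xg: "inner x g = 0" unfolding g_def using inner_rayleigh_grad[OF unit(1)] by simp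
  \<comment> \<open>This identity, together with the lower bound on the overlap, takes the place of
    geodesic convexity.\<close>
  have gv: "inner g v = 2 * \<Delta> * inner x v"
    unfolding g_def rayleigh_grad_def \<Delta>_def using eigen by (simp add: inner_simps algebra_simps)
  obtain w where w: "inner x w = 0" "gexp x w = v" "norm w = \<phi>"
    "inner g v \<le> inner g w"
    using gexp_log[OF unit overlap] xg gv \<Delta> overlap unfolding \<phi>_def by (metis mult_nonneg_nonneg zero_le_numeral)
  have "(norm (\<eta> *\<^sub>R g - w))\<^sup>2 = \<eta>\<^sup>2 * (norm g)\<^sup>2 + \<phi>\<^sup>2 - 2 * \<eta> * inner g w"
    unfolding power2_norm_eq_inner w(3)[symmetric]
    by (simp add: inner_simps inner_commute[of w g] power2_eq_square algebra_simps)
  also have "\<dots> \<le> \<eta>\<^sup>2 * (2 * \<gamma> * \<Delta>) + \<phi>\<^sup>2 - 2 * \<eta> * (2 * \<Delta> * inner x v)"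
  proof -
    have "4 * l * \<Delta> \<le> 2 * \<gamma> * \<Delta>" using l \<Delta> by (intro mult_right_mono) auto
    then have "(norm g)\<^sup>2 \<le> 2 * \<gamma> * \<Delta>" using norm_grad_sq_le unfolding g_def \<Delta>_def by simp
    then have "\<eta>\<^sup>2 * (norm g)\<^sup>2 \<le> \<eta>\<^sup>2 * (2 * \<gamma> * \<Delta>)" by (rule mult_left_mono) simp
    moreover have "2 * \<eta> * (2 * \<Delta> * inner x v) \<le> 2 * \<eta> * inner g w"
      using w(4) \<eta> unfolding gv by (intro mult_left_mono) auto
    ultimately show ?thesis by linarith
  qed
  \<comment> \<open>The choice of the step enters here: as \<open>\<eta> * \<gamma> = a\<close>, the
    quadratic term is \<open>2 * \<eta> * \<Delta> * a\<close>, half of what the linear term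
    provides at overlap \<open>a\<close>.\<close>
  also have "\<dots> = \<phi>\<^sup>2 + 2 * \<eta> * \<Delta> * (a - 2 * inner x v)"
    unfolding \<eta>(2)[symmetric] by (simp add: power2_eq_square algebra_simps)
  also have "\<dots> \<le> \<phi>\<^sup>2 + 2 * \<eta> * \<Delta> * (- a)"
    using a \<eta> \<Delta> by (intro add_left_mono mult_left_mono) auto
  also have "\<dots> \<le> \<phi>\<^sup>2 + 2 * \<eta> * (\<delta> * (\<phi>\<^sup>2 / 4)) * (- a)"
  proof -
    have "(\<phi> / 2)\<^sup>2 \<le> (sin \<phi>)\<^sup>2" using sin_ge_half[OF \<phi>] \<phi> by (intro power_mono) auto
    then have "\<delta> * (\<phi>\<^sup>2 / 4) \<le> \<delta> * (sin \<phi>)\<^sup>2"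
      using \<delta> by (intro mult_left_mono) (auto simp: power_divide)
    then have "\<delta> * (\<phi>\<^sup>2 / 4) \<le> \<Delta>" using gap unfolding sin2 \<Delta>_def by linarith
    then have "2 * \<eta> * (\<delta> * (\<phi>\<^sup>2 / 4)) * a \<le> 2 * \<eta> * \<Delta> * a"
      using \<eta> a by (intro mult_right_mono mult_left_mono) auto
    then show ?thesis by simp
  qed
  also have "\<dots> = (1 - a * (\<delta> / 2) * \<eta>) * \<phi>\<^sup>2" by (simp add: algebra_simps)
  finally have "norm (\<eta> *\<^sub>R g - w) \<le> sqrt ((1 - a * (\<delta> / 2) * \<eta>) * \<phi>\<^sup>2)"
    by (rule real_le_rsqrt)
  then have 1: "norm (\<eta> *\<^sub>R g - w) \<le> sqrt (1 - a * (\<delta> / 2) * \<eta>) * \<phi>"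
    using \<phi> by (simp add: real_sqrt_mult)
  \<comment> \<open>The comparison is applied to the actual direction \<open>q\<close>; its error is
    then split off linearly inside the tangent space, where the triangle inequality is
    Euclidean.\<close>
  have "arccos (inner (gexp x (- \<eta> *\<^sub>R q)) (gexp x w)) \<le> norm (- \<eta> *\<^sub>R q - w)"
    by (rule arccos_inner_gexp_le) (use unit q w \<eta> small in auto)
  also have "- \<eta> *\<^sub>R q - w = (\<eta> *\<^sub>R g - w) - \<eta> *\<^sub>R (q - rayleigh_grad x z)"
    unfolding g_def by (simp add: algebra_simps)
  also have "norm \<dots> \<le> norm (\<eta> *\<^sub>R g - w) + \<eta> * norm (q - rayleigh_grad x z)"
    using norm_triangle_ineq4[of "\<eta> *\<^sub>R g - w" "\<eta> *\<^sub>R (q - rayleigh_grad x z)"] \<eta> by simp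
  finally show ?thesis using 1 w(2) by simp
qed

end

text \<open>Parallel transport in closed form along the geodesic with initial velocity
  \<open>l\<close>: the component of \<open>u\<close> along \<open>l\<close> turns in the plane of
  \<open>x\<close> and \<open>l\<close>, the rest stays fixed. For \<open>l = 0\<close>, division by
  zero makes it the identity.\<close>

definition ptrans :: "'a::real_inner \<Rightarrow> 'a \<Rightarrow> 'a \<Rightarrow> 'a" where
  "ptrans x l u = u + (inner l u / norm l) *\<^sub>R
     (((cos (norm l) - 1) / norm l) *\<^sub>R l - sin (norm l) *\<^sub>R x)"

lemma ptrans_diff: "ptrans x l (u - w) = ptrans x l u - ptrans x l w"
  by (simp add: ptrans_def inner_simps diff_divide_distrib algebra_simps)

lemma norm_ptrans:
  assumes "norm x = 1" "inner x l = 0" "inner x u = 0"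
  shows "norm (ptrans x l u) = norm u"
proof (cases "l = 0")
  case False
  define e where "e = l /\<^sub>R norm l"
  define C S where "C = cos (norm l)" and "S = sin (norm l)"
  have e: "inner e e = 1" "inner x e = 0" "inner e x = 0" "inner x x = 1" using assms False
    by (auto simp: e_def norm_eq_1 dot_square_norm power2_eq_square inner_commute)
  have P: "ptrans x l u = u + inner e u *\<^sub>R ((C - 1) *\<^sub>R e - S *\<^sub>R x)"
    using False by (simp add: ptrans_def e_def C_def S_def divide_inverse algebra_simps)
  have CS: "C * C + S * S = 1" by (simp add: C_def S_def)
  have "inner (ptrans x l u) (ptrans x l u) =
      inner u u + inner e u * inner e u * (C * C + S * S - 1)"
    unfolding P using e assms(3)
    by (simp add: inner_simps inner_commute[of u x] inner_commute[of u e] algebra_simps)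
  then show ?thesis unfolding CS by (simp add: norm_eq_sqrt_inner)
qed (simp add: ptrans_def)

text \<open>A chord is no longer than its arc: the left side is the squared distance of two unit
  vectors at angle \<psi>.\<close>

lemma two_minus_cos_le: "2 - 2 * cos \<psi> \<le> (\<psi>::real)\<^sup>2"
proof -
  have "\<bar>sin (\<psi> / 2)\<bar> \<le> \<bar>\<psi> / 2\<bar>" by (rule abs_sin_x_le_abs_x)
  then have "(sin (\<psi> / 2))\<^sup>2 \<le> (\<psi> / 2)\<^sup>2" by (simp only: abs_le_square_iff)
  moreover have "cos \<psi> = 1 - 2 * (sin (\<psi> / 2))\<^sup>2" using cos_double_sin[of "\<psi> / 2"] by simp
  ultimately show ?thesis by (simp add: power_divide)
qed

text \<open>Parallel transport along the geodesic is the restriction of the rotation \<open>Rot\<close> of the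
  ambient space that moves \<open>x\<close> to \<open>y\<close>, and \<open>Rot\<close> is within \<open>norm l\<close> of the identity.\<close>

lemma rayleigh_grad_lipschitz:
  assumes x: "norm x = 1" "inner x l = 0"
    and "norm (zy - zx) \<le> \<Lambda> * norm (gexp x l - x)" "norm zx \<le> \<Lambda>"
  shows "norm (rayleigh_grad (gexp x l) zy - ptrans x l (rayleigh_grad x zx)) \<le> 4 * \<Lambda> * norm l"
proof (cases "l = 0")
  case True
  then have "zy = zx" using assms(3) by (simp add: gexp_def)
  then show ?thesis using True by (simp add: gexp_def ptrans_def)
next
  case False
  define e where "e = l /\<^sub>R norm l"
  define \<psi> where "\<psi> = norm l"
  define y where "y = gexp x l"
  define C S where "C = cos \<psi>" and "S = sin \<psi>"
  have CS: "C * C + S * S = 1" by (simp add: C_def S_def)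
  have e: "inner e e = 1" "inner x e = 0" "inner x x = 1" "inner e x = 0" using x False
    by (auto simp: e_def norm_eq_1 dot_square_norm power2_eq_square inner_commute)
  have P: "ptrans x l u = u + inner e u *\<^sub>R ((C - 1) *\<^sub>R e - S *\<^sub>R x)" for u
    using False by (simp add: ptrans_def e_def \<psi>_def C_def S_def divide_inverse algebra_simps)
  have y: "y = C *\<^sub>R x + S *\<^sub>R e"
    using False by (simp add: y_def gexp_def e_def \<psi>_def C_def S_def divide_inverse)
  have ny: "norm y = 1" unfolding y_def by (rule norm_gexp[OF x])
  define Rot where "Rot = (\<lambda>u. u + inner e u *\<^sub>R ((C - 1) *\<^sub>R e - S *\<^sub>R x)
     + inner x u *\<^sub>R ((C - 1) *\<^sub>R x + S *\<^sub>R e))"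
  have yR: "inner y (Rot zx) = inner x zx"
  proof -
    have "inner y (Rot zx) = inner x zx * (C * C + S * S)"
      unfolding y Rot_def by (simp add: inner_simps e algebra_simps)
    then show ?thesis unfolding CS by simp
  qed
  \<comment> \<open>\<open>Rot\<close> is orthogonal and sends \<open>x\<close> to \<open>y\<close>,
    so the transported gradient is the gradient at \<open>y\<close> built from
    \<open>Rot zx\<close>; linearity of \<open>rayleigh_grad y\<close> then merges the difference
    into a single gradient.\<close>
  have "ptrans x l (rayleigh_grad x zx) = - 2 *\<^sub>R (Rot zx - inner y (Rot zx) *\<^sub>R y)"
    unfolding yR unfolding P rayleigh_grad_def Rot_def y
    by (simp add: inner_simps e algebra_simps)
  then have eq: "rayleigh_grad y zy - ptrans x l (rayleigh_grad x zx) = rayleigh_grad y (zy - Rot zx)"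
    unfolding rayleigh_grad_def by (simp add: inner_simps algebra_simps)
  have yx: "norm (y - x) \<le> \<psi>"
  proof (rule power2_le_imp_le)
    have "(norm (y - x))\<^sup>2 = inner y y + inner x x - 2 * inner y x"
      unfolding power2_norm_eq_inner by (simp add: inner_simps inner_commute[of x y])
    also have "\<dots> = 2 - 2 * C" using ny e by (simp add: norm_eq_1 y inner_simps)
    finally show "(norm (y - x))\<^sup>2 \<le> \<psi>\<^sup>2" using two_minus_cos_le[of \<psi>] by (simp add: C_def)
  qed (simp add: \<psi>_def)
  have \<Lambda>: "0 \<le> \<Lambda>" using assms(4) norm_ge_zero order_trans by blast
  have R: "norm (Rot zx - zx) \<le> \<psi> * norm zx"
  proof (rule power2_le_imp_le)
    \<comment> \<open>The part of \<open>zx\<close> orthogonal to the plane in which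
      \<open>Rot\<close> acts; its nonnegative squared norm yields Bessel's inequality for the two
      coordinates that move.\<close>
    define p where "p = zx - inner e zx *\<^sub>R e - inner x zx *\<^sub>R x"
    have "0 \<le> inner p p" by simp
    also have "inner p p = inner zx zx - ((inner e zx)\<^sup>2 + (inner x zx)\<^sup>2)"
      unfolding p_def using e
      by (simp add: inner_simps inner_commute[of zx e] inner_commute[of zx x] power2_eq_square algebra_simps)
    finally have bessel: "(inner e zx)\<^sup>2 + (inner x zx)\<^sup>2 \<le> (norm zx)\<^sup>2"
      by (simp add: power2_norm_eq_inner)
    have "(norm (Rot zx - zx))\<^sup>2 =
        (C * C + S * S + 1 - 2 * C) * ((inner e zx)\<^sup>2 + (inner x zx)\<^sup>2)"
      unfolding power2_norm_eq_inner Rot_def using e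
      by (simp add: inner_simps power2_eq_square algebra_simps)
    also have "\<dots> \<le> \<psi>\<^sup>2 * (norm zx)\<^sup>2"
      unfolding CS using bessel two_minus_cos_le[of \<psi>] by (intro mult_mono) (auto simp: C_def)
    finally show "(norm (Rot zx - zx))\<^sup>2 \<le> (\<psi> * norm zx)\<^sup>2" by (simp add: power_mult_distrib)
  qed (simp add: \<psi>_def)
  have "norm (rayleigh_grad y (zy - Rot zx)) \<le> 2 * norm (zy - Rot zx)"
    by (rule norm_rayleigh_grad_le[OF ny])
  also have "norm (zy - Rot zx) \<le> norm (zy - zx) + norm (Rot zx - zx)"
    using norm_triangle_ineq4[of "zy - zx" "Rot zx - zx"] by simp
  also have "\<dots> \<le> \<Lambda> * \<psi> + \<psi> * \<Lambda>"
  proof (rule add_mono)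
    show "norm (zy - zx) \<le> \<Lambda> * \<psi>"
      using assms(3) mult_left_mono[OF yx \<Lambda>] unfolding y_def[symmetric] by linarith
    show "norm (Rot zx - zx) \<le> \<psi> * \<Lambda>"
      using R mult_left_mono[OF assms(4), of \<psi>] by (simp add: \<psi>_def)
  qed
  finally show ?thesis unfolding y_def[symmetric] eq \<psi>_def by simp
qed

section \<open>Vectors of all dimensions in one inner product space\<close>

text \<open>The dimension of a vector of Jordan_Normal_Form is a value, so these vectors do not form a
  type of class \<open>real_inner\<close>. Padding with zeros embeds them isometrically into the finitely
  supported sequences, which do.\<close>

typedef fin_seq = "{f :: nat \<Rightarrow> real. finite {k. f k \<noteq> 0}}"
  morphisms coord Fin_Seq
  by (rule exI[of _ "\<lambda>_. 0"]) simp

lemma finite_support: "finite {k. coord x k \<noteq> 0}" using coord by simp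

lemma coord_Fin_Seq: "finite {k. f k \<noteq> 0} \<Longrightarrow> coord (Fin_Seq f) = f"
  by (simp add: Fin_Seq_inverse)

lemma fin_seq_eqI: "(\<And>k. coord x k = coord y k) \<Longrightarrow> x = y"
  by (metis coord_inject ext)

instantiation fin_seq :: real_inner
begin

definition "0 = Fin_Seq (\<lambda>_. 0)"
definition "x + y = Fin_Seq (\<lambda>k. coord x k + coord y k)"
definition "- x = Fin_Seq (\<lambda>k. - coord x k)"
definition "x - y = Fin_Seq (\<lambda>k. coord x k - coord y k)"
definition "r *\<^sub>R x = Fin_Seq (\<lambda>k. r * coord x k)"
definition "inner x y = (\<Sum>k\<in>{k. coord x k \<noteq> 0}. coord x k * coord y k)" for x y :: fin_seq
definition "norm x = sqrt (inner x x)" for x :: fin_seq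
definition "dist x y = norm (x - y)" for x y :: fin_seq
definition "sgn x = inverse (norm x) *\<^sub>R x" for x :: fin_seq
definition [code del]:
  "(uniformity :: (fin_seq \<times> fin_seq) filter) = (INF e\<in>{0<..}. principal {(x, y). dist x y < e})"
definition [code del]:
  "open (U :: fin_seq set) \<longleftrightarrow> (\<forall>x\<in>U. eventually (\<lambda>(x', y). x' = x \<longrightarrow> y \<in> U) uniformity)"

lemma coord_simps:
  "coord 0 k = 0" "coord (x + y) k = coord x k + coord y k" "coord (- x) k = - coord x k"
  "coord (x - y) k = coord x k - coord y k" "coord (r *\<^sub>R x) k = r * coord x k"
proof -
  have xy: "finite ({k. coord x k \<noteq> 0} \<union> {k. coord y k \<noteq> 0})" using finite_support by simp
  show "coord 0 k = 0" by (simp add: zero_fin_seq_def coord_Fin_Seq)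
  show "coord (x + y) k = coord x k + coord y k" unfolding plus_fin_seq_def
    by (subst coord_Fin_Seq) (auto intro: finite_subset[OF _ xy])
  show "coord (- x) k = - coord x k" unfolding uminus_fin_seq_def
    by (subst coord_Fin_Seq) (auto intro: finite_subset[OF _ xy])
  show "coord (x - y) k = coord x k - coord y k" unfolding minus_fin_seq_def
    by (subst coord_Fin_Seq) (auto intro: finite_subset[OF _ xy])
  show "coord (r *\<^sub>R x) k = r * coord x k" unfolding scaleR_fin_seq_def
    by (subst coord_Fin_Seq) (auto intro: finite_subset[OF _ xy])
qed

lemma inner_fin_seq:
  assumes "finite K" "{k. coord x k \<noteq> 0} \<subseteq> K"
  shows "inner x y = (\<Sum>k\<in>K. coord x k * coord y k)"
  unfolding inner_fin_seq_def by (rule sum.mono_neutral_left) (use assms in auto)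

instance
proof
  fix x y z :: fin_seq and r s :: real
  show "x + y + z = x + (y + z)" "x + y = y + x" "0 + x = x" "- x + x = 0" "x - y = x + - y"
    "r *\<^sub>R (x + y) = r *\<^sub>R x + r *\<^sub>R y" "(r + s) *\<^sub>R x = r *\<^sub>R x + s *\<^sub>R x"
    "r *\<^sub>R s *\<^sub>R x = (r * s) *\<^sub>R x" "1 *\<^sub>R x = x"
    by (rule fin_seq_eqI; simp add: coord_simps algebra_simps)+
  define K where "K = {k. coord x k \<noteq> 0} \<union> {k. coord y k \<noteq> 0}"
  have K: "finite K" using finite_support by (simp add: K_def)
  have i: "inner u w = (\<Sum>k\<in>K. coord u k * coord w k)" if "{k. coord u k \<noteq> 0} \<subseteq> K" for u w
    by (rule inner_fin_seq[OF K that])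
  show "inner x y = inner y x"
    using i[of x y] i[of y x] by (simp add: K_def mult.commute)
  show "inner (x + y) z = inner x z + inner y z"
  proof -
    have "{k. coord (x + y) k \<noteq> 0} \<subseteq> K" by (auto simp: K_def coord_simps)
    from i[OF this, of z] show ?thesis using i[of x z] i[of y z]
      by (simp add: K_def coord_simps sum.distrib distrib_right)
  qed
  show "inner (r *\<^sub>R x) y = r * inner x y"
  proof -
    have "{k. coord (r *\<^sub>R x) k \<noteq> 0} \<subseteq> K" by (auto simp: K_def coord_simps)
    from i[OF this, of y] show ?thesis using i[of x y]
      by (simp add: K_def coord_simps sum_distrib_left mult.assoc)
  qed
  show "0 \<le> inner x x" unfolding inner_fin_seq_def by (rule sum_nonneg) simp
  show "inner x x = 0 \<longleftrightarrow> x = 0"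
  proof
    assume "inner x x = 0"
    then have "\<forall>k\<in>{k. coord x k \<noteq> 0}. coord x k * coord x k = 0"
      unfolding inner_fin_seq_def by (subst (asm) sum_nonneg_eq_0_iff) (auto simp: finite_support)
    then show "x = 0" by (intro fin_seq_eqI) (auto simp: coord_simps)
  qed (simp add: inner_fin_seq_def coord_simps)
qed (simp_all add: norm_fin_seq_def dist_fin_seq_def sgn_fin_seq_def uniformity_fin_seq_def
    open_fin_seq_def)

end

section \<open>Zero padding as an isometric embedding\<close>

definition pad :: "real vec \<Rightarrow> fin_seq" where
  "pad v = Fin_Seq (\<lambda>k. if k < dim_vec v then v $ k else 0)"

lemma coord_pad: "coord (pad v) k = (if k < dim_vec v then v $ k else 0)"
  unfolding pad_def by (subst coord_Fin_Seq) (auto intro: finite_subset[of _ "{..<dim_vec v}"])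

lemma pad_add: "u \<in> carrier_vec d \<Longrightarrow> w \<in> carrier_vec d \<Longrightarrow> pad (u + w) = pad u + pad w"
  by (rule fin_seq_eqI) (auto simp: coord_pad coord_simps)

lemma pad_diff: "u \<in> carrier_vec d \<Longrightarrow> w \<in> carrier_vec d \<Longrightarrow> pad (u - w) = pad u - pad w"
  by (rule fin_seq_eqI) (auto simp: coord_pad coord_simps)

lemma pad_smult [simp]: "pad (a \<cdot>\<^sub>v u) = a *\<^sub>R pad u"
  by (rule fin_seq_eqI) (auto simp: coord_pad coord_simps)

lemma pad_uminus [simp]: "pad (- u) = - pad u"
  by (rule fin_seq_eqI) (auto simp: coord_pad coord_simps)

lemma pad_zero [simp]: "pad (0\<^sub>v d) = 0"
  by (rule fin_seq_eqI) (auto simp: coord_pad coord_simps)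

lemma inner_pad:
  assumes "u \<in> carrier_vec d" "w \<in> carrier_vec d"
  shows "inner (pad u) (pad w) = u \<bullet> w"
proof -
  have "inner (pad u) (pad w) = (\<Sum>k\<in>{0..<d}. coord (pad u) k * coord (pad w) k)"
    by (rule inner_fin_seq) (use assms in \<open>auto simp: coord_pad split: if_splits\<close>)
  then show ?thesis using assms by (simp add: scalar_prod_def coord_pad)
qed

lemma norm_pad: "norm (pad u) = vnorm u"
  unfolding norm_eq_sqrt_inner vnorm_def by (subst inner_pad[OF carrier_vec_dim_vec carrier_vec_dim_vec]) simp

lemma pad_inject:
  assumes "u \<in> carrier_vec d" "w \<in> carrier_vec d"
  shows "pad u = pad w \<longleftrightarrow> u = w"
proof
  assume "pad u = pad w"
  then have "coord (pad u) k = coord (pad w) k" for k by simp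
  then have "(if k < d then u $ k else 0) = (if k < d then w $ k else 0)" for k
    using assms by (simp add: coord_pad)
  then have "u $ k = w $ k" if "k < d" for k using that by metis
  then show "u = w" using assms by (intro eq_vecI) auto
qed simp

lemma pad_finsum:
  assumes "finite I" "\<And>i. i \<in> I \<Longrightarrow> f i \<in> carrier_vec d"
  shows "pad (finsum_vec TYPE(real) d f I) = (\<Sum>i\<in>I. pad (f i))"
  using assms
proof (induction I)
  case (insert i I)
  have "finsum_vec TYPE(real) d f I \<in> carrier_vec d"
    by (rule finsum_vec_closed) (use insert in auto)
  moreover have "finsum_vec TYPE(real) d f (insert i I) = f i + finsum_vec TYPE(real) d f I"
    by (rule finsum_vec_insert) (use insert in auto)
  ultimately show ?case using insert by (simp add: pad_add[of _ d])
qed (simp add: finsum_vec_empty)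

lemma usphere_iff: "x \<in> usphere d \<longleftrightarrow> x \<in> carrier_vec d \<and> norm (pad x) = 1"
  by (simp add: usphere_def norm_pad)

lemma tangent_iff:
  "x \<in> carrier_vec d \<Longrightarrow> u \<in> tangent d x \<longleftrightarrow> u \<in> carrier_vec d \<and> inner (pad x) (pad u) = 0"
  by (auto simp: tangent_def inner_pad[of x d])

lemma sdist_pad:
  "x \<in> carrier_vec d \<Longrightarrow> y \<in> carrier_vec d \<Longrightarrow> sdist x y = arccos (inner (pad x) (pad y))"
  by (simp add: sdist_def inner_pad[of x d])

lemma pad_tproj:
  "x \<in> carrier_vec d \<Longrightarrow> u \<in> carrier_vec d \<Longrightarrow>
    pad (tproj x u) = pad u - inner (pad x) (pad u) *\<^sub>R pad x"
  by (simp add: tproj_def pad_diff[of _ d] inner_pad[of _ d])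

lemma sexp_carrier: "x \<in> carrier_vec d \<Longrightarrow> u \<in> carrier_vec d \<Longrightarrow> sexp x u \<in> carrier_vec d"
  by (simp add: sexp_def)

lemma pad_sexp:
  assumes "x \<in> carrier_vec d" "u \<in> carrier_vec d"
  shows "pad (sexp x u) = gexp (pad x) (pad u)"
  using assms by (auto simp: sexp_def gexp_def norm_pad pad_add[of _ d])

lemma sexp_usphere:
  assumes "x \<in> usphere d" "u \<in> tangent d x"
  shows "sexp x u \<in> usphere d"
  using assms norm_gexp[of "pad x" "pad u"]
  by (auto simp: usphere_iff tangent_iff pad_sexp[of x d] sexp_carrier)

section \<open>Parallel transport along minimal geodesics, from its differential equation to the
  closed form\<close>

definition vptrans :: "real vec \<Rightarrow> real vec \<Rightarrow> real vec \<Rightarrow> real vec" where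
  "vptrans x l u = u + ((l \<bullet> u) / vnorm l) \<cdot>\<^sub>v
     (((cos (vnorm l) - 1) / vnorm l) \<cdot>\<^sub>v l - sin (vnorm l) \<cdot>\<^sub>v x)"

lemma pad_vptrans:
  assumes "x \<in> carrier_vec d" "l \<in> carrier_vec d" "u \<in> carrier_vec d"
  shows "pad (vptrans x l u) = ptrans (pad x) (pad l) (pad u)"
  using assms by (simp add: vptrans_def ptrans_def norm_pad pad_add[of _ d] pad_diff[of _ d] inner_pad[of _ d])

text \<open>The squared distance of two parallel fields is constant: their derivatives are normal to
  the sphere, while their difference is tangent.\<close>

lemma parallel_unique:
  assumes V: "parallel_along d g V" and V': "parallel_along d g V'"
    and g: "\<And>s. g s \<in> carrier_vec d" and eq: "V 0 = V' 0"
  shows "V 1 = V' 1"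
proof -
  define W where "W = (\<lambda>s. \<Sum>k<d. (V s $ k - V' s $ k)\<^sup>2)"
  have "(W has_real_derivative 0) (at s within {0..1})" if s: "s \<in> {0..1}" for s
  proof -
    obtain w where w: "w \<in> carrier_vec d" "tproj (g s) w = 0\<^sub>v d"
      "\<And>k. k < d \<Longrightarrow> ((\<lambda>r. V r $ k) has_real_derivative w $ k) (at s within {0..1})"
      and t: "V s \<in> tangent d (g s)"
      using V s unfolding parallel_along_def by blast
    obtain w' where w': "w' \<in> carrier_vec d" "tproj (g s) w' = 0\<^sub>v d"
      "\<And>k. k < d \<Longrightarrow> ((\<lambda>r. V' r $ k) has_real_derivative w' $ k) (at s within {0..1})"
      and t': "V' s \<in> tangent d (g s)"
      using V' s unfolding parallel_along_def by blast
    have c: "V s \<in> carrier_vec d" "V' s \<in> carrier_vec d" using t t' by (auto simp: tangent_def)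
    have pw: "pad w = inner (pad (g s)) (pad w) *\<^sub>R pad (g s)"
      using pad_tproj[OF g[of s] w(1)] w(2) by simp
    have pw': "pad w' = inner (pad (g s)) (pad w') *\<^sub>R pad (g s)"
      using pad_tproj[OF g[of s] w'(1)] w'(2) by simp
    have "inner (pad (g s)) (pad (V s) - pad (V' s)) = 0"
      using t t' g by (simp add: tangent_iff inner_diff_right)
    then have "inner (pad (V s) - pad (V' s)) (pad (g s)) = 0" by (metis inner_commute)
    then have "inner (pad (V s) - pad (V' s)) (pad w - pad w') = 0"
      by (subst pw, subst pw') (simp add: inner_diff_right)
    then have "(V s - V' s) \<bullet> (w - w') = 0"
      using c w(1) w'(1) by (simp add: inner_pad[of _ d, symmetric] pad_diff[of _ d])
    then have sum0: "(\<Sum>k<d. (V s $ k - V' s $ k) * (w $ k - w' $ k)) = 0"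
      using c w(1) w'(1) by (simp add: scalar_prod_def lessThan_atLeast0)
    have "(W has_real_derivative (\<Sum>k<d. 2 * ((V s $ k - V' s $ k) * (w $ k - w' $ k))))
        (at s within {0..1})"
      unfolding W_def
      by (rule DERIV_sum) (auto intro!: derivative_eq_intros w(3) w'(3))
    then show ?thesis using sum0 by (simp add: sum_distrib_left[symmetric])
  qed
  then obtain c where "\<And>s. s \<in> {0..1} \<Longrightarrow> W s = c"
    using has_field_derivative_zero_constant[of "{0..1::real}" W] by auto
  then have "W 1 = W 0" by simp
  then have "W 1 = 0" by (simp add: W_def eq)
  then have *: "V 1 $ k = V' 1 $ k" if "k < d" for k
    using that unfolding W_def by (subst (asm) sum_nonneg_eq_0_iff) auto
  have "V 1 \<in> carrier_vec d" "V' 1 \<in> carrier_vec d"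
    using V V' by (auto simp: parallel_along_def tangent_def)
  then show ?thesis using * by (intro eq_vecI) auto
qed

text \<open>Equal lengths give equal coefficients, and below pi the sine in front of the velocity is
  nonzero. This makes the geodesic in \<open>transport\<close> unique.\<close>

lemma gexp_inject:
  fixes X :: "'a::real_inner"
  assumes "gexp X L' = gexp X L" "norm L' = norm L" "norm L < pi"
  shows "L' = L"
proof (cases "L = 0")
  case False
  then have "sin (norm L) > 0" using assms(3) by (intro sin_gt_zero) auto
  then show ?thesis using assms False by (auto simp: gexp_def)
qed (use assms in auto)

text \<open>Evaluates the definite description: the explicit field \<open>V\<close> gives existence,
  \<open>gexp_inject\<close> and \<open>parallel_unique\<close> give uniqueness of the geodesic and
  of the field. A length below pi excludes antipodal endpoints.\<close>

lemma transport_eq: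
  assumes x: "x \<in> usphere d" and l: "l \<in> tangent d x" "vnorm l < pi" and u: "u \<in> tangent d x"
  shows "transport d x (sexp x l) u = vptrans x l u"
    and "vptrans x l u \<in> tangent d (sexp x l)"
proof -
  define \<psi> where "\<psi> = vnorm l"
  define e where "e = (1 / \<psi>) \<cdot>\<^sub>v l"
  define \<beta> where "\<beta> = e \<bullet> u"
  define V where "V = (\<lambda>s. u + \<beta> \<cdot>\<^sub>v ((cos (s * \<psi>) - 1) \<cdot>\<^sub>v e - sin (s * \<psi>) \<cdot>\<^sub>v x))"
  have xc: "x \<in> carrier_vec d" using x by (simp add: usphere_def)
  have lc: "l \<in> carrier_vec d" and uc: "u \<in> carrier_vec d" using l u by (auto simp: tangent_def)
  have ec: "e \<in> carrier_vec d" using lc by (simp add: e_def)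
  have \<psi>: "0 \<le> \<psi>" by (simp add: \<psi>_def norm_pad[symmetric])
  have slc: "s \<cdot>\<^sub>v l \<in> carrier_vec d" for s using lc by simp
  have gc: "sexp x (s \<cdot>\<^sub>v l) \<in> carrier_vec d" for s by (rule sexp_carrier[OF xc slc])
  have xx: "inner (pad x) (pad x) = 1" using x by (simp add: usphere_iff norm_eq_1)
  have xl: "inner (pad x) (pad l) = 0" and xu: "inner (pad x) (pad u) = 0"
    using l u xc by (auto simp: tangent_iff)
  have xe: "inner (pad x) (pad e) = 0" using xl by (simp add: e_def)
  have ee: "\<psi> = 0 \<or> inner (pad e) (pad e) = 1"
    by (simp add: e_def dot_square_norm norm_pad \<psi>_def power2_eq_square)
  have eu: "inner (pad e) (pad u) = \<beta>" using ec uc by (simp add: \<beta>_def inner_pad)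
  \<comment> \<open>For a zero velocity, division by zero makes \<open>e\<close> the zero vector
    instead of a unit vector; the curve and the field are then constant.\<close>
  have psi0: "\<beta> = 0 \<and> l = 0\<^sub>v d" if "\<psi> = 0"
  proof -
    have "norm (pad l) = 0" using that by (simp add: \<psi>_def norm_pad)
    then have "pad l = pad (0\<^sub>v d)" by simp
    then have "l = 0\<^sub>v d" by (subst (asm) pad_inject[OF lc]) auto
    then show ?thesis using uc by (simp add: \<beta>_def e_def)
  qed
  have g: "pad (sexp x (s \<cdot>\<^sub>v l)) = cos (s * \<psi>) *\<^sub>R pad x + sin (s * \<psi>) *\<^sub>R pad e"
    if "0 \<le> s" for s
  proof (cases "s = 0 \<or> \<psi> = 0")
    case True
    then show ?thesis using psi0 xc by (auto simp: pad_sexp[OF xc slc] gexp_def)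
  next
    case False
    then show ?thesis using that
      by (simp add: pad_sexp[OF xc slc] gexp_def norm_pad \<psi>_def[symmetric] e_def abs_of_nonneg)
  qed
  have Vc: "V s \<in> carrier_vec d" for s using uc ec xc by (simp add: V_def)
  have padV: "pad (V s) = pad u + \<beta> *\<^sub>R ((cos (s * \<psi>) - 1) *\<^sub>R pad e - sin (s * \<psi>) *\<^sub>R pad x)" for s
    using uc ec xc by (simp add: V_def pad_add[of _ d] pad_diff[of _ d])
  have tang: "V s \<in> tangent d (sexp x (s \<cdot>\<^sub>v l))" if "0 \<le> s" for s
  proof -
    have "inner (pad (sexp x (s \<cdot>\<^sub>v l))) (pad (V s)) = 0"
      using ee
    proof
      assume "\<psi> = 0"
      then have "\<beta> = 0" using psi0 by simp
      then show ?thesis using xu \<open>\<psi> = 0\<close> unfolding g[OF that] padV by simp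
    next
      assume "inner (pad e) (pad e) = 1"
      then show ?thesis unfolding g[OF that] padV using xx xe xu eu
        by (simp add: inner_simps inner_commute[of "pad e" "pad x"] algebra_simps)
    qed
    then show ?thesis using tangent_iff[OF gc] Vc by simp
  qed
  have par: "parallel_along d (\<lambda>s. sexp x (s \<cdot>\<^sub>v l)) V"
    unfolding parallel_along_def
  proof (intro ballI conjI)
    fix s :: real assume s: "s \<in> {0..1}"
    then show "V s \<in> tangent d (sexp x (s \<cdot>\<^sub>v l))" using tang by simp
    \<comment> \<open>A multiple of the current point: the field changes only in the normal
      direction, so its covariant derivative vanishes.\<close>
    define w where "w = (- \<beta> * \<psi>) \<cdot>\<^sub>v (cos (s * \<psi>) \<cdot>\<^sub>v x + sin (s * \<psi>) \<cdot>\<^sub>v e)"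
    have wc: "w \<in> carrier_vec d" using xc ec by (simp add: w_def)
    show "\<exists>w\<in>carrier_vec d. (\<forall>k<d. ((\<lambda>r. V r $ k) has_real_derivative w $ k) (at s within {0..1})) \<and>
           tproj (sexp x (s \<cdot>\<^sub>v l)) w = 0\<^sub>v d"
    proof (intro bexI[OF _ wc] conjI allI impI)
      fix k assume k: "k < d"
      have "(\<lambda>r. V r $ k) = (\<lambda>r. u $ k + \<beta> * ((cos (r * \<psi>) - 1) * e $ k - sin (r * \<psi>) * x $ k))"
        using k uc ec xc by (auto simp: V_def)
      moreover have "w $ k = - \<beta> * \<psi> * (cos (s * \<psi>) * x $ k + sin (s * \<psi>) * e $ k)"
        using k ec xc by (simp add: w_def)
      ultimately show "((\<lambda>r. V r $ k) has_real_derivative w $ k) (at s within {0..1})"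
        by (auto intro!: derivative_eq_intros simp: algebra_simps)
    next
      have "inner (pad (sexp x (s \<cdot>\<^sub>v l))) (pad (sexp x (s \<cdot>\<^sub>v l))) = 1"
      proof -
        have "s \<cdot>\<^sub>v l \<in> tangent d x" using xl slc xc by (simp add: tangent_iff)
        then show ?thesis using sexp_usphere[OF x, of "s \<cdot>\<^sub>v l"] by (simp add: usphere_iff norm_eq_1)
      qed
      moreover have "pad w = (- \<beta> * \<psi>) *\<^sub>R pad (sexp x (s \<cdot>\<^sub>v l))"
        using s xc ec by (simp add: g w_def pad_add[of _ d])
      ultimately have "pad (tproj (sexp x (s \<cdot>\<^sub>v l)) w) = pad (0\<^sub>v d)"
        unfolding pad_tproj[OF gc wc] by simp
      then show "tproj (sexp x (s \<cdot>\<^sub>v l)) w = 0\<^sub>v d"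
        by (subst (asm) pad_inject[of _ d]) (use gc wc in \<open>auto simp: tproj_def\<close>)
    qed
  qed
  have V0: "V 0 = u" using uc ec xc by (intro eq_vecI) (auto simp: V_def)
  have V1: "V 1 = vptrans x l u"
  proof -
    have "pad (V 1) = pad (vptrans x l u)"
      unfolding padV pad_vptrans[OF xc lc uc] ptrans_def norm_pad \<psi>_def[symmetric]
      by (simp add: e_def \<beta>_def[symmetric] eu[symmetric])
    moreover have "vptrans x l u \<in> carrier_vec d" using xc lc uc by (simp add: vptrans_def)
    ultimately show ?thesis using pad_inject[OF Vc] by blast
  qed
  show "vptrans x l u \<in> tangent d (sexp x l)" using tang[of 1] V1 by simp
  have dist: "vnorm l = sdist x (sexp x l)"
  proof -
    have "inner (pad x) (gexp (pad x) (pad l)) = cos (norm (pad l))"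
      using xx xl by (simp add: gexp_def inner_simps)
    then show ?thesis using l(2)
      by (simp add: sdist_pad[OF xc sexp_carrier[OF xc lc]] pad_sexp[OF xc lc] norm_pad[symmetric] arccos_cos)
  qed
  show "transport d x (sexp x l) u = vptrans x l u"
    unfolding transport_def
  proof (rule the_equality)
    show "\<exists>l' V'. l' \<in> tangent d x \<and> vnorm l' = sdist x (sexp x l) \<and> sexp x l' = sexp x l \<and>
        parallel_along d (\<lambda>s. sexp x (s \<cdot>\<^sub>v l')) V' \<and> V' 0 = u \<and> V' 1 = vptrans x l u"
      using l(1) dist par V0 V1 by blast
  next
    fix y
    assume "\<exists>l' V'. l' \<in> tangent d x \<and> vnorm l' = sdist x (sexp x l) \<and> sexp x l' = sexp x l \<and>
        parallel_along d (\<lambda>s. sexp x (s \<cdot>\<^sub>v l')) V' \<and> V' 0 = u \<and> V' 1 = y"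
    then obtain l' V' where l': "l' \<in> tangent d x" "vnorm l' = sdist x (sexp x l)"
        "sexp x l' = sexp x l"
      and V': "parallel_along d (\<lambda>s. sexp x (s \<cdot>\<^sub>v l')) V'" "V' 0 = u" "V' 1 = y"
      by blast
    have lc': "l' \<in> carrier_vec d" using l' by (simp add: tangent_def)
    have "gexp (pad x) (pad l') = gexp (pad x) (pad l)"
      using l'(3) by (simp add: pad_sexp[OF xc lc, symmetric] pad_sexp[OF xc lc', symmetric])
    then have "pad l' = pad l"
      by (rule gexp_inject) (use l'(2) l(2) dist in \<open>auto simp: norm_pad\<close>)
    then have "l' = l" using pad_inject[OF lc' lc] by simp
    then show "y = vptrans x l u"
      using parallel_unique[OF V'(1)[unfolded \<open>l' = l\<close>] par gc] V' V0 V1 by simp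
  qed
qed

text \<open>Transfers the guarantees of the quantizer to a tangent space. The third one,
  independence of the reference, is what makes all machines agree in round 0, where their references
  differ.\<close>

lemma tangent_Q:
  assumes Q: "quantizer d C Q enc dec b" and \<phi>: "tangent_isometry d x (\<phi> x)"
    and x: "x \<in> carrier_vec d"
    and u: "u \<in> tangent d x" "u' \<in> tangent d x" and yw: "0 < y" "0 < w"
    and le: "norm (pad u - pad u') \<le> y"
  shows "tangent_Q d \<phi> Q x u u' y w \<in> tangent d x"
    and "norm (pad (tangent_Q d \<phi> Q x u u' y w) - pad u) \<le> w"
    and "u'' \<in> tangent d x \<Longrightarrow> norm (pad u - pad u'') \<le> y \<Longrightarrow>
      tangent_Q d \<phi> Q x u u'' y w = tangent_Q d \<phi> Q x u u' y w"
proof -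
  define \<psi> where "\<psi> = \<phi> x"
  have bij: "bij_betw \<psi> (tangent d x) (carrier_vec (d - 1))"
    and add: "\<And>u v. u \<in> tangent d x \<Longrightarrow> v \<in> tangent d x \<Longrightarrow> \<psi> (u + v) = \<psi> u + \<psi> v"
    and smult: "\<And>a u. u \<in> tangent d x \<Longrightarrow> \<psi> (a \<cdot>\<^sub>v u) = a \<cdot>\<^sub>v \<psi> u"
    and nrm: "\<And>u. u \<in> tangent d x \<Longrightarrow> vnorm (\<psi> u) = vnorm u"
    using \<phi> unfolding tangent_isometry_def \<psi>_def by auto
  have \<psi>c: "\<psi> u \<in> carrier_vec (d - 1)" if "u \<in> tangent d x" for u
    using bij that by (auto simp: bij_betw_def)
  have iso: "vnorm (\<psi> u - \<psi> v) = norm (pad u - pad v)" if uv: "u \<in> tangent d x" "v \<in> tangent d x" for u v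
  proof -
    have c: "u \<in> carrier_vec d" "v \<in> carrier_vec d" using uv by (auto simp: tangent_def)
    have m: "(- 1) \<cdot>\<^sub>v v \<in> tangent d x" using uv(2) x by (simp add: tangent_iff)
    have s: "u + (- 1) \<cdot>\<^sub>v v \<in> tangent d x" using uv m x by (simp add: tangent_iff pad_add[of _ d] inner_simps)
    have "\<psi> (u + (- 1) \<cdot>\<^sub>v v) = \<psi> u + (- 1) \<cdot>\<^sub>v \<psi> v" using add[OF uv(1) m] smult[OF uv(2)] by simp
    also have "\<dots> = \<psi> u - \<psi> v" using \<psi>c[OF uv(1)] \<psi>c[OF uv(2)] by (intro eq_vecI) auto
    finally have "vnorm (\<psi> u - \<psi> v) = vnorm (u + (- 1) \<cdot>\<^sub>v v)" using nrm[OF s] by simp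
    then show ?thesis using c by (simp add: norm_pad[symmetric] pad_add[of _ d])
  qed
  obtain L N where L: "int_lattice (d - 1) L" and NQ: "\<forall>z\<in>carrier_vec (d - 1).
      N z \<in> L \<and> (\<forall>l\<in>L. vnorm (N z - z) \<le> vnorm (l - z)) \<and>
      (\<forall>z'\<in>carrier_vec (d - 1). vnorm (z - z') \<le> y \<longrightarrow>
        dec w y (enc w y z) z' = Q z z' y w \<and> vnorm (Q z z' y w - z) \<le> w \<and> Q z z' y w = N z)"
    using Q[unfolded quantizer_def, rule_format, OF yw] by (elim conjE exE) (rule that)
  have N: "vnorm (Q z z' y w - z) \<le> w \<and> Q z z' y w = N z \<and> N z \<in> L"
    if "z \<in> carrier_vec (d - 1)" "z' \<in> carrier_vec (d - 1)" "vnorm (z - z') \<le> y" for z z'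
    using bspec[OF NQ that(1)] that(2,3) by metis
  \<comment> \<open>Lattice membership is the source of the dimension of the decoded vector, which
    inverting the isometry requires.\<close>
  have Lc: "L \<subseteq> carrier_vec (d - 1)" using L unfolding int_lattice_def by auto
  have q: "Q (\<psi> u) (\<psi> u') y w \<in> carrier_vec (d - 1)"
    using N[OF \<psi>c[OF u(1)] \<psi>c[OF u(2)]] iso[OF u] le Lc by auto
  have t: "tangent_Q d \<phi> Q x u u' y w = inv_into (tangent d x) \<psi> (Q (\<psi> u) (\<psi> u') y w)"
    by (simp add: tangent_Q_def \<psi>_def)
  show tang: "tangent_Q d \<phi> Q x u u' y w \<in> tangent d x"
    unfolding t using q bij by (metis bij_betw_imp_surj_on inv_into_into)
  have "\<psi> (tangent_Q d \<phi> Q x u u' y w) = Q (\<psi> u) (\<psi> u') y w"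
    unfolding t using q bij by (metis bij_betw_imp_surj_on f_inv_into_f)
  then show "norm (pad (tangent_Q d \<phi> Q x u u' y w) - pad u) \<le> w"
    using iso[OF tang u(1)] N[OF \<psi>c[OF u(1)] \<psi>c[OF u(2)]] iso[OF u] le by metis
  show "tangent_Q d \<phi> Q x u u'' y w = tangent_Q d \<phi> Q x u u' y w"
    if "u'' \<in> tangent d x" "norm (pad u - pad u'') \<le> y"
  proof -
    have "Q (\<psi> u) (\<psi> u') y w = N (\<psi> u)"
      using N[OF \<psi>c[OF u(1)] \<psi>c[OF u(2)]] iso[OF u] le by simp
    moreover have "Q (\<psi> u) (\<psi> u'') y w = N (\<psi> u)"
      using N[OF \<psi>c[OF u(1)] \<psi>c[OF that(1)]] iso[OF u(1) that(1)] that(2) by simp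
    ultimately show ?thesis by (simp add: tangent_Q_def \<psi>_def[symmetric])
  qed
qed

section \<open>Extremal eigenvalues of symmetric matrices\<close>

definition qform :: "real mat \<Rightarrow> real vec \<Rightarrow> real" where
  "qform A x = inner (pad x) (pad (A *\<^sub>v x))"

lemma symmetric_inner:
  assumes "A \<in> carrier_mat d d" "transpose_mat A = A" "x \<in> carrier_vec d" "y \<in> carrier_vec d"
  shows "inner (pad (A *\<^sub>v y)) (pad x) = inner (pad y) (pad (A *\<^sub>v x))"
  using transpose_vec_mult_scalar[OF assms(1,3,4)] assms by (simp add: inner_pad[of _ d])

text \<open>The constant is the Frobenius norm, plus 1 to make it strictly positive and safe to
  divide by.\<close>

lemma mat_bounded:
  assumes "W \<in> carrier_mat n m"
  obtains C :: real where "C > 0" "\<And>x. x \<in> carrier_vec m \<Longrightarrow> norm (pad (W *\<^sub>v x)) \<le> C * norm (pad x)"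
proof
  define C where "C = sqrt (\<Sum>i<n. (norm (pad (row W i)))\<^sup>2) + 1"
  have S: "0 \<le> (\<Sum>i<n. (norm (pad (row W i)))\<^sup>2)" by (rule sum_nonneg) simp
  show "C > 0" using S by (simp add: C_def add_nonneg_pos)
  fix x :: "real vec" assume x: "x \<in> carrier_vec m"
  have Wx: "W *\<^sub>v x \<in> carrier_vec n" using assms x by simp
  have "(norm (pad (W *\<^sub>v x)))\<^sup>2 = (\<Sum>i<n. (row W i \<bullet> x)\<^sup>2)"
    unfolding power2_norm_eq_inner inner_pad[OF Wx Wx] using assms
    by (simp add: scalar_prod_def lessThan_atLeast0 power2_eq_square)
  also have "\<dots> \<le> (\<Sum>i<n. (norm (pad (row W i)))\<^sup>2 * (norm (pad x))\<^sup>2)"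
  proof (rule sum_mono)
    fix i assume "i \<in> {..<n}"
    then have r: "row W i \<in> carrier_vec m" using assms by auto
    show "(row W i \<bullet> x)\<^sup>2 \<le> (norm (pad (row W i)))\<^sup>2 * (norm (pad x))\<^sup>2"
      unfolding inner_pad[OF r x, symmetric] power2_norm_eq_inner by (rule Cauchy_Schwarz_ineq)
  qed
  also have "\<dots> = (sqrt (\<Sum>i<n. (norm (pad (row W i)))\<^sup>2) * norm (pad x))\<^sup>2"
    using S by (simp add: power_mult_distrib sum_distrib_right)
  finally have "norm (pad (W *\<^sub>v x)) \<le> sqrt (\<Sum>i<n. (norm (pad (row W i)))\<^sup>2) * norm (pad x)"
    by (rule power2_le_imp_le) (use S in auto)
  also have "\<dots> \<le> C * norm (pad x)" unfolding C_def by (intro mult_right_mono) auto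
  finally show "norm (pad (W *\<^sub>v x)) \<le> C * norm (pad x)" .
qed

lemma qform_scale:
  assumes "A \<in> carrier_mat d d" "x \<in> carrier_vec d"
  shows "qform A (a \<cdot>\<^sub>v x) = a\<^sup>2 * qform A x"
  using assms by (simp add: qform_def mult_mat_vec power2_eq_square)

text \<open>Evaluate the form, which is nonnegative, at \<open>x - t P x\<close> for the best \<open>t\<close>.\<close>

lemma psd_apply_le:
  assumes P: "P \<in> carrier_mat d d" "transpose_mat P = P"
    and psd: "\<And>x. x \<in> carrier_vec d \<Longrightarrow> 0 \<le> qform P x"
    and le: "\<And>x. x \<in> carrier_vec d \<Longrightarrow> qform P x \<le> \<Lambda> * (norm (pad x))\<^sup>2"
    and x: "x \<in> carrier_vec d" and \<Lambda>: "0 \<le> \<Lambda>"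
  shows "(norm (pad (P *\<^sub>v x)))\<^sup>2 \<le> \<Lambda> * qform P x"
proof -
  define y where "y = P *\<^sub>v x"
  have y: "y \<in> carrier_vec d" using P x by (simp add: y_def)
  define b where "b = (norm (pad y))\<^sup>2"
  have ineq: "0 \<le> qform P x - 2 * t * b + t\<^sup>2 * (\<Lambda> * b)" for t
  proof -
    have c: "x + (- t) \<cdot>\<^sub>v y \<in> carrier_vec d" using x y by simp
    have "P *\<^sub>v (x + (- t) \<cdot>\<^sub>v y) = P *\<^sub>v x + (- t) \<cdot>\<^sub>v (P *\<^sub>v y)"
      using P x y by (simp add: mult_add_distrib_mat_vec[of _ d d] mult_mat_vec[of _ d d])
    then have "qform P (x + (- t) \<cdot>\<^sub>v y) = inner (pad x - t *\<^sub>R pad y) (pad y - t *\<^sub>R pad (P *\<^sub>v y))"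
      unfolding qform_def y_def using P x by (simp add: pad_add[of _ d])
    also have "\<dots> = qform P x - 2 * t * b + t\<^sup>2 * qform P y"
    proof -
      have "inner (pad x) (pad (P *\<^sub>v y)) = b"
        using symmetric_inner[OF P y x] by (simp add: y_def b_def power2_norm_eq_inner)
      then show ?thesis unfolding qform_def y_def[symmetric] b_def power2_norm_eq_inner
        by (simp add: inner_diff_left inner_diff_right power2_eq_square algebra_simps)
    qed
    also have "t\<^sup>2 * qform P y \<le> t\<^sup>2 * (\<Lambda> * b)"
      unfolding b_def by (rule mult_left_mono[OF le[OF y]]) simp
    finally show ?thesis using psd[OF c] by linarith
  qed
  show ?thesis
  proof (cases "\<Lambda> = 0")
    case True
    have "b \<le> 0"
    proof (rule ccontr)
      assume "\<not> b \<le> 0"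
      \<comment> \<open>For \<open>\<Lambda> = 0\<close> the bound is affine in \<open>t\<close>
        with slope \<open>- 2 * b\<close>; this \<open>t\<close> gives it the value -1.\<close>
      then show False using ineq[of "(qform P x + 1) / (2 * b)"] psd[OF x] True by simp
    qed
    then show ?thesis using True by (simp add: b_def y_def)
  next
    case False
    then have "0 \<le> qform P x - b / \<Lambda>" using ineq[of "1 / \<Lambda>"]
      by (simp add: power2_eq_square field_simps)
    then show ?thesis using False \<Lambda> by (simp add: b_def y_def field_simps)
  qed
qed

text \<open>If the supremum \<open>s\<close> of the form on the unit sphere were not an eigenvalue, \<open>s I - A\<close> would be
  invertible, and then its form would be bounded away from 0 on the unit sphere.\<close>

lemma symmetric_top_eigenvalue:
  assumes A: "A \<in> carrier_mat d d" "transpose_mat A = A" and d: "0 < d"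
  obtains s where "eigenvalue A s" "\<And>x. x \<in> carrier_vec d \<Longrightarrow> qform A x \<le> s * (norm (pad x))\<^sup>2"
proof -
  obtain C where C: "C > 0" "\<And>x. x \<in> carrier_vec d \<Longrightarrow> norm (pad (A *\<^sub>v x)) \<le> C * norm (pad x)"
    using mat_bounded[OF A(1)] by metis
  define S where "S = qform A ` usphere d"
  have "norm (pad (unit_vec d 0)) = 1"
    using d unfolding norm_eq_1 by (subst inner_pad[of _ d]) auto
  then have ne: "S \<noteq> {}" unfolding S_def using usphere_iff[of "unit_vec d 0" d] by auto
  have "qform A x \<le> C" if "x \<in> usphere d" for x
  proof -
    have "qform A x \<le> norm (pad x) * norm (pad (A *\<^sub>v x))"
      unfolding qform_def by (rule norm_cauchy_schwarz)
    then show ?thesis using C(2)[of x] that by (simp add: usphere_iff)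
  qed
  then have bdd: "bdd_above S" unfolding S_def by (intro bdd_aboveI2)
  define s where "s = Sup S"
  have le: "qform A x \<le> s * (norm (pad x))\<^sup>2" if x: "x \<in> carrier_vec d" for x
  proof (cases "norm (pad x) = 0")
    case True
    then show ?thesis by (simp add: qform_def)
  next
    case False
    define y where "y = (1 / norm (pad x)) \<cdot>\<^sub>v x"
    have y: "y \<in> usphere d" using False x by (simp add: y_def usphere_iff)
    then have "qform A y \<le> s" unfolding s_def S_def[symmetric]
      by (intro cSup_upper bdd) (auto simp: S_def)
    moreover have "qform A y = qform A x / (norm (pad x))\<^sup>2"
      unfolding y_def qform_scale[OF A(1) x] by (simp add: power_divide)
    ultimately show ?thesis using False by (simp add: field_simps)
  qed
  have "eigenvalue A s"
  proof (rule ccontr)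
    assume "\<not> eigenvalue A s"
    define B where "B = char_matrix A s"
    have B: "B \<in> carrier_mat d d" using A(1) by (simp add: B_def char_matrix_def)
    have "det B \<noteq> 0" using \<open>\<not> eigenvalue A s\<close> eigenvalue_det[OF A(1)] by (simp add: B_def)
    from det_non_zero_imp_unit[OF B this, of undefined]
    obtain W where W: "W \<in> carrier_mat d d" "W * B = 1\<^sub>m d"
      unfolding Units_def by (auto simp: ring_mat_simps)
    obtain C' where C': "C' > 0" "\<And>x. x \<in> carrier_vec d \<Longrightarrow> norm (pad (W *\<^sub>v x)) \<le> C' * norm (pad x)"
      using mat_bounded[OF W(1)] by metis
    define P where "P = - B"
    have P: "P \<in> carrier_mat d d" using B by (simp add: P_def)
    have Bt: "transpose_mat B = B"
    proof (rule eq_matI)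
      fix i j assume "i < dim_row B" "j < dim_col B"
      then have ij: "i < d" "j < d" using B by auto
      have "A $$ (j, i) = A $$ (i, j)" using A ij by (metis index_transpose_mat(1) carrier_matD)
      then show "transpose_mat B $$ (i, j) = B $$ (i, j)"
        using ij A(1) B by (auto simp: B_def char_matrix_def)
    qed (use B in auto)
    have Pt: "transpose_mat P = P" unfolding P_def transpose_uminus Bt ..
    have Px: "pad (P *\<^sub>v x) = s *\<^sub>R pad x - pad (A *\<^sub>v x)" if x: "x \<in> carrier_vec d" for x
    proof -
      have "B *\<^sub>v x = A *\<^sub>v x + (- s) \<cdot>\<^sub>v x"
        unfolding B_def char_matrix_def using A x
        by (intro eq_vecI) (auto simp: add_scalar_prod_distrib[of _ d])
      then show ?thesis unfolding P_def using A x B by (simp add: pad_add[of _ d])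
    qed
    have qP: "qform P x = s * (norm (pad x))\<^sup>2 - qform A x" if "x \<in> carrier_vec d" for x
      unfolding qform_def Px[OF that] by (simp add: inner_diff_right power2_norm_eq_inner)
    obtain C'' where C'': "C'' > 0" "\<And>x. x \<in> carrier_vec d \<Longrightarrow> norm (pad (P *\<^sub>v x)) \<le> C'' * norm (pad x)"
      using mat_bounded[OF P] by metis
    have psd: "0 \<le> qform P x" if "x \<in> carrier_vec d" for x using le[OF that] qP[OF that] by simp
    have up: "qform P x \<le> C'' * (norm (pad x))\<^sup>2" if "x \<in> carrier_vec d" for x
    proof -
      have "qform P x \<le> norm (pad x) * norm (pad (P *\<^sub>v x))"
        unfolding qform_def by (rule norm_cauchy_schwarz)
      also have "\<dots> \<le> norm (pad x) * (C'' * norm (pad x))"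
        by (rule mult_left_mono[OF C''(2)[OF that]]) simp
      finally show ?thesis by (simp add: power2_eq_square mult_ac)
    qed
    \<comment> \<open>\<open>1 = |W B x|\<close> is at most \<open>C' |P x|\<close>, and
      \<open>|P x|^2\<close> is at most \<open>C''\<close> times the form of \<open>P\<close> by
      \<open>psd_apply_le\<close>. So this number bounds the form of \<open>P\<close> from below on
      the sphere, against the choice of \<open>s\<close> as supremum.\<close>
    define \<epsilon> where "\<epsilon> = 1 / (C'\<^sup>2 * C'')"
    have \<epsilon>: "\<epsilon> > 0" using C' C'' by (simp add: \<epsilon>_def)
    have "qform A x \<le> s - \<epsilon>" if "x \<in> usphere d" for x
    proof -
      have x: "x \<in> carrier_vec d" "norm (pad x) = 1" using that by (auto simp: usphere_iff)
      have "W *\<^sub>v (B *\<^sub>v x) = x"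
        using W B x by (simp add: assoc_mult_mat_vec[of _ d d _ d, symmetric])
      then have "1 \<le> C' * norm (pad (B *\<^sub>v x))" using C'(2)[of "B *\<^sub>v x"] B x by simp
      then have "1 \<le> C' * norm (pad (P *\<^sub>v x))" using B x by (simp add: P_def)
      then have "1\<^sup>2 \<le> (C' * norm (pad (P *\<^sub>v x)))\<^sup>2" by (intro power_mono) auto
      also have "\<dots> = C'\<^sup>2 * (norm (pad (P *\<^sub>v x)))\<^sup>2" by (simp add: power_mult_distrib)
      also have "\<dots> \<le> C'\<^sup>2 * (C'' * qform P x)"
        using psd_apply_le[OF P Pt psd up x(1)] C'' by (intro mult_left_mono) auto
      finally have "\<epsilon> \<le> qform P x" using C' C'' by (simp add: \<epsilon>_def field_simps)
      then show ?thesis using qP[OF x(1)] x(2) by simp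
    qed
    then have "s \<le> s - \<epsilon>" unfolding s_def using ne by (intro cSup_least) (auto simp: S_def)
    then show False using \<epsilon> by simp
  qed
  then show thesis using le that by blast
qed

lemma qform_le_lambda_max:
  assumes A: "A \<in> carrier_mat d d" "transpose_mat A = A" and d: "0 < d" and x: "x \<in> carrier_vec d"
  shows "qform A x \<le> lambda_max A * (norm (pad x))\<^sup>2"
proof -
  obtain s where s: "eigenvalue A s" "\<And>x. x \<in> carrier_vec d \<Longrightarrow> qform A x \<le> s * (norm (pad x))\<^sup>2"
    using symmetric_top_eigenvalue[OF A d] by metis
  have "s \<le> lambda_max A" unfolding lambda_max_def
    by (rule Max_ge) (use s card_finite_spectrum[OF A(1)] in \<open>auto simp: spectrum_def\<close>)
  then show ?thesis using s(2)[OF x] by (meson mult_right_mono order_trans zero_le_power2)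
qed

text \<open>In Schur form with the simple eigenvalue \<open>l\<close> last, back substitution shows that an eigenvector
  for \<open>l\<close> is determined by its last coordinate.\<close>

lemma simple_eigenvalue_not_orthogonal:
  fixes A :: "real mat"
  assumes A: "A \<in> carrier_mat d d"
    and cp: "char_poly A = [:- l, 1:] * (\<Prod>e\<leftarrow>es. [:- e, 1:])" and l: "l \<notin> set es"
    and u: "eigenvector A u l" and v: "eigenvector A v l"
  shows "u \<bullet> v \<noteq> 0"
proof
  assume orth: "u \<bullet> v = 0"
  have u': "u \<in> carrier_vec d" "u \<noteq> 0\<^sub>v d" "A *\<^sub>v u = l \<cdot>\<^sub>v u"
    and v': "v \<in> carrier_vec d" "v \<noteq> 0\<^sub>v d" "A *\<^sub>v v = l \<cdot>\<^sub>v v"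
    using u v A by (auto simp: eigenvector_def)
  obtain B P Q where sd: "schur_decomposition A (es @ [l]) = (B, P, Q)" by (metis prod_cases3)
  have "char_poly A = (\<Prod>e\<leftarrow>es @ [l]. [:- e, 1:])" unfolding cp by (simp add: mult.commute)
  from schur_decomposition[OF A this sd]
  have wit: "similar_mat_wit A B P Q" and tri: "upper_triangular B" and dg: "diag_mat B = es @ [l]"
    by auto
  from similar_mat_witD2[OF A wit]
  have PQ: "P * Q = 1\<^sub>m d" "Q * P = 1\<^sub>m d" "A = P * B * Q"
    and c: "B \<in> carrier_mat d d" "P \<in> carrier_mat d d" "Q \<in> carrier_mat d d" by auto
  have "length (diag_mat B) = d" using c by (simp add: diag_mat_def)
  then have len: "d = Suc (length es)" using dg by simp
  have Bii: "B $$ (i, i) \<noteq> l" if "i < length es" for i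
  proof -
    have "B $$ (i, i) = diag_mat B ! i" using that c len by (simp add: diag_mat_def del: upt_Suc)
    then show ?thesis using that l by (simp add: dg nth_append) (metis nth_mem)
  qed
  have zero: "y = 0\<^sub>v d" if y: "y \<in> carrier_vec d" "B *\<^sub>v y = l \<cdot>\<^sub>v y" "y $ length es = 0" for y
  proof (rule ccontr)
    assume "y \<noteq> 0\<^sub>v d"
    then obtain i where "i < d" "y $ i \<noteq> 0" using y(1) by (metis eq_vecI carrier_vecD index_zero_vec)
    then have fin: "finite {i. i < d \<and> y $ i \<noteq> 0}" "{i. i < d \<and> y $ i \<noteq> 0} \<noteq> {}" by auto
    \<comment> \<open>In row \<open>k\<close> triangularity removes the entries before the diagonal
      and maximality of \<open>k\<close> those after it. What is left says that the diagonal entry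
      is \<open>l\<close>, which happens only in the last row.\<close>
    define k where "k = Max {i. i < d \<and> y $ i \<noteq> 0}"
    have k: "k < d" "y $ k \<noteq> 0" using Max_in[OF fin] by (auto simp: k_def)
    have above: "y $ j = 0" if "k < j" "j < d" for j
      using Max_ge[OF fin(1), of j] that by (fastforce simp: k_def)
    have "k < length es" using k y(3) len by (metis less_SucE)
    have "l * y $ k = (B *\<^sub>v y) $ k" using y(1,2) k by simp
    also have "\<dots> = (\<Sum>j\<in>{0..<d}. B $$ (k, j) * y $ j)"
      using c y(1) k by (simp add: scalar_prod_def)
    also have "\<dots> = (\<Sum>j\<in>{0..<d}. if j = k then B $$ (k, k) * y $ k else 0)"
    proof (rule sum.cong[OF refl])
      fix j assume "j \<in> {0..<d}"
      then show "B $$ (k, j) * y $ j = (if j = k then B $$ (k, k) * y $ k else 0)"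
        using above[of j] upper_triangularD[OF tri, of j k] k c by (cases j k rule: linorder_cases) auto
    qed
    also have "\<dots> = B $$ (k, k) * y $ k" using k by simp
    finally show False using Bii[OF \<open>k < length es\<close>] k by simp
  qed
  have QA: "B *\<^sub>v (Q *\<^sub>v y) = Q *\<^sub>v (A *\<^sub>v y)" if "y \<in> carrier_vec d" for y
  proof -
    have "Q * A = B * Q"
    proof -
      have "Q * A = (Q * P) * (B * Q)"
        unfolding PQ(3) using c by (simp add: assoc_mult_mat[of _ d d _ d _ d])
      then show ?thesis using PQ(2) c by simp
    qed
    then show ?thesis using c A that by (metis assoc_mult_mat_vec)
  qed
  have det0: "y = 0\<^sub>v d" if y: "y \<in> carrier_vec d" "A *\<^sub>v y = l \<cdot>\<^sub>v y" "(Q *\<^sub>v y) $ length es = 0" for y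
  proof -
    have "Q *\<^sub>v y = 0\<^sub>v d"
      by (rule zero) (use c y QA[OF y(1)] in \<open>auto simp: mult_mat_vec[of _ d d]\<close>)
    then have "P *\<^sub>v (Q *\<^sub>v y) = 0\<^sub>v d" using c by (auto intro!: eq_vecI)
    then show ?thesis using PQ(1) c y(1) by (metis assoc_mult_mat_vec one_mult_mat_vec)
  qed
  define \<alpha> where "\<alpha> = (Q *\<^sub>v u) $ length es"
  define \<beta> where "\<beta> = (Q *\<^sub>v v) $ length es"
  \<comment> \<open>In this combination the last Schur coordinates cancel, so it vanishes and
    \<open>\<beta> u = \<alpha> v\<close>. Orthogonality then forces \<open>\<alpha> = 0\<close>,
    and with its last coordinate \<open>u\<close> itself vanishes.\<close>
  define w where "w = \<beta> \<cdot>\<^sub>v u + (- \<alpha>) \<cdot>\<^sub>v v"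
  have w: "w \<in> carrier_vec d" using u' v' by (simp add: w_def)
  have dist: "D *\<^sub>v w = \<beta> \<cdot>\<^sub>v (D *\<^sub>v u) + (- \<alpha>) \<cdot>\<^sub>v (D *\<^sub>v v)" if "D \<in> carrier_mat d d" for D
    unfolding w_def using that u' v' by (simp add: mult_add_distrib_mat_vec[of _ d d] mult_mat_vec[of _ d d])
  have "w = 0\<^sub>v d"
  proof (rule det0[OF w])
    show "A *\<^sub>v w = l \<cdot>\<^sub>v w" unfolding dist[OF A] using u' v'
      by (intro eq_vecI) (auto simp: w_def algebra_simps)
    show "(Q *\<^sub>v w) $ length es = 0" unfolding dist[OF c(3)] using c u' v' len
      by (simp add: \<alpha>_def \<beta>_def)
  qed
  then have "\<beta> *\<^sub>R pad u - \<alpha> *\<^sub>R pad v = 0" using u' v'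
    by (metis w_def pad_add pad_smult pad_zero smult_carrier_vec diff_conv_add_uminus scaleR_minus_left)
  then have eq: "\<beta> *\<^sub>R pad u = \<alpha> *\<^sub>R pad v" by simp
  have uv: "inner (pad u) (pad v) = 0" using orth u' v' by (simp add: inner_pad[of _ d])
  have "\<alpha> * inner (pad v) (pad v) = inner (\<beta> *\<^sub>R pad u) (pad v)" unfolding eq by simp
  also have "\<dots> = 0" using uv by simp
  finally have "\<alpha> = 0 \<or> pad v = 0" by simp
  moreover have "pad v \<noteq> 0" using v' pad_inject[OF v'(1), of "0\<^sub>v d"] by simp
  ultimately have "\<alpha> = 0" by simp
  then show False using det0[OF u'(1,3)] u'(2) by (simp add: \<alpha>_def)
qed

text \<open>Deflation: the top eigenvalue of \<open>A - l v v\<^sup>T\<close>, if not 0, is an eigenvalue of \<open>A\<close> with an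
  eigenvector orthogonal to \<open>v\<close>.\<close>

lemma qform_le_second_eigenvalue:
  assumes A: "A \<in> carrier_mat d d" "transpose_mat A = A" and d: "0 < d"
    and cp: "char_poly A = [:- l, 1:] * (\<Prod>e\<leftarrow>es. [:- e, 1:])" and l: "l \<notin> set es"
    and es: "\<And>e. e \<in> set es \<Longrightarrow> e \<le> l2" and l2: "0 \<le> l2"
    and v: "v \<in> usphere d" "A *\<^sub>v v = l \<cdot>\<^sub>v v"
    and x: "x \<in> carrier_vec d" "inner (pad v) (pad x) = 0"
  shows "qform A x \<le> l2 * (norm (pad x))\<^sup>2"
proof -
  have vc: "v \<in> carrier_vec d" "norm (pad v) = 1" using v by (auto simp: usphere_iff)
  define A' where "A' = mat d d (\<lambda>(i, j). A $$ (i, j) - l * v $ i * v $ j)"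
  have A': "A' \<in> carrier_mat d d" by (simp add: A'_def)
  have sym: "A $$ (j, i) = A $$ (i, j)" if "i < d" "j < d" for i j
    using A that by (metis index_transpose_mat(1) carrier_matD)
  have A't: "transpose_mat A' = A'"
    by (rule eq_matI) (auto simp: A'_def sym)
  have A'x: "pad (A' *\<^sub>v y) = pad (A *\<^sub>v y) - (l * inner (pad v) (pad y)) *\<^sub>R pad v"
    if y: "y \<in> carrier_vec d" for y
  proof -
    have "A' *\<^sub>v y = A *\<^sub>v y - (l * (v \<bullet> y)) \<cdot>\<^sub>v v"
    proof (rule eq_vecI)
      fix i assume "i < dim_vec (A *\<^sub>v y - (l * (v \<bullet> y)) \<cdot>\<^sub>v v)"
      then have i: "i < d" using vc by simp
      then show "(A' *\<^sub>v y) $ i = (A *\<^sub>v y - (l * (v \<bullet> y)) \<cdot>\<^sub>v v) $ i"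
        using A(1) y vc by (simp add: A'_def scalar_prod_def sum_subtractf sum_distrib_left
            sum_distrib_right algebra_simps)
    qed (use A vc in \<open>auto simp: A'_def\<close>)
    then show ?thesis using A vc y by (simp add: pad_diff[of _ d] inner_pad[of _ d])
  qed
  obtain s where s: "eigenvalue A' s" "\<And>x. x \<in> carrier_vec d \<Longrightarrow> qform A' x \<le> s * (norm (pad x))\<^sup>2"
    using symmetric_top_eigenvalue[OF A' A't d] by metis
  then obtain u where u: "u \<in> carrier_vec d" "u \<noteq> 0\<^sub>v d" "A' *\<^sub>v u = s \<cdot>\<^sub>v u"
    using A' unfolding eigenvalue_def eigenvector_def by auto
  have "s \<le> l2"
  \<comment> \<open>For \<open>s = 0\<close> the eigenvector may be \<open>v\<close> itself, moved
    to eigenvalue 0 by the deflation; that case is settled by \<open>0 \<le> l2\<close>.\<close>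
  proof (cases "s = 0")
    case False
    have "inner (pad (A' *\<^sub>v v)) (pad u) = inner (pad v) (pad (A' *\<^sub>v u))"
      by (rule symmetric_inner[OF A' A't u(1) vc(1)])
    moreover have "pad (A' *\<^sub>v v) = 0" unfolding A'x[OF vc(1)] v(2) using vc(2) by (simp add: norm_eq_1)
    ultimately have vu: "inner (pad v) (pad u) = 0" using u(3) False by simp
    then have "pad (A *\<^sub>v u) = pad (s \<cdot>\<^sub>v u)" using A'x[OF u(1)] u(3) by simp
    then have "A *\<^sub>v u = s \<cdot>\<^sub>v u" by (subst (asm) pad_inject[of _ d]) (use A u in auto)
    then have ev: "eigenvector A u s" using u A by (simp add: eigenvector_def)
    have "v \<noteq> 0\<^sub>v d" using vc by auto
    then have ev': "eigenvector A v l" using v vc A by (simp add: eigenvector_def)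
    have "s \<noteq> l"
      using simple_eigenvalue_not_orthogonal[OF A(1) cp l ev'] ev vu u vc by (auto simp: inner_pad[of _ d])
    have "poly (char_poly A) s = 0"
      using ev eigenvalue_root_char_poly[OF A(1)] by (auto simp: eigenvalue_def)
    then have "s \<in> set es" using \<open>s \<noteq> l\<close> unfolding cp
      by (auto simp: poly_prod_list prod_list_zero_iff)
    then show ?thesis by (rule es)
  qed (use l2 in simp)
  moreover have "qform A' x = qform A x" unfolding qform_def A'x[OF x(1)] x(2) by simp
  ultimately show ?thesis using s(2)[OF x(1)] by (metis mult_right_mono order_trans zero_le_power2)
qed

section \<open>The distributed covariance matrix\<close>

lemma gram_carrier: "M \<in> carrier_mat m d \<Longrightarrow> gram M \<in> carrier_mat d d"
  by (simp add: gram_def)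

lemma gram_symmetric: "transpose_mat (gram M) = gram M"
  unfolding gram_def by (subst transpose_mult[of _ "dim_col M" "dim_row M"]) auto

lemma gram_index:
  assumes "i < dim_col M" "j < dim_col M"
  shows "gram M $$ (i, j) = (\<Sum>r<dim_row M. M $$ (r, i) * M $$ (r, j))"
  using assms by (simp add: gram_def scalar_prod_def lessThan_atLeast0)

lemma gram_psd:
  assumes "M \<in> carrier_mat m d" "x \<in> carrier_vec d"
  shows "0 \<le> qform (gram M) x"
proof -
  have "qform (gram M) x = x \<bullet> (transpose_mat M *\<^sub>v (M *\<^sub>v x))"
    unfolding qform_def gram_def using assms by (subst inner_pad[of _ d]) auto
  also have "\<dots> = (M *\<^sub>v x) \<bullet> (M *\<^sub>v x)"
    using transpose_vec_mult_scalar[of M m d x "M *\<^sub>v x"] assms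
    by (metis comm_scalar_prod mult_mat_vec_carrier transpose_carrier_mat)
  also have "\<dots> = inner (pad (M *\<^sub>v x)) (pad (M *\<^sub>v x))"
    using assms by (intro inner_pad[symmetric, of _ m]) auto
  finally show ?thesis by simp
qed

lemma dim_col_local_data: "dim_col (local_data M P i) = dim_col M"
  by (simp add: local_data_def dim_submatrix)

text \<open>\<open>submatrix\<close> renumbers the chosen rows through \<open>pick\<close>; since
  \<open>pick\<close> is a bijection onto \<open>P i\<close>, summing over all rows undoes the
  renumbering.\<close>

lemma gram_local_data_index:
  assumes I: "P i \<subseteq> {..<dim_row M}" and ab: "a < dim_col M" "b < dim_col M"
  shows "gram (local_data M P i) $$ (a, b) = (\<Sum>r\<in>P i. M $$ (r, a) * M $$ (r, b))"
proof -
  have fin: "finite (P i)" using I finite_subset by blast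
  have set: "{r. r < dim_row M \<and> r \<in> P i} = P i" using I by auto
  have rows: "dim_row (local_data M P i) = card (P i)" by (simp add: local_data_def dim_submatrix set)
  have "inj_on (pick (P i)) {..<card (P i)}"
    by (rule inj_onI) (metis lessThan_iff linorder_neqE_nat less_irrefl pick_mono_le)
  moreover have "pick (P i) ` {..<card (P i)} \<subseteq> P i" using pick_in_set_le by auto
  ultimately have bij: "bij_betw (pick (P i)) {..<card (P i)} (P i)"
    by (metis bij_betw_def card_image card_lessThan card_subset_eq fin)
  have "gram (local_data M P i) $$ (a, b)
      = (\<Sum>r<card (P i). M $$ (pick (P i) r, a) * M $$ (pick (P i) r, b))"
    unfolding gram_index[of a "local_data M P i" b, unfolded dim_col_local_data, OF ab] rows
    by (rule sum.cong) (use ab in \<open>auto simp: local_data_def submatrix_index set pick_UNIV\<close>)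
  also have "\<dots> = (\<Sum>r\<in>P i. M $$ (r, a) * M $$ (r, b))"
    by (rule sum.reindex_bij_betw[OF bij])
  finally show ?thesis .
qed

lemma gram_local_data_sum:
  assumes M: "M \<in> carrier_mat m d" and P: "row_partition n m P" and x: "x \<in> carrier_vec d"
  shows "pad (gram M *\<^sub>v x) = (\<Sum>i<n. pad (gram (local_data M P i) *\<^sub>v x))"
proof -
  have PI: "P i \<subseteq> {..<m}" if "i < n" for i using P that by (auto simp: row_partition_def)
  have fin: "finite (P i)" if "i < n" for i using PI[OF that] finite_subset by blast
  have UN: "(\<Union>i<n. P i) = {..<m}" and dis: "disjoint_family_on P {..<n}"
    using P by (auto simp: row_partition_def)
  have G: "gram (local_data M P i) \<in> carrier_mat d d" for i
    by (rule gram_carrier, rule carrier_matI[OF refl]) (use M in \<open>simp add: dim_col_local_data\<close>)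
  have idx: "gram M $$ (a, b) = (\<Sum>i<n. gram (local_data M P i) $$ (a, b))" if ab: "a < d" "b < d" for a b
  proof -
    have "gram M $$ (a, b) = (\<Sum>r\<in>(\<Union>i<n. P i). M $$ (r, a) * M $$ (r, b))"
      unfolding UN using gram_index[of a M b] M ab by simp
    also have "\<dots> = (\<Sum>i<n. \<Sum>r\<in>P i. M $$ (r, a) * M $$ (r, b))"
      by (rule sum.UNION_disjoint) (use dis fin in \<open>auto simp: disjoint_family_on_def\<close>)
    also have "\<dots> = (\<Sum>i<n. gram (local_data M P i) $$ (a, b))"
      by (rule sum.cong[OF refl]) (use gram_local_data_index[of P _ M a b] PI M ab in auto)
    finally show ?thesis .
  qed
  have c: "coord (\<Sum>i<n. pad (F i)) k = (\<Sum>i<n. coord (pad (F i)) k)" for F k and n :: nat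
    by (induction n) (auto simp: coord_simps)
  show ?thesis
  proof (rule fin_seq_eqI)
    fix k
    show "coord (pad (gram M *\<^sub>v x)) k = coord (\<Sum>i<n. pad (gram (local_data M P i) *\<^sub>v x)) k"
    proof (cases "k < d")
      case True
      have e: "(B *\<^sub>v x) $ k = (\<Sum>j<d. B $$ (k, j) * x $ j)" if "B \<in> carrier_mat d d" for B
        using that x True by (simp add: scalar_prod_def lessThan_atLeast0)
      have "(\<Sum>j<d. gram M $$ (k, j) * x $ j) = (\<Sum>j<d. \<Sum>i<n. gram (local_data M P i) $$ (k, j) * x $ j)"
        by (rule sum.cong) (use idx True in \<open>auto simp: sum_distrib_right\<close>)
      also have "\<dots> = (\<Sum>i<n. \<Sum>j<d. gram (local_data M P i) $$ (k, j) * x $ j)" by (rule sum.swap)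
      finally show ?thesis unfolding c coord_pad
        using e[OF G] e[OF gram_carrier[OF M]] carrier_matD(1)[OF gram_carrier[OF M]]
          carrier_matD(1)[OF G] True by (simp del: index_mult_mat_vec)
    next
      case False
      then show ?thesis unfolding c coord_pad
        using carrier_matD(1)[OF gram_carrier[OF M]] carrier_matD(1)[OF G] by simp
    qed
  qed
qed

text \<open>Along a coordinate line the objective is a quadratic polynomial, so the partial
  derivative is its linear coefficient, in which symmetry merges the two mixed terms.\<close>

lemma pad_rgrad:
  assumes B: "B \<in> carrier_mat d d" "transpose_mat B = B" and x: "x \<in> carrier_vec d"
  shows "pad (rgrad d (pca_obj B) x) = rayleigh_grad (pad x) (pad (B *\<^sub>v x))"
    and "rgrad d (pca_obj B) x \<in> carrier_vec d"
proof -
  have Bx: "B *\<^sub>v x \<in> carrier_vec d" using B x by simp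
  have "deriv (\<lambda>s. pca_obj B (x + s \<cdot>\<^sub>v unit_vec d k)) 0 = - 2 * (B *\<^sub>v x) $ k" if k: "k < d" for k
  proof -
    define e where "e = (unit_vec d k :: real vec)"
    have e: "e \<in> carrier_vec d" by (simp add: e_def)
    have Be: "B *\<^sub>v e \<in> carrier_vec d" using B e by simp
    have ek: "inner (pad e) (pad (B *\<^sub>v x)) = (B *\<^sub>v x) $ k"
      using Bx e k by (simp add: inner_pad[of _ d] e_def)
    have eq: "pca_obj B (x + s \<cdot>\<^sub>v e) = - (qform B x + 2 * s * (B *\<^sub>v x) $ k + s\<^sup>2 * qform B e)" for s
    proof -
      have c: "x + s \<cdot>\<^sub>v e \<in> carrier_vec d" using x e by simp
      have "B *\<^sub>v (x + s \<cdot>\<^sub>v e) = B *\<^sub>v x + s \<cdot>\<^sub>v (B *\<^sub>v e)"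
        using B x e by (simp add: mult_add_distrib_mat_vec[of _ d d] mult_mat_vec[of _ d d])
      then have "pca_obj B (x + s \<cdot>\<^sub>v e) = - inner (pad x + s *\<^sub>R pad e) (pad (B *\<^sub>v x) + s *\<^sub>R pad (B *\<^sub>v e))"
        unfolding pca_obj_def using c x e Bx Be
        by (simp add: inner_pad[OF c, symmetric] pad_add[of _ d])
      moreover have "inner (pad x) (pad (B *\<^sub>v e)) = (B *\<^sub>v x) $ k"
        using symmetric_inner[OF B e x] ek by (simp add: inner_commute)
      ultimately show ?thesis using ek unfolding qform_def
        by (simp add: inner_add_left inner_add_right power2_eq_square algebra_simps)
    qed
    have "((\<lambda>s. pca_obj B (x + s \<cdot>\<^sub>v e)) has_real_derivative - 2 * (B *\<^sub>v x) $ k) (at 0)"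
      unfolding eq by (auto intro!: derivative_eq_intros)
    then show ?thesis unfolding e_def by (rule DERIV_imp_deriv)
  qed
  then have nab: "nabla d (pca_obj B) x = (- 2) \<cdot>\<^sub>v (B *\<^sub>v x)"
    using Bx carrier_matD(1)[OF B(1)] by (intro eq_vecI) (auto simp: nabla_def simp del: index_mult_mat_vec)
  show "pad (rgrad d (pca_obj B) x) = rayleigh_grad (pad x) (pad (B *\<^sub>v x))"
    unfolding rgrad_def nab rayleigh_grad_def using x Bx by (simp add: pad_tproj[of _ d] algebra_simps)
  show "rgrad d (pca_obj B) x \<in> carrier_vec d"
    unfolding rgrad_def nab tproj_def using x Bx by simp
qed

section \<open>Convergence of the quantized iteration\<close>

lemma rayleigh_grad_sum:
  "(\<Sum>i\<in>I. rayleigh_grad x (z i)) = rayleigh_grad x (\<Sum>i\<in>I. z i)"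
  by (induction I rule: infinite_finite_induct)
    (simp_all add: rayleigh_grad_def inner_add_right algebra_simps)

lemma norm_diff_via: "norm (x - z) \<le> norm (x - y) + norm (y - z)"
  for x y z :: "'a::real_normed_vector"
  by (rule norm_diff_triangle_le[OF order_refl order_refl])

text \<open>\<open>v\<close> is whichever signed eigenvector is nearest to the start.
  \<open>a\<close> abbreviates the overlap c p / sqrt d; its bound holds because c is at most 1 and
  d at least 2. \<open>bound\<close> is the operator norm bound hidden in \<gamma>, as each A_i is
  positive semidefinite.\<close>

locale qrgd =
  fixes n d i\<^sub>0 :: nat and A :: "nat \<Rightarrow> real mat" and Q enc dec b \<phi> and C\<^sub>Q :: real
    and v :: "real vec" and l \<delta> \<gamma> a \<eta> D \<sigma> \<theta> :: real and R :: "nat \<Rightarrow> real"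
  assumes i0: "i\<^sub>0 < n"
    and A: "\<And>i. A i \<in> carrier_mat d d" "\<And>i. transpose_mat (A i) = A i"
    and bound: "\<And>i x. i < n \<Longrightarrow> x \<in> carrier_vec d \<Longrightarrow>
      norm (pad (A i *\<^sub>v x)) \<le> \<gamma> / (2 * real n) * norm (pad x)"
    and v: "v \<in> usphere d"
    and step: "\<And>x. x \<in> usphere d \<Longrightarrow> 0 \<le> inner (pad x) (pad v) \<Longrightarrow>
      rayleigh_step (pad x) (pad v) (\<Sum>i<n. pad (A i *\<^sub>v x)) l \<delta> \<gamma>"
    and \<delta>: "0 < \<delta>" "\<delta> \<le> l" "2 * l \<le> \<gamma>"
    and quant: "quantizer d C\<^sub>Q Q enc dec b"
    and iso: "\<And>x. x \<in> usphere d \<Longrightarrow> tangent_isometry d x (\<phi> x)"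
    and a: "0 < a" "a\<^sup>2 \<le> 1 / 2"
    and \<eta>: "\<eta> = a / \<gamma>" and D: "D = arccos a" and \<sigma>: "\<sigma> = par_sigma D (\<delta> / 2) \<eta>"
    and \<theta>: "\<theta> = par_theta \<sigma>" and R: "R = par_R \<gamma> D \<sigma>"
begin

abbreviation "K \<equiv> par_K \<sigma>"
abbreviation "\<rho> \<equiv> par_sqrt_xi \<sigma>"
abbreviation "h \<equiv> 1 - sqrt \<sigma>"
abbreviation "g i x \<equiv> rgrad d (pca_obj (A i)) x"
abbreviation "QT \<equiv> tangent_Q d \<phi> Q"

lemma n: "0 < n" using i0 by simp

lemma \<gamma>: "0 < \<gamma>" "2 * \<delta> \<le> \<gamma>" using \<delta> by auto

text \<open>A rational number just above 1 / sqrt 2, for linear arithmetic.\<close>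

lemma a_le: "a \<le> 71/100"
proof (rule power2_le_imp_le)
  show "a\<^sup>2 \<le> (71/100)\<^sup>2" using a by (simp add: power2_eq_square)
qed simp

lemma cos_D: "cos D = a" unfolding D using a a_le by (intro cos_arccos) auto

lemma D_bounds: "pi / 4 \<le> D" "D \<le> pi / 2" "0 < D"
proof -
  have "a \<le> cos (pi / 4)"
  proof (rule power2_le_imp_le)
    show "a\<^sup>2 \<le> (cos (pi / 4))\<^sup>2" using a by (simp add: cos_45 power_divide)
    show "0 \<le> cos (pi / 4)" by (simp add: cos_45)
  qed
  then have "arccos (cos (pi / 4)) \<le> D" unfolding D using a
    by (intro arccos_le_arccos) auto
  then show "pi / 4 \<le> D" by (simp add: arccos_cos)
  then show "0 < D" using pi_gt_zero by linarith
  show "D \<le> pi / 2" unfolding D using a a_le by (intro arccos_le_pi2) auto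
qed

text \<open>For this step size \<open>cos D * \<mu> * \<eta>\<close> equals
  \<open>a\<^sup>2 * \<delta> / (2 * \<gamma>)\<close>, which is at most 1/2, so the first branch of
  \<open>par_sigma\<close> always applies.\<close>

lemma \<sigma>_eq: "\<sigma> = 1 - a\<^sup>2 * \<delta> / (2 * \<gamma>)"
  and \<sigma>_eq': "\<sigma> = 1 - a * (\<delta> / 2) * \<eta>" and \<sigma>_bounds: "1 / 2 \<le> \<sigma>" "\<sigma> < 1"
proof -
  have eq: "a * (\<delta> / 2) * \<eta> = a\<^sup>2 * \<delta> / (2 * \<gamma>)" by (simp add: \<eta> power2_eq_square)
  have "a\<^sup>2 * \<delta> \<le> 1 * \<gamma>" using a \<delta> \<gamma> by (intro mult_mono) auto
  then have le: "a\<^sup>2 * \<delta> / (2 * \<gamma>) \<le> 1 / 2" using \<gamma> by (simp add: field_simps)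
  show "\<sigma> = 1 - a * (\<delta> / 2) * \<eta>" unfolding \<sigma> par_sigma_def cos_D eq using le by simp
  then show 1: "\<sigma> = 1 - a\<^sup>2 * \<delta> / (2 * \<gamma>)" unfolding eq .
  show "1 / 2 \<le> \<sigma>" using le unfolding 1 by simp
  show "\<sigma> < 1" unfolding 1 using a \<delta> \<gamma> by simp
qed

lemma sqrt_\<sigma>: "7/10 \<le> sqrt \<sigma>" "sqrt \<sigma> < 1"
proof -
  show "7/10 \<le> sqrt \<sigma>" using \<sigma>_bounds by (intro real_le_rsqrt) (simp add: power2_eq_square)
  show "sqrt \<sigma> < 1" using \<sigma>_bounds by simp
qed

lemma sqrt_\<sigma>_pos: "0 < sqrt \<sigma>"
  by (rule less_le_trans[OF _ sqrt_\<sigma>(1)]) simp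

text \<open>\<open>h\<close> is the margin of the exact step. Its lower bound, half of 1 - \<sigma>,
  is what produces the factor \<gamma> / (a^2 \<delta>) in the number of rounds.\<close>

lemma h: "0 < h" "h \<le> 3/10" "a\<^sup>2 * \<delta> / (4 * \<gamma>) \<le> h"
proof -
  show "0 < h" "h \<le> 3/10" using sqrt_\<sigma> by auto
  have "1 - \<sigma> = h * (1 + sqrt \<sigma>)" using \<sigma>_bounds by (simp add: algebra_simps)
  also have "\<dots> \<le> h * 2" using sqrt_\<sigma> by (intro mult_left_mono) auto
  finally show "a\<^sup>2 * \<delta> / (4 * \<gamma>) \<le> h" unfolding \<sigma>_eq by simp
qed

text \<open>The parameters grant half of the margin \<open>h\<close> to the quantization error, so
  the rate worsens from 1 - h to 1 - h/2. That \<open>K * \<rho>\<close> is at least 2 leaves room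
  for the drift of the gradient between rounds.\<close>

lemma params: "\<theta> * K = h / 2" "\<rho> = 1 - h / 2" "K * \<rho> = 2 + K * (h / 2)" "2 \<le> K"
  "\<theta> = sqrt \<sigma> * h / 4"
proof -
  have s: "sqrt \<sigma> \<noteq> 0" using sqrt_\<sigma> by auto
  show 1: "\<theta> * K = h / 2" and 2: "\<theta> = sqrt \<sigma> * h / 4"
    using s by (simp_all add: \<theta> par_theta_def par_K_def field_simps)
  show 3: "\<rho> = 1 - h / 2" unfolding par_sqrt_xi_def \<theta>[symmetric] 1 by (simp add: field_simps)
  show "2 \<le> K" unfolding par_K_def pos_le_divide_eq[OF sqrt_\<sigma>_pos] using sqrt_\<sigma>(2) by linarith
  have "\<rho> = h / 2 + sqrt \<sigma>" unfolding par_sqrt_xi_def \<theta>[symmetric] 1 ..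
  then show "K * \<rho> = 2 + K * (h / 2)" using s by (simp add: par_K_def field_simps)
qed

lemma \<theta>_pos: "0 < \<theta>" unfolding params by (intro divide_pos_pos mult_pos_pos sqrt_\<sigma>_pos h(1)) simp

lemma \<rho>: "0 < \<rho>" "\<rho> < 1" unfolding params using h by auto

lemma \<rho>_power_le: "\<rho> ^ t \<le> 1" using \<rho> by (intro power_le_one) auto

lemma R_eq: "R t = \<gamma> * K * (\<rho> ^ t * D)" unfolding R par_R_def by simp

lemma R_pos: "0 < R t" unfolding R_eq using \<gamma> params(4) \<rho> D_bounds by simp

lemma \<theta>R: "\<theta> * R t = \<gamma> * (h / 2) * (\<rho> ^ t * D)" unfolding R_eq params(1)[symmetric] by (simp add: mult_ac)

lemma widths_pos: "0 < up_y n \<gamma> R t" "0 < up_w n \<theta> R t" "0 < down_y \<gamma> \<theta> R t" "0 < down_w \<theta> R t"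
  using n \<gamma> R_pos \<theta>_pos
  by (auto simp: up_y_def up_w_def down_y_def down_w_def intro!: add_pos_pos mult_pos_pos divide_pos_pos)

lemma pad_g: "x \<in> carrier_vec d \<Longrightarrow> pad (g i x) = rayleigh_grad (pad x) (pad (A i *\<^sub>v x))"
  using pad_rgrad(1)[OF A] .

lemma g_tangent: "x \<in> usphere d \<Longrightarrow> g i x \<in> tangent d x"
  using pad_rgrad(2)[OF A] inner_rayleigh_grad[of "pad x"] by (auto simp: tangent_iff usphere_iff pad_g)

lemma norm_g_le:
  assumes "x \<in> usphere d" "i < n"
  shows "norm (pad (g i x)) \<le> \<gamma> / n"
proof -
  have x: "x \<in> carrier_vec d" "norm (pad x) = 1" using assms by (auto simp: usphere_iff)
  have "norm (pad (g i x)) \<le> 2 * norm (pad (A i *\<^sub>v x))"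
    unfolding pad_g[OF x(1)] by (rule norm_rayleigh_grad_le[OF x(2)])
  also have "\<dots> \<le> \<gamma> / n" using bound[OF assms(2) x(1)] x(2) by simp
  finally show ?thesis .
qed

lemma sum_le_n: "(\<And>i. i < n \<Longrightarrow> norm (F i) \<le> c / n) \<Longrightarrow> norm (\<Sum>i<n. F i) \<le> (c::real)"
  for F :: "nat \<Rightarrow> fin_seq"
  using sum_norm_le[of "{..<n}" F "\<lambda>_. c / n"] n by simp

text \<open>The induction invariant. The error of \<open>q\<close> is the sum of n upstream errors
  of \<open>\<theta> * R t / (2 * n)\<close> and one downstream error of
  \<open>\<theta> * R t / 2\<close>.\<close>

definition close :: "nat \<Rightarrow> real vec \<Rightarrow> (nat \<Rightarrow> real vec) \<Rightarrow> real vec \<Rightarrow> bool" where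
  "close t x qm q \<longleftrightarrow> x \<in> usphere d \<and> sdist x v \<le> \<rho> ^ t * D \<and>
    (\<forall>i<n. qm i \<in> tangent d x \<and> norm (pad (qm i) - pad (g i x)) \<le> up_w n \<theta> R t) \<and>
    q \<in> tangent d x \<and> norm (pad q - (\<Sum>i<n. pad (g i x))) \<le> \<theta> * R t"

lemma finsum_tangent:
  assumes "x \<in> usphere d" "\<And>i. i < n \<Longrightarrow> qm i \<in> tangent d x"
  shows "finsum_vec TYPE(real) d qm {..<n} \<in> tangent d x"
    and "pad (finsum_vec TYPE(real) d qm {..<n}) = (\<Sum>i<n. pad (qm i))"
proof -
  have c: "qm \<in> {..<n} \<rightarrow> carrier_vec d" using assms by (auto simp: tangent_def)
  show p: "pad (finsum_vec TYPE(real) d qm {..<n}) = (\<Sum>i<n. pad (qm i))"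
    by (rule pad_finsum) (use c in auto)
  have x: "x \<in> carrier_vec d" using assms by (simp add: usphere_def)
  have "inner (pad x) (\<Sum>i<n. pad (qm i)) = 0"
    unfolding inner_sum_right using assms(2) x by (intro sum.neutral) (auto simp: tangent_iff)
  then show "finsum_vec TYPE(real) d qm {..<n} \<in> tangent d x"
    using finsum_vec_closed[OF c] p x by (simp add: tangent_iff)
qed

lemma finsum_close:
  assumes "x \<in> usphere d"
    and "\<And>i. i < n \<Longrightarrow> qm i \<in> tangent d x \<and> norm (pad (qm i) - pad (g i x)) \<le> up_w n \<theta> R t"
  shows "norm (pad (finsum_vec TYPE(real) d qm {..<n}) - (\<Sum>i<n. pad (g i x))) \<le> \<theta> * R t / 2"
proof -
  have "norm (\<Sum>i<n. pad (qm i) - pad (g i x)) \<le> \<theta> * R t / 2"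
    by (rule sum_le_n) (use assms(2) in \<open>auto simp: up_w_def field_simps\<close>)
  then show ?thesis using finsum_tangent(2)[of x qm] assms by (simp add: sum_subtractf)
qed

text \<open>Round 0 has no old vector to refer to, so gradients of other machines serve as
  references. All of them and their sum have norm at most \<gamma>, which the radii with 2 \<gamma>
  pi cover.\<close>

lemma close_init:
  assumes x: "x \<in> usphere d" "sdist x v \<le> D"
    and qm: "\<And>i. i < n \<Longrightarrow> qm i = QT x (g i x) (g i\<^sub>0 x) (up_y n \<gamma> R 0) (up_w n \<theta> R 0)"
  defines "r \<equiv> finsum_vec TYPE(real) d qm {..<n}"
  shows "j < n \<Longrightarrow> close 0 x qm (QT x r (g j x) (down_y \<gamma> \<theta> R 0) (down_w \<theta> R 0))"
    and "i < n \<Longrightarrow> j < n \<Longrightarrow> QT x r (g i x) (down_y \<gamma> \<theta> R 0) (down_w \<theta> R 0) =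
      QT x r (g j x) (down_y \<gamma> \<theta> R 0) (down_w \<theta> R 0)"
proof -
  have xc: "x \<in> carrier_vec d" using x by (simp add: usphere_def)
  have small: "norm (pad (g i x)) \<le> \<gamma>" if "i < n" for i
  proof -
    have "\<gamma> / n \<le> \<gamma>" using n \<gamma> by (simp add: field_simps)
    then show ?thesis using norm_g_le[OF x(1) that] by linarith
  qed
  have pi: "2 * \<gamma> \<le> 2 * \<gamma> * pi" using \<gamma> pi_ge_two by simp
  have up: "qm i \<in> tangent d x \<and> norm (pad (qm i) - pad (g i x)) \<le> up_w n \<theta> R 0" if i: "i < n" for i
  proof -
    have "norm (pad (g i x) - pad (g i\<^sub>0 x)) \<le> up_y n \<gamma> R 0"
      using norm_triangle_ineq4[of "pad (g i x)" "pad (g i\<^sub>0 x)"] small[OF i] small[OF i0] pi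
      by (simp add: up_y_def)
    from tangent_Q[where \<phi> = \<phi>, OF quant iso[OF x(1)] xc g_tangent[OF x(1), of i]
        g_tangent[OF x(1), of i\<^sub>0] widths_pos(1,2)[of 0] this]
    show ?thesis using qm[OF i] by simp
  qed
  have r: "r \<in> tangent d x" unfolding r_def by (rule finsum_tangent(1)[OF x(1)]) (use up in auto)
  have r': "norm (pad r - (\<Sum>i<n. pad (g i x))) \<le> \<theta> * R 0 / 2"
    unfolding r_def by (rule finsum_close[OF x(1) up])
  have G: "norm (\<Sum>i<n. pad (g i x)) \<le> \<gamma>" by (rule sum_le_n) (use norm_g_le[OF x(1)] in auto)
  have rg: "norm (pad r - pad (g i x)) \<le> down_y \<gamma> \<theta> R 0" if i: "i < n" for i
  proof -
    have "norm (pad r - pad (g i x)) \<le> norm (pad r - (\<Sum>i<n. pad (g i x)))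
        + norm ((\<Sum>i<n. pad (g i x)) - pad (g i x))" by (rule norm_diff_via)
    then show ?thesis
      using r' G small[OF i] pi norm_triangle_ineq4[of "\<Sum>i<n. pad (g i x)" "pad (g i x)"]
      by (simp add: down_y_def)
  qed
  note dQ = tangent_Q[where \<phi> = \<phi>, OF quant iso[OF x(1)] xc r g_tangent[OF x(1)] widths_pos(3,4)[of 0] rg]
  show "close 0 x qm (QT x r (g j x) (down_y \<gamma> \<theta> R 0) (down_w \<theta> R 0))" if j: "j < n"
  proof -
    have "norm (pad (QT x r (g j x) (down_y \<gamma> \<theta> R 0) (down_w \<theta> R 0)) - (\<Sum>i<n. pad (g i x)))
        \<le> \<theta> * R 0"
      using norm_diff_via[of "pad (QT x r (g j x) (down_y \<gamma> \<theta> R 0) (down_w \<theta> R 0))"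
          "\<Sum>i<n. pad (g i x)" "pad r"] r' dQ(2)[OF j] by (simp add: down_w_def)
    then show ?thesis unfolding close_def using x up dQ(1)[OF j] by simp
  qed
  show "QT x r (g i x) (down_y \<gamma> \<theta> R 0) (down_w \<theta> R 0) =
      QT x r (g j x) (down_y \<gamma> \<theta> R 0) (down_w \<theta> R 0)" if "i < n" "j < n"
    using dQ(3)[OF that(2) g_tangent[OF x(1)] rg[OF that(1)]] .
qed

lemma close_step:
  assumes cl: "close t x qm q"
    and x': "x' = sexp x ((- \<eta>) \<cdot>\<^sub>v q)"
    and qm': "\<And>i. i < n \<Longrightarrow> qm' i = QT x' (g i x') (transport d x x' (qm i))
      (up_y n \<gamma> R (Suc t)) (up_w n \<theta> R (Suc t))"
    and q': "q' = QT x' (finsum_vec TYPE(real) d qm' {..<n}) (transport d x x' q)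
      (down_y \<gamma> \<theta> R (Suc t)) (down_w \<theta> R (Suc t))"
  shows "close (Suc t) x' qm' q'"
proof -
  define X where "X = pad x"
  define G where "G = (\<lambda>x. \<Sum>i<n. pad (g i x))"
  define \<phi>\<^sub>x where "\<phi>\<^sub>x = arccos (inner X (pad v))"
  define E where "E = \<rho> ^ t * D"
  define L where "L = - \<eta> *\<^sub>R pad q"
  have x: "x \<in> usphere d" "sdist x v \<le> E" and q: "q \<in> tangent d x" "norm (pad q - G x) \<le> \<theta> * R t"
    and qm: "\<And>i. i < n \<Longrightarrow> qm i \<in> tangent d x \<and> norm (pad (qm i) - pad (g i x)) \<le> up_w n \<theta> R t"
    using cl unfolding close_def G_def E_def by auto
  have xc: "x \<in> carrier_vec d" and X: "norm X = 1" using x by (auto simp: usphere_iff X_def)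
  have vc: "v \<in> carrier_vec d" and V: "norm (pad v) = 1" using v by (auto simp: usphere_iff)
  have qc: "q \<in> carrier_vec d" and Xq: "inner X (pad q) = 0" using q xc by (auto simp: tangent_iff X_def)
  have E: "0 \<le> E" "E \<le> D" using \<rho> D_bounds \<rho>_power_le[of t] mult_right_mono[of "\<rho> ^ t" 1 D] by (auto simp: E_def)
  have \<phi>le: "\<phi>\<^sub>x \<le> E" using x(2) by (simp add: \<phi>\<^sub>x_def sdist_pad[OF xc vc] X_def)
  have abs: "\<bar>inner X (pad v)\<bar> \<le> 1" using Cauchy_Schwarz_ineq2[of X "pad v"] X V by simp
  have a_inner: "a \<le> inner X (pad v)"
  proof -
    have "cos D \<le> cos \<phi>\<^sub>x" using \<phi>le E D_bounds abs
      by (intro cos_monotone_0_pi_le) (auto simp: \<phi>\<^sub>x_def intro!: arccos_lbound)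
    then show ?thesis unfolding cos_D \<phi>\<^sub>x_def using abs by (simp add: abs_le_iff)
  qed
  define z where "z = (\<Sum>i<n. pad (A i *\<^sub>v x))"
  interpret rs: rayleigh_step X "pad v" z l \<delta> \<gamma>
    using step[OF x(1)] a_inner a unfolding X_def z_def by simp
  have rs\<phi>: "rs.\<phi> = \<phi>\<^sub>x" by (simp add: rs.\<phi>_def \<phi>\<^sub>x_def)
  have Gz: "G x = rayleigh_grad X z"
    unfolding G_def z_def X_def rayleigh_grad_sum[symmetric] using pad_g[OF xc] by simp
  have \<eta>0: "0 < \<eta>" "\<eta> * \<gamma> = a" using a \<gamma> by (auto simp: \<eta>)
  have qE: "norm (pad q) \<le> \<gamma> * (1 + h / 2) * E"
  proof -
    have "norm (pad q) \<le> norm (G x) + norm (pad q - G x)" by (rule norm_triangle_sub)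
    also have "\<dots> \<le> \<gamma> * E + \<gamma> * (h / 2) * E"
      using rs.norm_grad_le mult_left_mono[OF \<phi>le, of \<gamma>] \<gamma> q(2)
      unfolding Gz rs\<phi> \<theta>R E_def by linarith
    finally show ?thesis by (simp add: algebra_simps)
  qed
  have L_le: "norm L \<le> a * (1 + h / 2) * E"
  proof -
    have "norm L \<le> \<eta> * (\<gamma> * (1 + h / 2) * E)"
      unfolding L_def using \<eta>0 mult_left_mono[OF qE, of \<eta>] by simp
    also have "\<dots> = (\<eta> * \<gamma>) * (1 + h / 2) * E" by (simp only: mult.assoc)
    finally show ?thesis unfolding \<eta>0(2) .
  qed
  \<comment> \<open>The product of 71/100 and 1 + 3/20, rounded up. What matters later is that twice
    41/50 plus 3/20 stays below 2.\<close>
  have ah: "a * (1 + h / 2) \<le> (41/50)"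
  proof -
    have "a * (1 + h / 2) \<le> 71/100 * (23/20)" using a a_le h by (intro mult_mono) auto
    then show ?thesis by simp
  qed
  have L_le': "norm L \<le> (41/50) * E" using L_le mult_right_mono[OF ah E(1)] by linarith
  then have L_pi: "norm L \<le> pi / 2" using E D_bounds by linarith
  have lt: "(- \<eta>) \<cdot>\<^sub>v q \<in> tangent d x" using q xc by (simp add: tangent_iff)
  have lc: "(- \<eta>) \<cdot>\<^sub>v q \<in> carrier_vec d" using qc by simp
  have vl: "vnorm ((- \<eta>) \<cdot>\<^sub>v q) < pi"
  proof -
    have "vnorm ((- \<eta>) \<cdot>\<^sub>v q) = norm L" by (simp add: norm_pad[symmetric] L_def)
    then show ?thesis using L_pi pi_gt_zero by linarith
  qed
  have x's: "x' \<in> usphere d" unfolding x' by (rule sexp_usphere[OF x(1) lt])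
  then have x'c: "x' \<in> carrier_vec d" by (simp add: usphere_def)
  have X': "pad x' = gexp X L" unfolding x' pad_sexp[OF xc lc] X_def L_def by simp
  have XL: "inner X L = 0" unfolding L_def using Xq by simp
  have tr: "transport d x x' u \<in> tangent d x'" "pad (transport d x x' u) = ptrans X L (pad u)"
    if u: "u \<in> tangent d x" for u
  proof -
    have uc: "u \<in> carrier_vec d" using u by (simp add: tangent_def)
    show "transport d x x' u \<in> tangent d x'"
      using transport_eq[OF x(1) lt vl u] by (simp add: x')
    show "pad (transport d x x' u) = ptrans X L (pad u)"
      unfolding x' transport_eq(1)[OF x(1) lt vl u] pad_vptrans[OF xc lc uc] by (simp add: X_def L_def)
  qed
  have P_iso: "norm (ptrans X L (pad u) - ptrans X L (pad w)) = norm (pad u - pad w)"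
    if "u \<in> tangent d x" "w \<in> tangent d x" for u w
    unfolding ptrans_diff[symmetric] using that xc
    by (intro norm_ptrans[OF X XL]) (simp add: tangent_iff X_def inner_diff_right)
  have smooth: "norm (pad (g i x') - ptrans X L (pad (g i x))) \<le> 2 * \<gamma> * norm L / n" if i: "i < n" for i
  proof -
    have c: "x' - x \<in> carrier_vec d" using xc x'c by simp
    have "norm (pad (A i *\<^sub>v x') - pad (A i *\<^sub>v x)) \<le> \<gamma> / (2 * n) * norm (gexp X L - X)"
    proof -
      have "pad (A i *\<^sub>v (x' - x)) = pad (A i *\<^sub>v x') - pad (A i *\<^sub>v x)"
        using A(1)[of i] xc x'c by (simp add: mult_minus_distrib_mat_vec[of _ d d] pad_diff[of _ d])
      moreover have "pad (x' - x) = gexp X L - X"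
        using pad_diff[OF x'c xc] by (simp add: X' X_def)
      ultimately show ?thesis using bound[OF i c] by simp
    qed
    moreover have "norm (pad (A i *\<^sub>v x)) \<le> \<gamma> / (2 * n)"
      using bound[OF i xc] X by (simp add: X_def)
    ultimately have "norm (rayleigh_grad (gexp X L) (pad (A i *\<^sub>v x')) -
        ptrans X L (rayleigh_grad X (pad (A i *\<^sub>v x)))) \<le> 4 * (\<gamma> / (2 * n)) * norm L"
      by (intro rayleigh_grad_lipschitz[OF X XL])
    then show ?thesis unfolding pad_g[OF xc] pad_g[OF x'c] X' X_def[symmetric] using n by simp
  qed
  \<comment> \<open>The old vector misses the new gradient by the drift of the gradient plus the old
    quantization error; both together must fit into the next radius. The factor \<open>K\<close> in
    \<open>R\<close> exists for this, making the radius at least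
    \<open>2 * \<gamma> * E\<close>.\<close>
  have budget: "2 * \<gamma> * norm L + \<theta> * R t \<le> R (Suc t)"
  proof -
    have "2 * \<gamma> * norm L \<le> 2 * \<gamma> * ((41/50) * E)"
      using L_le' \<gamma> by (intro mult_left_mono) auto
    moreover have "\<theta> * R t \<le> \<gamma> * (3/20) * E" unfolding \<theta>R E_def[symmetric]
      using \<gamma> h E by (intro mult_right_mono mult_left_mono) auto
    moreover have "\<gamma> * (2 * E) \<le> R (Suc t)"
    proof -
      have "R (Suc t) = \<gamma> * ((K * \<rho>) * E)" unfolding R_eq E_def by (simp add: mult_ac)
      moreover have "2 \<le> K * \<rho>" unfolding params(3) using params(4) h by simp
      ultimately show ?thesis using mult_right_mono[OF _ E(1), of 2 "K * \<rho>"] \<gamma> by simp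
    qed
    moreover have "0 \<le> \<gamma> * E" using \<gamma> E by simp
    ultimately show ?thesis by (simp add: mult_ac)
  qed
  have up: "qm' i \<in> tangent d x' \<and> norm (pad (qm' i) - pad (g i x')) \<le> up_w n \<theta> R (Suc t)" if i: "i < n" for i
  proof -
    have "norm (pad (g i x') - pad (transport d x x' (qm i)))
        \<le> norm (pad (g i x') - ptrans X L (pad (g i x)))
          + norm (ptrans X L (pad (g i x)) - ptrans X L (pad (qm i)))"
      unfolding tr(2)[OF conjunct1[OF qm[OF i]]] by (rule norm_diff_via)
    also have "\<dots> \<le> 2 * \<gamma> * norm L / n + up_w n \<theta> R t"
      using smooth[OF i] P_iso[OF g_tangent[OF x(1)] conjunct1[OF qm[OF i]]] qm[OF i]
      by (simp add: norm_minus_commute)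
    also have "\<dots> \<le> R (Suc t) / n"
    proof -
      have "up_w n \<theta> R t \<le> \<theta> * R t / n" unfolding up_w_def using n \<theta>_pos R_pos[of t]
        by (simp add: field_simps)
      moreover have "(2 * \<gamma> * norm L + \<theta> * R t) / n \<le> R (Suc t) / n"
        using budget by (intro divide_right_mono) auto
      ultimately show ?thesis by (simp add: add_divide_distrib)
    qed
    finally have "norm (pad (g i x') - pad (transport d x x' (qm i))) \<le> up_y n \<gamma> R (Suc t)"
      by (simp add: up_y_def)
    from tangent_Q[where \<phi> = \<phi>, OF quant iso[OF x's] x'c g_tangent[OF x's, of i]
        tr(1)[OF conjunct1[OF qm[OF i]]] widths_pos(1,2)[of "Suc t"] this]
    show ?thesis unfolding qm'[OF i] by simp
  qed
  define r where "r = finsum_vec TYPE(real) d qm' {..<n}"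
  have r: "r \<in> tangent d x'" unfolding r_def by (rule finsum_tangent(1)[OF x's]) (use up in auto)
  have r': "norm (pad r - G x') \<le> \<theta> * R (Suc t) / 2"
    unfolding r_def G_def by (rule finsum_close[OF x's up])
  have Gsmooth: "norm (G x' - ptrans X L (G x)) \<le> 2 * \<gamma> * norm L"
  proof -
    have "ptrans X L (\<Sum>i<m. F i) = (\<Sum>i<m. ptrans X L (F i))" for F and m :: nat
    proof (induction m)
      case (Suc m)
      have "ptrans X L (u + w) = ptrans X L u + ptrans X L w" for u w
        by (simp add: ptrans_def inner_add_right add_divide_distrib algebra_simps)
      then show ?case using Suc by simp
    qed (simp add: ptrans_def)
    then have "G x' - ptrans X L (G x) = (\<Sum>i<n. pad (g i x') - ptrans X L (pad (g i x)))"
      unfolding G_def by (simp add: sum_subtractf)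
    then show ?thesis using sum_le_n[of "\<lambda>i. pad (g i x') - ptrans X L (pad (g i x))"] smooth by simp
  qed
  \<comment> \<open>Transport is an isometry and carries the old error over unchanged. The extra
    \<open>\<theta> / 2\<close> in \<open>down_y\<close> pays for the upstream error of the new sum
    \<open>r\<close>.\<close>
  have rt: "norm (pad r - pad (transport d x x' q)) \<le> down_y \<gamma> \<theta> R (Suc t)"
  proof -
    have "norm (ptrans X L (G x) - ptrans X L (pad q)) = norm (G x - pad q)"
      unfolding ptrans_diff[symmetric]
      by (rule norm_ptrans[OF X XL]) (use Xq inner_rayleigh_grad[OF X] in \<open>simp add: Gz inner_diff_right\<close>)
    also have "\<dots> \<le> \<theta> * R t" using q(2) by (simp add: norm_minus_commute)
    finally have 1: "norm (ptrans X L (G x) - ptrans X L (pad q)) \<le> \<theta> * R t" .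
    have "norm (pad r - pad (transport d x x' q)) \<le> norm (pad r - G x') + norm (G x' - ptrans X L (pad q))"
      unfolding tr(2)[OF q(1)] by (rule norm_diff_via)
    also have "norm (G x' - ptrans X L (pad q)) \<le> norm (G x' - ptrans X L (G x))
        + norm (ptrans X L (G x) - ptrans X L (pad q))" by (rule norm_diff_via)
    finally show ?thesis using r' Gsmooth 1 budget by (simp add: down_y_def algebra_simps)
  qed
  note dQ = tangent_Q[where \<phi> = \<phi>, OF quant iso[OF x's] x'c r tr(1)[OF q(1)] widths_pos(3,4)[of "Suc t"] rt]
  have q'1: "q' \<in> tangent d x'" unfolding q' r_def[symmetric] by (rule dQ(1))
  have q'2: "norm (pad q' - G x') \<le> \<theta> * R (Suc t)"
  proof -
    have "norm (pad q' - G x') \<le> norm (pad q' - pad r) + norm (pad r - G x')"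
      by (rule norm_diff_via)
    then show ?thesis using dQ(2) r' unfolding q' r_def[symmetric] down_w_def by simp
  qed
  have dist: "sdist x' v \<le> \<rho> ^ Suc t * D"
  proof -
    have "sdist x' v = arccos (inner (gexp X (- \<eta> *\<^sub>R pad q)) (pad v))"
      by (simp add: sdist_pad[OF x'c vc] X' L_def)
    also have "\<dots> \<le> sqrt (1 - a * (\<delta> / 2) * \<eta>) * rs.\<phi> + \<eta> * norm (pad q - rayleigh_grad X z)"
    proof (rule rs.contraction)
      have "\<eta> * norm (pad q) = norm L" using \<eta>0 by (simp add: L_def)
      then show "\<eta> * norm (pad q) + rs.\<phi> \<le> pi" using L_pi \<phi>le E D_bounds unfolding rs\<phi> by linarith
    qed (use a a_inner \<eta>0 Xq in auto)
    also have "\<dots> \<le> sqrt \<sigma> * E + \<eta> * (\<theta> * R t)"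
      unfolding \<sigma>_eq'[symmetric] rs\<phi> Gz[symmetric]
      using \<phi>le q(2) \<eta>0 less_imp_le[OF sqrt_\<sigma>_pos] by (intro add_mono mult_left_mono) auto
    also have "\<eta> * (\<theta> * R t) = a * (h / 2) * E"
      unfolding \<theta>R E_def[symmetric] \<eta>0(2)[symmetric] by (simp only: mult.assoc)
    \<comment> \<open>Replacing \<open>a\<close> by 1 is generous, but it meets the rate exactly:
      sqrt \<sigma> + h/2 = \<rho>.\<close>
    also have "a * (h / 2) * E \<le> 1 * (h / 2) * E"
      using a_le a h E by (intro mult_right_mono) auto
    also have "sqrt \<sigma> * E + 1 * (h / 2) * E = \<rho> * E" unfolding params(2) by (simp add: field_simps)
    finally show ?thesis by (simp add: E_def mult_ac)
  qed
  show ?thesis unfolding close_def using x's dist up q'1 q'2 by (auto simp: G_def)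
qed

section \<open>Runs of the algorithm\<close>

abbreviation run :: "real vec \<Rightarrow> (nat \<Rightarrow> real vec) \<Rightarrow> (nat \<Rightarrow> nat \<Rightarrow> real vec) \<Rightarrow> (nat \<Rightarrow> real vec) \<Rightarrow> bool"
  where "run x\<^sub>0 x qm q \<equiv> qrgd_run d n i\<^sub>0 (\<lambda>i. pca_obj (A i)) QT \<gamma> \<eta> \<theta> R x\<^sub>0 x qm q"

lemma run_close:
  assumes x0: "x\<^sub>0 \<in> usphere d" "sdist x\<^sub>0 v \<le> D" and run: "run x\<^sub>0 x qm q"
  shows "close t (x t) (qm t) (q t)"
proof (induction t)
  case 0
  have "close 0 (x 0) (qm 0) (QT (x 0) (finsum_vec TYPE(real) d (qm 0) {..<n}) (g i\<^sub>0 (x 0))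
      (down_y \<gamma> \<theta> R 0) (down_w \<theta> R 0))"
    by (rule close_init(1)[OF _ _ _ i0]) (use x0 run in \<open>auto simp: qrgd_run_def Let_def\<close>)
  moreover have "q 0 = QT (x 0) (finsum_vec TYPE(real) d (qm 0) {..<n}) (g i\<^sub>0 (x 0))
      (down_y \<gamma> \<theta> R 0) (down_w \<theta> R 0)"
    using run i0 unfolding qrgd_run_def Let_def by blast
  ultimately show ?case by simp
next
  case (Suc t)
  show ?case
    by (rule close_step[OF Suc.IH]) (use run in \<open>auto simp: qrgd_run_def Let_def\<close>)
qed

text \<open>Existence is not automatic: \<open>qrgd_run\<close> demands that every machine decodes
  the same \<open>q 0\<close>, which rests on the second part of \<open>close_init\<close>. It keeps
  statements about all runs from being vacuous.\<close>

lemma run_exists: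
  assumes x0: "x\<^sub>0 \<in> usphere d" "sdist x\<^sub>0 v \<le> D"
  shows "\<exists>x qm q. run x\<^sub>0 x qm q"
proof -
  define qm0 where "qm0 = (\<lambda>i. QT x\<^sub>0 (g i x\<^sub>0) (g i\<^sub>0 x\<^sub>0) (up_y n \<gamma> R 0) (up_w n \<theta> R 0))"
  define q0 where "q0 = QT x\<^sub>0 (finsum_vec TYPE(real) d qm0 {..<n}) (g i\<^sub>0 x\<^sub>0) (down_y \<gamma> \<theta> R 0) (down_w \<theta> R 0)"
  define next_x where "next_x = (\<lambda>(x, qm :: nat \<Rightarrow> real vec, q). sexp x ((- \<eta>) \<cdot>\<^sub>v q))"
  define next_qm where "next_qm = (\<lambda>t s i. case s of (x, qm, q) \<Rightarrow>
    QT (next_x s) (g i (next_x s)) (transport d x (next_x s) (qm i))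
      (up_y n \<gamma> R (Suc t)) (up_w n \<theta> R (Suc t)))"
  define next_q where "next_q = (\<lambda>t s. case s of (x, qm, q) \<Rightarrow>
    QT (next_x s) (finsum_vec TYPE(real) d (next_qm t s) {..<n}) (transport d x (next_x s) q)
      (down_y \<gamma> \<theta> R (Suc t)) (down_w \<theta> R (Suc t)))"
  define st where "st = rec_nat (x\<^sub>0, qm0, q0) (\<lambda>t s. (next_x s, next_qm t s, next_q t s))"
  have st0: "st 0 = (x\<^sub>0, qm0, q0)"
    and stS: "\<And>t. st (Suc t) = (next_x (st t), next_qm t (st t), next_q t (st t))"
    by (simp_all add: st_def)
  have q0_eq: "q0 = QT x\<^sub>0 (finsum_vec TYPE(real) d qm0 {..<n}) (g i x\<^sub>0) (down_y \<gamma> \<theta> R 0) (down_w \<theta> R 0)"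
    if "i < n" for i
    unfolding q0_def by (rule close_init(2)[OF x0 _ i0 that]) (simp add: qm0_def)
  have "run x\<^sub>0 (\<lambda>t. fst (st t)) (\<lambda>t. fst (snd (st t))) (\<lambda>t. snd (snd (st t)))"
    unfolding qrgd_run_def Let_def
    using q0_eq
    by (auto simp: st0 stS qm0_def next_x_def next_qm_def next_q_def split: prod.splits)
  then show ?thesis by blast
qed

end

section \<open>Communication complexity\<close>

context qrgd
begin

lemma quantizer_bits:
  assumes "0 < y" "0 < w" "2 \<le> y / w" "y / w \<le> B" "0 < C\<^sub>Q"
  shows "real (b y w) \<le> C\<^sub>Q * d * log 2 B"
proof -
  have "real (b y w) \<le> C\<^sub>Q * d * log 2 (y / w)" using quant assms unfolding quantizer_def by blast
  also have "\<dots> \<le> C\<^sub>Q * d * log 2 B" using assms by (intro mult_left_mono log_mono) auto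
  finally show ?thesis .
qed

lemma hD: "h * D \<le> 1"
proof -
  have "h * D \<le> 3 / 10 * 2" using h D_bounds pi_less_4 by (intro mult_mono) auto
  then show ?thesis by simp
qed

lemma one_le_inverse_h: "1 \<le> 1 / h"
proof -
  have "u \<le> 3 / 10 \<Longrightarrow> 1 * u \<le> 1" for u :: real by simp
  then show ?thesis unfolding pos_le_divide_eq[OF h(1)] using h(2) by blast
qed

text \<open>These quotients make up y / w in round 0 and in later rounds. The constant 34 comes from
  D > 3/4 and 8 pi < 34 * 3/4, the constant 12 from \<theta> being at least 7/40 h, hence at least
  h/6.\<close>

lemma ratio_base: "8 * pi \<le> 8 * pi / (h * D)" "8 * pi / (h * D) \<le> 34 / h"
    "2 \<le> 2 / \<theta>" "2 / \<theta> \<le> 12 / h"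
proof -
  have pos: "0 < h * D" using h D_bounds by simp
  show "8 * pi \<le> 8 * pi / (h * D)" using pos hD by (simp add: le_divide_eq)
  have "8 * pi \<le> 34 * (3 / 4)" using pi_approx by simp
  also have "\<dots> \<le> 34 * D" using D_bounds pi_approx by simp
  finally have "8 * pi / (h * D) \<le> 34 * D / (h * D)" using pos by (intro divide_right_mono) auto
  then show "8 * pi / (h * D) \<le> 34 / h" using D_bounds by simp
  have "sqrt \<sigma> * h \<le> 1 * (3 / 10)" using sqrt_\<sigma> sqrt_\<sigma>_pos h by (intro mult_mono) auto
  then have "\<theta> \<le> 1" unfolding params(5) by simp
  then show "2 \<le> 2 / \<theta>" using \<theta>_pos by (simp add: le_divide_eq)
  have aux: "7 / 10 * u \<le> w \<Longrightarrow> 0 < u \<Longrightarrow> u / 6 \<le> w / 4" for u w :: real by simp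
  have "7 / 10 * h \<le> sqrt \<sigma> * h" using sqrt_\<sigma> h by (intro mult_right_mono) auto
  then have "h / 6 \<le> \<theta>" unfolding params(5) using aux[OF _ h(1)] by blast
  then show "2 / \<theta> \<le> 12 / h" using h(1) \<theta>_pos by (simp add: field_simps)
qed

text \<open>The lower bound 2 is the threshold above which \<open>quantizer\<close> limits the
  message length. The factor n stems from the upstream messages of round 0, whose width is divided
  by n while their radius is not; 35 is 34 plus the 1 in the downstream ratio.\<close>

lemma ratios:
  shows "2 \<le> up_y n \<gamma> R t / up_w n \<theta> R t" "up_y n \<gamma> R t / up_w n \<theta> R t \<le> 35 * real n / h"
    and "2 \<le> down_y \<gamma> \<theta> R t / down_w \<theta> R t" "down_y \<gamma> \<theta> R t / down_w \<theta> R t \<le> 35 * real n / h"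
proof -
  have n1: "1 \<le> real n" using n by simp
  have hn: "35 / h \<le> 35 * real n / h" by (rule divide_right_mono) (use n1 \<sigma>_bounds in auto)
  note h1 = one_le_inverse_h
  have Rt: "0 < R t" by (rule R_pos)
  have R0: "\<theta> * R 0 = \<gamma> * (h * D) / 2" using \<theta>R[of 0] by simp
  have up: "up_y n \<gamma> R t / up_w n \<theta> R t = (if t = 0 then n * (8 * pi / (h * D)) else 2 / \<theta>)"
  proof (cases "t = 0")
    case True
    have "up_y n \<gamma> R 0 / up_w n \<theta> R 0 = 2 * \<gamma> * pi / (\<gamma> * (h * D) / 2 / (2 * n))"
      by (simp add: up_y_def up_w_def R0)
    also have "\<dots> = n * (8 * pi / (h * D))" using \<gamma> by simp
    finally show ?thesis using True by simp
  next
    case False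
    then show ?thesis using Rt n by (simp add: up_y_def up_w_def)
  qed
  have down: "down_y \<gamma> \<theta> R t / down_w \<theta> R t = 1 + (if t = 0 then 8 * pi / (h * D) else 2 / \<theta>)"
  proof (cases "t = 0")
    case True
    have "down_y \<gamma> \<theta> R 0 / down_w \<theta> R 0 = 1 + 2 * \<gamma> * pi / (\<theta> * R 0 / 2)"
      using \<theta>_pos R_pos[of 0] by (simp add: down_y_def down_w_def add_divide_distrib)
    also have "2 * \<gamma> * pi / (\<theta> * R 0 / 2) = 8 * pi / (h * D)" unfolding R0 using \<gamma> by simp
    finally show ?thesis using True by simp
  next
    case False
    then show ?thesis using Rt \<theta>_pos by (simp add: down_y_def down_w_def field_simps)
  qed
  have "2 \<le> 8 * pi / (h * D)" using ratio_base(1) pi_ge_two by linarith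
  moreover have "8 * pi / (h * D) \<le> n * (8 * pi / (h * D))"
    using mult_right_mono[OF n1, of "8 * pi / (h * D)"] calculation by simp
  ultimately show "2 \<le> up_y n \<gamma> R t / up_w n \<theta> R t" "2 \<le> down_y \<gamma> \<theta> R t / down_w \<theta> R t"
    unfolding up down using ratio_base(3) by auto
  have "n * (8 * pi / (h * D)) \<le> n * (34 / h)" using ratio_base(2) by (intro mult_left_mono) auto
  also have "\<dots> \<le> 35 * real n / h" using h by (simp add: divide_right_mono)
  finally show "up_y n \<gamma> R t / up_w n \<theta> R t \<le> 35 * real n / h"
    unfolding up using ratio_base(4) hn h1 by auto
  show "down_y \<gamma> \<theta> R t / down_w \<theta> R t \<le> 35 * real n / h"
    unfolding down using ratio_base(2,4) hn h1 by auto
qed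

lemma total_bits:
  assumes "0 < C\<^sub>Q"
  shows "real (qrgd_bits n b \<gamma> \<theta> R T) \<le> real T * (2 * real n * (C\<^sub>Q * real d * log 2 (35 * real n / h)))"
proof -
  let ?L = "C\<^sub>Q * real d * log 2 (35 * real n / h)"
  have "real (qrgd_bits n b \<gamma> \<theta> R T) =
      (\<Sum>t<T. n * real (b (up_y n \<gamma> R t) (up_w n \<theta> R t)) + n * real (b (down_y \<gamma> \<theta> R t) (down_w \<theta> R t)))"
    by (simp add: qrgd_bits_def)
  also have "\<dots> \<le> (\<Sum>t<T. n * ?L + n * ?L)"
    by (intro sum_mono add_mono mult_left_mono quantizer_bits widths_pos ratios assms) auto
  also have "\<dots> = real T * (2 * real n * ?L)" by simp
  finally show ?thesis .
qed

text \<open>Since 1 - h/2 is at most exp (- h/2), about (2/h) ln (D / \<epsilon>) rounds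
  suffice.\<close>

lemma rounds:
  assumes "0 < \<epsilon>" "0 < \<kappa>" "\<kappa> \<le> ln (D / \<epsilon>)"
  obtains T where "\<rho> ^ T * D \<le> \<epsilon>" "real T \<le> (2 + 1 / \<kappa>) / h * ln (D / \<epsilon>)"
proof
  define L where "L = ln (D / \<epsilon>)"
  define T where "T = nat \<lceil>2 / h * L\<rceil>"
  have L: "0 < L" "1 \<le> L / \<kappa>" using assms by (auto simp: L_def le_divide_eq)
  have nn: "0 \<le> 2 / h * L" using L \<sigma>_bounds by simp
  have T1: "2 / h * L \<le> T" unfolding T_def using nn by linarith
  have T2: "real T \<le> 2 / h * L + 1" unfolding T_def using nn by linarith
  \<comment> \<open>The round added by the ceiling is absorbed into the logarithm; this is where
    \<kappa> enters the constant.\<close>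
  have T3: "1 \<le> L / \<kappa> / h"
  proof -
    have "L / \<kappa> * 1 \<le> L / \<kappa> * (1 / h)"
      by (rule mult_left_mono[OF one_le_inverse_h]) (use L in linarith)
    then show ?thesis using L(2) by simp
  qed
  have "2 / u * L + L / \<kappa> / u = (2 + 1 / \<kappa>) / u * L" for u :: real
    by (simp add: add_divide_distrib distrib_right)
  from this[of h] show "real T \<le> (2 + 1 / \<kappa>) / h * ln (D / \<epsilon>)"
    using T2 T3 unfolding L_def by linarith
  have "\<rho> \<le> exp (- (h / 2))" unfolding params(2) using exp_ge_add_one_self[of "- (h / 2)"] by simp
  then have "\<rho> ^ T \<le> exp (- (h / 2)) ^ T" using \<rho> by (intro power_mono) auto
  also have "\<dots> = exp (- (h / 2 * T))" by (simp add: exp_of_nat_mult[symmetric] mult.commute)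
  also have "\<dots> \<le> exp (- L)"
  proof -
    have "h / 2 * (2 / h * L) \<le> h / 2 * T" using T1 h by (intro mult_left_mono) auto
    then show ?thesis using h by simp
  qed
  also have "\<dots> = \<epsilon> / D" unfolding L_def using assms D_bounds by (simp add: exp_minus)
  finally show "\<rho> ^ T * D \<le> \<epsilon>" using D_bounds by (simp add: field_simps)
qed

end

text \<open>The factors come from the number of rounds, from 1/h being at most 4/c^2 times d
  \<gamma> / (p^2 \<delta>), from two messages per machine and round, and from comparing the
  logarithm of 35 n / h with that of n d \<gamma> / (p \<delta>).\<close>

definition bits_const :: "real \<Rightarrow> real \<Rightarrow> real \<Rightarrow> real" where
  "bits_const c C\<^sub>Q \<kappa> = (2 + 1 / \<kappa>) * (4 / c\<^sup>2) * (2 * C\<^sub>Q * ((ln (140 / c\<^sup>2) + 2) / ln 2))"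

lemma ln_140_nonneg:
  assumes "0 < c" "c \<le> (1::real)"
  shows "0 \<le> ln (140 / c\<^sup>2)"
proof -
  have "c\<^sup>2 \<le> 1" using assms by (simp add: power_le_one)
  then show ?thesis using assms by (intro ln_ge_zero) (simp add: le_divide_eq)
qed

lemma bits_const_pos:
  assumes "0 < c" "c \<le> 1" "0 < C\<^sub>Q" "0 < \<kappa>"
  shows "0 < bits_const c C\<^sub>Q \<kappa>"
  unfolding bits_const_def using assms ln_140_nonneg[of c]
  by (intro mult_pos_pos divide_pos_pos add_pos_pos add_nonneg_pos) auto

lemma total_bits_bound:
  fixes n d :: nat and c C\<^sub>Q \<kappa> \<delta> \<gamma> p h E T :: real
  assumes c: "0 < c" "c \<le> 1" and C: "0 < C\<^sub>Q" and \<kappa>: "0 < \<kappa>"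
    and nd: "1 \<le> n" "2 \<le> d" and \<gamma>: "0 < \<delta>" "2 * \<delta> \<le> \<gamma>" and p: "0 < p" "p < 1"
    and h: "0 < h" "(c * p / sqrt (real d))\<^sup>2 * \<delta> / (4 * \<gamma>) \<le> h"
    and E: "0 \<le> E" and T: "0 \<le> T" "T \<le> (2 + 1 / \<kappa>) / h * E"
  shows "T * (2 * real n * (C\<^sub>Q * real d * log 2 (35 * real n / h))) \<le>
    bits_const c C\<^sub>Q \<kappa> * (n * ((real d)\<^sup>2 / p\<^sup>2) * (\<gamma> / \<delta>) * ln (real n * real d * \<gamma> / (p * \<delta>)) * E)"
proof -
  define X where "X = real n * real d * \<gamma> / (p * \<delta>)"
  define Y where "Y = d * \<gamma> / (p\<^sup>2 * \<delta>)"
  have \<gamma>0: "0 < \<gamma>" using \<gamma> by simp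
  have n1: "1 \<le> real n" and d2: "2 \<le> real d" using nd by auto
  have nd2: "2 \<le> real n * real d" using mult_mono[OF n1 d2] by simp
  have Y: "0 < Y" using \<gamma>0 \<gamma> p d2 by (simp add: Y_def)
  have "4 * \<delta> \<le> (real n * real d) * \<gamma>" using mult_mono[OF nd2 \<gamma>(2)] \<gamma> by simp
  moreover have "4 * (p * \<delta>) \<le> 4 * \<delta>" using p \<gamma> by simp
  ultimately have "4 * (p * \<delta>) \<le> real n * real d * \<gamma>" by linarith
  \<comment> \<open>From d at least 2 and \<gamma> at least 2 \<delta>. As 4 exceeds e,
    \<open>ln X\<close> is at least 1 and can absorb the additive constant ln (140 / c^2).\<close>
  then have X: "4 \<le> X" using p \<gamma> unfolding X_def by (subst pos_le_divide_eq) auto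
  have "ln 4 \<le> ln X" using X by simp
  moreover have "1 \<le> ln (4::real)" using exp_le ln_ge_iff[of 4 1] by simp
  ultimately have lnX: "1 \<le> ln X" by linarith
  have hY: "1 / h \<le> 4 / c\<^sup>2 * Y"
  proof -
    have eq: "4 / c\<^sup>2 * Y = 1 / ((c * p / sqrt d)\<^sup>2 * \<delta> / (4 * \<gamma>))"
      using c p d2 \<gamma> \<gamma>0 by (simp add: Y_def power_divide power_mult_distrib mult_ac)
    have "0 < (c * p / sqrt d)\<^sup>2 * \<delta> / (4 * \<gamma>)" using c p d2 \<gamma> \<gamma>0 by simp
    then show ?thesis unfolding eq using h by (intro frac_le) auto
  qed
  \<comment> \<open>\<open>X\<^sup>2\<close> is \<open>n * Y\<close> times n d \<gamma> / \<delta>,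
    a factor of at least 1; so n / h is polynomial in \<open>X\<close>.\<close>
  have nY: "n * Y \<le> X\<^sup>2"
  proof -
    have "\<delta> * 1 \<le> \<gamma> * (real n * real d)" using \<gamma> nd2 by (intro mult_mono) auto
    then have "1 \<le> real n * real d * \<gamma> / \<delta>" using \<gamma> by (simp add: field_simps)
    then have "n * Y * 1 \<le> n * Y * (real n * real d * \<gamma> / \<delta>)" using Y by (intro mult_left_mono) auto
    also have "\<dots> = X\<^sup>2" by (simp add: X_def Y_def power2_eq_square mult_ac)
    finally show ?thesis by simp
  qed
  have "35 * real n / h \<le> 140 / c\<^sup>2 * X\<^sup>2"
  proof -
    have "35 * real n * (1 / h) \<le> 35 * real n * (4 / c\<^sup>2 * Y)" using hY by (intro mult_left_mono) auto
    also have "\<dots> = 140 / c\<^sup>2 * (n * Y)" by simp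
    also have "\<dots> \<le> 140 / c\<^sup>2 * X\<^sup>2" using nY by (intro mult_left_mono) auto
    finally show ?thesis by simp
  qed
  then have "ln (35 * real n / h) \<le> ln (140 / c\<^sup>2 * X\<^sup>2)" using n1 h X c by (subst ln_le_cancel_iff) auto
  also have "\<dots> = ln (140 / c\<^sup>2) + 2 * ln X"
    using X c by (subst ln_mult) (auto simp: ln_realpow)
  also have "\<dots> \<le> ln (140 / c\<^sup>2) * ln X + 2 * ln X"
    using mult_left_mono[OF lnX ln_140_nonneg[OF c]] by simp
  also have "\<dots> = (ln (140 / c\<^sup>2) + 2) * ln X" by (simp add: algebra_simps)
  finally have log: "log 2 (35 * real n / h) \<le> (ln (140 / c\<^sup>2) + 2) / ln 2 * ln X"
    by (simp add: log_def divide_right_mono)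
  have T': "T \<le> (2 + 1 / \<kappa>) * (4 / c\<^sup>2 * Y) * E"
  proof -
    have "(2 + 1 / \<kappa>) * (1 / h) * E \<le> (2 + 1 / \<kappa>) * (4 / c\<^sup>2 * Y) * E"
      using hY \<kappa> E by (intro mult_right_mono mult_left_mono) auto
    then show ?thesis using T by simp
  qed
  define M where "M = 2 * real n * (C\<^sub>Q * d * ((ln (140 / c\<^sup>2) + 2) / ln 2 * ln X))"
  have M: "0 \<le> M" unfolding M_def using ln_140_nonneg[OF c] lnX C by simp
  have le: "2 * real n * (C\<^sub>Q * d * log 2 (35 * real n / h)) \<le> M"
    unfolding M_def using log C by (intro mult_left_mono) auto
  have rearrange: "k * (4 / c\<^sup>2 * (real d * \<gamma> / (p\<^sup>2 * \<delta>))) * E * (2 * real n * (C\<^sub>Q * real d * (u * w))) =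
      k * (4 / c\<^sup>2) * (2 * C\<^sub>Q * u) * (real n * ((real d)\<^sup>2 / p\<^sup>2) * (\<gamma> / \<delta>) * w * E)"
    for k u w :: real by (simp add: power2_eq_square mult_ac)
  have "T * (2 * real n * (C\<^sub>Q * d * log 2 (35 * real n / h))) \<le> (2 + 1 / \<kappa>) * (4 / c\<^sup>2 * Y) * E * M"
    using mult_left_mono[OF le T(1)] mult_right_mono[OF T' M] by linarith
  also have "\<dots> = bits_const c C\<^sub>Q \<kappa> * (n * ((real d)\<^sup>2 / p\<^sup>2) * (\<gamma> / \<delta>) * ln X * E)"
    unfolding M_def bits_const_def Y_def by (rule rearrange)
  finally show ?thesis unfolding X_def .
qed

section \<open>The principal component problem\<close>

text \<open>In dimension 1 an overlap never exceeds 1. If c > 1, the midpoint p of 1/c and 1 has c p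
  > 1, so an empty event would need the positive probability 1 - p.\<close>

lemma universal_overlap_le_1:
  assumes "universal_overlap c"
  shows "c \<le> 1"
proof (rule ccontr)
  assume "\<not> c \<le> 1"
  then have c: "1 < c" by simp
  define p where "p = (1 / c + 1) / 2"
  have p: "0 < p" "p < 1" and cp: "1 < c * p" using c by (auto simp: p_def field_simps)
  define v where "v = (unit_vec 1 0 :: real vec)"
  have "norm (pad v) = 1" unfolding norm_eq_1 v_def by (subst inner_pad[of _ 1]) auto
  then have v: "v \<in> usphere 1" by (simp add: usphere_iff v_def)
  let ?S = "{x \<in> usphere 1. c * p / sqrt (real 1) \<le> \<bar>x \<bullet> v\<bar>}"
  have "1 - p \<le> measure (uniform_sphere 1) ?S"
    using assms v p unfolding universal_overlap_def by blast
  then have "?S \<noteq> {}" using p by (metis measure_empty diff_gt_0_iff_gt not_less)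
  then obtain x where x: "x \<in> usphere 1" "c * p \<le> \<bar>x \<bullet> v\<bar>" by auto
  have "\<bar>x \<bullet> v\<bar> \<le> norm (pad x) * norm (pad v)"
    using Cauchy_Schwarz_ineq2[of "pad x" "pad v"] x v by (simp add: usphere_iff inner_pad[of _ 1])
  then show False using x v cp by (simp add: usphere_iff)
qed

lemma psd_norm_le_lambda_max:
  assumes A: "A \<in> carrier_mat d d" "transpose_mat A = A" and d: "0 < d"
    and psd: "\<And>x. x \<in> carrier_vec d \<Longrightarrow> 0 \<le> qform A x" and x: "x \<in> carrier_vec d"
  shows "0 \<le> lambda_max A" "norm (pad (A *\<^sub>v x)) \<le> lambda_max A * norm (pad x)"
proof -
  have u: "norm (pad (unit_vec d 0)) = 1"
    using d unfolding norm_eq_1 by (subst inner_pad[of _ d]) auto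
  show 0: "0 \<le> lambda_max A"
    using psd[of "unit_vec d 0"] qform_le_lambda_max[OF A d, of "unit_vec d 0"] u by simp
  have "(norm (pad (A *\<^sub>v x)))\<^sup>2 \<le> lambda_max A * qform A x"
    by (rule psd_apply_le[OF A psd qform_le_lambda_max[OF A d] x 0])
  also have "\<dots> \<le> lambda_max A * (lambda_max A * (norm (pad x))\<^sup>2)"
    by (rule mult_left_mono[OF qform_le_lambda_max[OF A d x] 0])
  also have "\<dots> = (lambda_max A * norm (pad x))\<^sup>2" by (simp add: power2_eq_square)
  finally show "norm (pad (A *\<^sub>v x)) \<le> lambda_max A * norm (pad x)"
    by (rule power2_le_imp_le) (use 0 in simp)
qed

text \<open>Split y = t v + w with w orthogonal to v. Symmetry removes the cross terms, so the form
  at y is l t^2 plus the form at w, which lies between 0 and l2 |w|^2; the spectral assumptions of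
  the locale follow.\<close>

lemma rayleigh_step_of_gap:
  assumes A: "A \<in> carrier_mat d d" "transpose_mat A = A"
    and psd: "\<And>x. x \<in> carrier_vec d \<Longrightarrow> 0 \<le> qform A x"
    and v: "v \<in> usphere d" "A *\<^sub>v v = l \<cdot>\<^sub>v v"
    and second: "\<And>x. x \<in> carrier_vec d \<Longrightarrow> inner (pad v) (pad x) = 0 \<Longrightarrow>
      qform A x \<le> l2 * (norm (pad x))\<^sup>2"
    and l: "0 \<le> l2" "l2 < l" "2 * l \<le> \<gamma>"
    and x: "x \<in> usphere d" "0 \<le> inner (pad x) (pad v)"
  shows "rayleigh_step (pad x) (pad v) (pad (A *\<^sub>v x)) l (l - l2) \<gamma>"
proof -
  have vc: "v \<in> carrier_vec d" "norm (pad v) = 1" using v by (auto simp: usphere_iff)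
  have xc: "x \<in> carrier_vec d" "norm (pad x) = 1" using x by (auto simp: usphere_iff)
  have split: "0 \<le> qform A y - l * (inner (pad y) (pad v))\<^sup>2 \<and>
      qform A y - l * (inner (pad y) (pad v))\<^sup>2 \<le> l2 * ((norm (pad y))\<^sup>2 - (inner (pad y) (pad v))\<^sup>2)"
    if y: "y \<in> carrier_vec d" for y
  proof -
    define t where "t = inner (pad y) (pad v)"
    define w where "w = y - t \<cdot>\<^sub>v v"
    have w: "w \<in> carrier_vec d" "pad w = pad y - t *\<^sub>R pad v"
      using y vc by (auto simp: w_def pad_diff[of _ d])
    have wv: "inner (pad v) (pad w) = 0"
      using vc by (simp add: w inner_diff_right t_def norm_eq_1 inner_commute)
    have Aw: "pad (A *\<^sub>v w) = pad (A *\<^sub>v y) - (t * l) *\<^sub>R pad v"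
      using A y vc v(2) unfolding w_def
      by (simp add: mult_minus_distrib_mat_vec[of _ d d] mult_mat_vec[of _ d d] pad_diff[of _ d])
    have vAy: "inner (pad v) (pad (A *\<^sub>v y)) = l * t"
      using symmetric_inner[OF A y vc(1)] v(2) by (simp add: t_def inner_commute)
    have "qform A w = qform A y - l * t\<^sup>2"
      unfolding qform_def w(2) Aw using vc vAy
      by (simp add: inner_diff_left inner_diff_right t_def[symmetric] norm_eq_1 power2_eq_square algebra_simps)
    moreover have "(norm (pad w))\<^sup>2 = (norm (pad y))\<^sup>2 - t\<^sup>2"
      unfolding power2_norm_eq_inner w(2) using vc
      by (simp add: inner_diff_left inner_diff_right inner_commute[of "pad v" "pad y"] t_def[symmetric]
          norm_eq_1 power2_eq_square algebra_simps)
    ultimately show ?thesis using psd[OF w(1)] second[OF w(1) wv] by (simp add: t_def)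
  qed
  have top: "qform A y \<le> l * (norm (pad y))\<^sup>2" if y: "y \<in> carrier_vec d" for y
  proof -
    have "(inner (pad y) (pad v))\<^sup>2 \<le> (norm (pad y))\<^sup>2"
      using Cauchy_Schwarz_ineq[of "pad y" "pad v"] vc by (simp add: power2_norm_eq_inner norm_eq_1)
    then have "l2 * ((norm (pad y))\<^sup>2 - (inner (pad y) (pad v))\<^sup>2)
        \<le> l * ((norm (pad y))\<^sup>2 - (inner (pad y) (pad v))\<^sup>2)"
      using l by (intro mult_right_mono) auto
    then show ?thesis using split[OF y] by (simp add: algebra_simps)
  qed
  show ?thesis
  proof
    show "norm (pad x) = 1" "norm (pad v) = 1" "0 \<le> inner (pad x) (pad v)" "2 * l \<le> \<gamma>"
      using xc vc x l by auto
    show "0 \<le> l" "0 < l - l2" using l by auto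
    show "inner (pad (A *\<^sub>v x)) (pad v) = l * inner (pad x) (pad v)"
      using symmetric_inner[OF A vc(1) xc(1)] v(2) by simp
    show "(l - l2) * (1 - (inner (pad x) (pad v))\<^sup>2) \<le> l - inner (pad x) (pad (A *\<^sub>v x))"
      using split[OF xc(1)] xc(2) by (simp add: qform_def algebra_simps)
    show "l * (inner (pad x) (pad v))\<^sup>2 \<le> inner (pad x) (pad (A *\<^sub>v x))"
      using split[OF xc(1)] by (simp add: qform_def)
    show "inner (pad (A *\<^sub>v x)) (pad (A *\<^sub>v x)) \<le> l * inner (pad x) (pad (A *\<^sub>v x))"
      using psd_apply_le[OF A psd top xc(1)] l by (simp add: qform_def power2_norm_eq_inner)
  qed
qed

text \<open>The length of \<open>ls\<close> is \<open>d\<close>, so \<open>2 \<le> d\<close> ensures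
  that \<open>ls ! 1\<close> is a genuine entry; being an eigenvalue of a positive semidefinite
  matrix, it is nonnegative.\<close>

lemma eigenvalue_list_gap:
  assumes A: "A \<in> carrier_mat d d" and d: "2 \<le> d"
    and psd: "\<And>x. x \<in> carrier_vec d \<Longrightarrow> 0 \<le> qform A x"
    and ls: "eigenvalue_list A ls" and gap: "ls ! 1 < ls ! 0"
  obtains es where "char_poly A = [:- (ls ! 0), 1:] * (\<Prod>e\<leftarrow>es. [:- e, 1:])" "ls ! 0 \<notin> set es"
    "\<And>e. e \<in> set es \<Longrightarrow> e \<le> ls ! 1" "0 \<le> ls ! 1"
proof -
  have cp: "char_poly A = (\<Prod>e\<leftarrow>ls. [:- e, 1:])" and srt: "sorted_wrt (\<ge>) ls"
    using ls by (auto simp: eigenvalue_list_def)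
  have "length ls = d" using degree_monic_char_poly[OF A] degree_linear_factors[of uminus ls] cp by simp
  then obtain l1 l2 rest where lsq: "ls = l1 # l2 # rest"
    using d by (metis One_nat_def Suc_1 Suc_le_length_iff)
  have le: "e \<le> l2" if "e \<in> set (l2 # rest)" for e using srt that by (auto simp: lsq)
  have "poly (char_poly A) l2 = 0" unfolding cp lsq by simp
  then obtain w where w: "w \<in> carrier_vec d" "w \<noteq> 0\<^sub>v d" "A *\<^sub>v w = l2 \<cdot>\<^sub>v w"
    using eigenvalue_root_char_poly[OF A] A unfolding eigenvalue_def eigenvector_def by auto
  have "0 \<le> l2 * (norm (pad w))\<^sup>2"
    using psd[OF w(1)] w(3) by (simp add: qform_def power2_norm_eq_inner)
  moreover have "pad w \<noteq> 0" using w pad_inject[OF w(1), of "0\<^sub>v d"] by simp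
  ultimately have "0 \<le> l2" by (simp add: zero_le_mult_iff)
  moreover have "char_poly A = [:- (ls ! 0), 1:] * (\<Prod>e\<leftarrow>l2 # rest. [:- e, 1:])"
    unfolding cp lsq by (simp only: list.map prod_list.Cons nth_Cons_0)
  moreover have "ls ! 0 \<notin> set (l2 # rest)" using le[of "ls ! 0"] gap by (auto simp: lsq)
  ultimately show thesis using that[of "l2 # rest"] le by (simp add: lsq)
qed

lemma dpca_qrgd:
  assumes nd: "1 \<le> n" "2 \<le> d" "i\<^sub>0 < n"
    and M: "M \<in> carrier_mat m d" and P: "row_partition n m P"
    and A: "A = (\<lambda>i. gram (local_data M P i))"
    and ls: "eigenvalue_list (gram M) ls" and \<delta>: "\<delta> = ls ! 0 - ls ! 1" "0 < \<delta>"
    and v: "v \<in> usphere d" "gram M *\<^sub>v v = (ls ! 0) \<cdot>\<^sub>v v"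
    and \<gamma>: "\<gamma> = total_smoothness n A"
    and quant: "quantizer d C\<^sub>Q Q enc dec b" and iso: "\<And>x. x \<in> usphere d \<Longrightarrow> tangent_isometry d x (\<phi> x)"
    and a: "0 < a" "a\<^sup>2 \<le> 1 / 2"
    and par: "\<eta> = a / \<gamma>" "D = arccos a" "\<sigma> = par_sigma D (\<delta> / 2) \<eta>" "\<theta> = par_theta \<sigma>" "R = par_R \<gamma> D \<sigma>"
  shows "qrgd n d i\<^sub>0 A Q enc dec b \<phi> C\<^sub>Q v (ls ! 0) \<delta> \<gamma> a \<eta> D \<sigma> \<theta> R"
proof -
  have Ac: "A i \<in> carrier_mat d d" for i
    unfolding A by (rule gram_carrier, rule carrier_matI[OF refl]) (use M in \<open>simp add: dim_col_local_data\<close>)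
  have At: "transpose_mat (A i) = A i" for i unfolding A by (rule gram_symmetric)
  have Apsd: "0 \<le> qform (A i) x" if "x \<in> carrier_vec d" for i x
    unfolding A by (rule gram_psd[OF _ that], rule carrier_matI[OF refl]) (use M in \<open>simp add: dim_col_local_data\<close>)
  have d: "0 < d" using nd by simp
  have \<lambda>: "lambda_max (A i) \<le> \<gamma> / (2 * real n)" if "i < n" for i
  proof -
    have "2 * lambda_max (A i) \<le> Max ((\<lambda>i. 2 * lambda_max (A i)) ` {..<n})"
      by (rule Max_ge) (use that in auto)
    then have "n * (2 * lambda_max (A i)) \<le> \<gamma>"
      unfolding \<gamma> total_smoothness_def by (intro mult_left_mono) auto
    then show ?thesis using nd by (simp add: field_simps)
  qed
  have bound: "norm (pad (A i *\<^sub>v x)) \<le> \<gamma> / (2 * real n) * norm (pad x)" if "i < n" "x \<in> carrier_vec d" for i x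
  proof -
    have "norm (pad (A i *\<^sub>v x)) \<le> lambda_max (A i) * norm (pad x)"
      by (rule psd_norm_le_lambda_max(2)[OF Ac At d]) (use Apsd that in auto)
    then show ?thesis
      using mult_right_mono[OF \<lambda>[OF that(1)] norm_ge_zero[of "pad x"]] by linarith
  qed
  have G: "gram M \<in> carrier_mat d d" using gram_carrier[OF M] .
  have Gpsd: "\<And>x. x \<in> carrier_vec d \<Longrightarrow> 0 \<le> qform (gram M) x" using gram_psd[OF M] .
  have gap: "ls ! 1 < ls ! 0" using \<delta> by simp
  obtain es where es: "char_poly (gram M) = [:- (ls ! 0), 1:] * (\<Prod>e\<leftarrow>es. [:- e, 1:])" "ls ! 0 \<notin> set es"
    "\<And>e. e \<in> set es \<Longrightarrow> e \<le> ls ! 1" "0 \<le> ls ! 1"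
    using eigenvalue_list_gap[OF G nd(2) Gpsd ls gap] by metis
  have vc: "v \<in> carrier_vec d" "norm (pad v) = 1" using v by (auto simp: usphere_iff)
  \<comment> \<open>The top eigenvalue is the sum of the local quadratic forms at \<open>v\<close>,
    each at most \<gamma> / (2 n).\<close>
  have l\<gamma>: "2 * (ls ! 0) \<le> \<gamma>"
  proof -
    have "ls ! 0 = inner (pad v) (pad (gram M *\<^sub>v v))" using v vc by (simp add: norm_eq_1)
    also have "\<dots> = (\<Sum>i<n. inner (pad v) (pad (A i *\<^sub>v v)))"
      unfolding gram_local_data_sum[OF M P vc(1)] A by (rule inner_sum_right)
    also have "\<dots> \<le> (\<Sum>i<n. \<gamma> / (2 * real n))"
    proof (rule sum_mono)
      fix i assume "i \<in> {..<n}"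
      then show "inner (pad v) (pad (A i *\<^sub>v v)) \<le> \<gamma> / (2 * real n)"
        using norm_cauchy_schwarz[of "pad v" "pad (A i *\<^sub>v v)"] bound[of i v] vc by simp
    qed
    also have "\<dots> = \<gamma> / 2" using nd by simp
    finally show ?thesis by simp
  qed
  show ?thesis
  proof (rule qrgd.intro)
    show "i\<^sub>0 < n" by fact
    show "A i \<in> carrier_mat d d" "transpose_mat (A i) = A i" for i by (rule Ac, rule At)
    show "norm (pad (A i *\<^sub>v x)) \<le> \<gamma> / (2 * real n) * norm (pad x)" if "i < n" "x \<in> carrier_vec d" for i x
      by (rule bound[OF that])
    show "rayleigh_step (pad x) (pad v) (\<Sum>i<n. pad (A i *\<^sub>v x)) (ls ! 0) \<delta> \<gamma>"
      if x: "x \<in> usphere d" "0 \<le> inner (pad x) (pad v)" for x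
    proof -
      have "x \<in> carrier_vec d" using x by (simp add: usphere_def)
      then have eq: "(\<Sum>i<n. pad (A i *\<^sub>v x)) = pad (gram M *\<^sub>v x)"
        using gram_local_data_sum[OF M P] by (simp add: A)
      have "qform (gram M) y \<le> ls ! 1 * (norm (pad y))\<^sup>2"
        if "y \<in> carrier_vec d" "inner (pad v) (pad y) = 0" for y
        by (rule qform_le_second_eigenvalue[OF G gram_symmetric d es(1,2) _ es(4) v that]) (rule es(3))
      then show ?thesis unfolding eq \<delta>(1)
        by (intro rayleigh_step_of_gap[OF G gram_symmetric _ v _ es(4) gap l\<gamma> x] Gpsd) auto
    qed
    show "\<delta> \<le> ls ! 0" using es(4) \<delta> by simp
  qed (use v \<delta> l\<gamma> quant iso a par in auto)
qed

text \<open>\<kappa> is the positive lower bound that the asymptotic regime grants to ln (D /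
  \<epsilon>); the other logarithm is at least 1 by itself, since d is at least 2 and \<gamma> at
  least 2 \<delta>.\<close>

theorem mainTheorem7:
  fixes c C\<^sub>Q \<kappa> :: real
  assumes "universal_overlap c" and "C\<^sub>Q > 0" and "\<kappa> > 0"
  shows "\<exists>C>0. \<forall>n m d M P ls v\<^sub>1 i\<^sub>0 Q enc dec b \<phi> p \<epsilon> A \<delta> \<mu> \<gamma> \<eta> D \<sigma> \<theta> R.
    n \<ge> 1 \<and> d \<ge> 2 \<and> i\<^sub>0 < n \<and>
    M \<in> carrier_mat m d \<and> row_partition n m P \<and>
    A = (\<lambda>i. gram (local_data M P i)) \<and>
    eigenvalue_list (gram M) ls \<and> \<delta> = ls ! 0 - ls ! 1 \<and> \<delta> > 0 \<and> \<mu> = \<delta> / 2 \<and>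
    v\<^sub>1 \<in> usphere d \<and> eigenvector (gram M) v\<^sub>1 (ls ! 0) \<and>
    \<gamma> = total_smoothness n A \<and>
    quantizer d C\<^sub>Q Q enc dec b \<and> (\<forall>x\<in>usphere d. tangent_isometry d x (\<phi> x)) \<and>
    0 < p \<and> p < 1 \<and>
    \<eta> = c * p / (sqrt (real d) * \<gamma>) \<and> D = arccos (c * p / sqrt (real d)) \<and>
    \<sigma> = par_sigma D \<mu> \<eta> \<and> \<theta> = par_theta \<sigma> \<and> R = par_R \<gamma> D \<sigma> \<and>
    \<epsilon> > 0 \<and> ln (D / \<epsilon>) \<ge> \<kappa> \<longrightarrow>
    (\<exists>E\<in>sets (uniform_sphere d). measure (uniform_sphere d) E \<ge> 1 - p \<and>
      (\<forall>x\<^sub>0\<in>E.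
        (\<exists>x qm q. qrgd_run d n i\<^sub>0 (\<lambda>i. pca_obj (A i)) (tangent_Q d \<phi> Q) \<gamma> \<eta> \<theta> R x\<^sub>0 x qm q) \<and>
        (\<forall>x qm q. qrgd_run d n i\<^sub>0 (\<lambda>i. pca_obj (A i)) (tangent_Q d \<phi> Q) \<gamma> \<eta> \<theta> R x\<^sub>0 x qm q \<longrightarrow>
          (\<forall>xstar\<in>{v\<^sub>1, - v\<^sub>1}. sdist x\<^sub>0 xstar = min (sdist x\<^sub>0 v\<^sub>1) (sdist x\<^sub>0 (- v\<^sub>1)) \<longrightarrow>
            (\<exists>T. sdist (x T) xstar \<le> \<epsilon> \<and>
              real (qrgd_bits n b \<gamma> \<theta> R T) \<le>
                C * (real n * ((real d)\<^sup>2 / p\<^sup>2) * (\<gamma> / \<delta>) *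
                     ln (real n * real d * \<gamma> / (p * \<delta>)) * ln (D / \<epsilon>)))))))"
proof -
  have c: "0 < c" "c \<le> 1"
    using assms(1) universal_overlap_le_1 by (auto simp: universal_overlap_def)
  show ?thesis
  proof (intro exI[of _ "bits_const c C\<^sub>Q \<kappa>"] conjI allI impI, goal_cases)
    case 1
    show ?case by (rule bits_const_pos[OF c assms(2,3)])
  next
    case (2 n m d M P ls v\<^sub>1 i\<^sub>0 Q enc dec b \<phi> p \<epsilon> A \<delta> \<mu> \<gamma> \<eta> D \<sigma> \<theta> R)
    then have nd: "1 \<le> n" "2 \<le> d" "i\<^sub>0 < n"
      and M: "M \<in> carrier_mat m d" "row_partition n m P"
      and A: "A = (\<lambda>i. gram (local_data M P i))"
      and ls: "eigenvalue_list (gram M) ls" and \<delta>: "\<delta> = ls ! 0 - ls ! 1" "0 < \<delta>"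
      and \<mu>: "\<mu> = \<delta> / 2"
      and v1: "v\<^sub>1 \<in> usphere d" "eigenvector (gram M) v\<^sub>1 (ls ! 0)"
      and \<gamma>: "\<gamma> = total_smoothness n A"
      and quant: "quantizer d C\<^sub>Q Q enc dec b"
      and iso: "\<And>x. x \<in> usphere d \<Longrightarrow> tangent_isometry d x (\<phi> x)"
      and p: "0 < p" "p < 1"
      and \<eta>: "\<eta> = c * p / (sqrt (real d) * \<gamma>)" and D: "D = arccos (c * p / sqrt (real d))"
      and par: "\<sigma> = par_sigma D \<mu> \<eta>" "\<theta> = par_theta \<sigma>" "R = par_R \<gamma> D \<sigma>"
      and \<epsilon>: "0 < \<epsilon>" "\<kappa> \<le> ln (D / \<epsilon>)"
      by auto
    define a where "a = c * p / sqrt (real d)"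
    have a0: "0 < a" using c p nd by (simp add: a_def)
    have a2: "a\<^sup>2 \<le> 1 / 2"
    proof -
      have "(c * p)\<^sup>2 \<le> 1" using c p mult_mono[of c 1 p 1] by (simp add: power_le_one)
      moreover have "a\<^sup>2 = (c * p)\<^sup>2 / d" by (simp add: a_def power_divide)
      ultimately have "a\<^sup>2 \<le> 1 / d" by (simp add: divide_right_mono)
      also have "\<dots> \<le> 1 / 2" using nd by (intro divide_left_mono) auto
      finally show ?thesis .
    qed
    have \<eta>a: "\<eta> = a / \<gamma>" and Da: "D = arccos a" by (simp_all add: \<eta> D a_def)
    define E where "E = {x \<in> usphere d. a \<le> \<bar>x \<bullet> v\<^sub>1\<bar>}"
    have meas: "1 - p \<le> measure (uniform_sphere d) E"
    proof -
      have d1: "1 \<le> d" using nd by simp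
      show ?thesis unfolding E_def a_def
        using assms(1)[unfolded universal_overlap_def, THEN conjunct2, rule_format, OF d1 v1(1) conjI[OF p]] .
    qed
    \<comment> \<open>Sets outside the sigma-algebra have \<open>measure\<close> 0 by convention, so
      the positive bound 1 - p already yields measurability.\<close>
    then have "measure (uniform_sphere d) E \<noteq> 0" using p by linarith
    then have sets: "E \<in> sets (uniform_sphere d)" using measure_notin_sets by blast
    have vc: "v\<^sub>1 \<in> carrier_vec d" "norm (pad v\<^sub>1) = 1" "- v\<^sub>1 \<in> carrier_vec d"
      using v1 by (auto simp: usphere_iff)
    have G: "gram M \<in> carrier_mat d d" by (rule gram_carrier[OF M(1)])
    have ev: "w \<in> usphere d \<and> gram M *\<^sub>v w = (ls ! 0) \<cdot>\<^sub>v w" if "w \<in> {v\<^sub>1, - v\<^sub>1}" for w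
    proof -
      have e1: "gram M *\<^sub>v v\<^sub>1 = (ls ! 0) \<cdot>\<^sub>v v\<^sub>1" using v1(2) by (simp add: eigenvector_def)
      have "- v\<^sub>1 = (- 1) \<cdot>\<^sub>v v\<^sub>1" by auto
      then have "gram M *\<^sub>v (- v\<^sub>1) = (- 1) \<cdot>\<^sub>v (gram M *\<^sub>v v\<^sub>1)"
        using mult_mat_vec[OF G vc(1)] by simp
      also have "\<dots> = (ls ! 0) \<cdot>\<^sub>v (- v\<^sub>1)" unfolding e1 by (intro eq_vecI) auto
      finally show ?thesis using that e1 vc by (auto simp: usphere_iff)
    qed
    \<comment> \<open>Both signs are instantiated, since which one is nearest is decided only by the
      starting point.\<close>
    have Q: "qrgd n d i\<^sub>0 A Q enc dec b \<phi> C\<^sub>Q w (ls ! 0) \<delta> \<gamma> a \<eta> D \<sigma> \<theta> R" if "w \<in> {v\<^sub>1, - v\<^sub>1}" for w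
      by (rule dpca_qrgd[OF nd M A ls \<delta> _ _ \<gamma> quant iso a0 a2 \<eta>a Da _ par(2,3)])
        (use ev[OF that] par(1) \<mu> in auto)
    have near: "sdist x w \<le> D"
      if x: "x \<in> E" and w: "w \<in> {v\<^sub>1, - v\<^sub>1}"
        and min: "sdist x w = min (sdist x v\<^sub>1) (sdist x (- v\<^sub>1))" for x w
    proof -
      have xc: "x \<in> carrier_vec d" "norm (pad x) = 1" and ov: "a \<le> \<bar>inner (pad x) (pad v\<^sub>1)\<bar>"
        using x vc by (auto simp: E_def usphere_iff inner_pad[of _ d])
      have le1: "\<bar>inner (pad x) (pad v\<^sub>1)\<bar> \<le> 1"
        using Cauchy_Schwarz_ineq2[of "pad x" "pad v\<^sub>1"] xc vc by simp
      have s: "sdist x v\<^sub>1 = arccos (inner (pad x) (pad v\<^sub>1))"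
        "sdist x (- v\<^sub>1) = arccos (- inner (pad x) (pad v\<^sub>1))"
        using sdist_pad[OF xc(1) vc(1)] sdist_pad[OF xc(1) vc(3)] by simp_all
      have "arccos \<bar>inner (pad x) (pad v\<^sub>1)\<bar> \<le> D"
        unfolding Da using ov le1 a0 by (intro arccos_le_arccos) auto
      then show ?thesis unfolding min s by (auto simp: abs_if min_le_iff_disj split: if_splits)
    qed
    show ?case
    proof (intro bexI[OF _ sets] conjI ballI allI impI)
      show "1 - p \<le> measure (uniform_sphere d) E" by (rule meas)
      fix x\<^sub>0 assume x0: "x\<^sub>0 \<in> E"
      then have x0s: "x\<^sub>0 \<in> usphere d" by (simp add: E_def)
      show "\<exists>x qm q. qrgd_run d n i\<^sub>0 (\<lambda>i. pca_obj (A i)) (tangent_Q d \<phi> Q) \<gamma> \<eta> \<theta> R x\<^sub>0 x qm q"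
      proof -
        \<comment> \<open>Existence of a run is proved through its distance to the nearest
          eigenvector, so one of the two signs has to be picked first.\<close>
        obtain w where w: "w \<in> {v\<^sub>1, - v\<^sub>1}" "sdist x\<^sub>0 w = min (sdist x\<^sub>0 v\<^sub>1) (sdist x\<^sub>0 (- v\<^sub>1))"
          by (metis insertCI min_def)
        interpret qrgd n d i\<^sub>0 A Q enc dec b \<phi> C\<^sub>Q w "ls ! 0" \<delta> \<gamma> a \<eta> D \<sigma> \<theta> R by (rule Q[OF w(1)])
        show ?thesis by (rule run_exists[OF x0s near[OF x0 w]])
      qed
      fix x qm q w
      assume run: "qrgd_run d n i\<^sub>0 (\<lambda>i. pca_obj (A i)) (tangent_Q d \<phi> Q) \<gamma> \<eta> \<theta> R x\<^sub>0 x qm q"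
        and w: "w \<in> {v\<^sub>1, - v\<^sub>1}" "sdist x\<^sub>0 w = min (sdist x\<^sub>0 v\<^sub>1) (sdist x\<^sub>0 (- v\<^sub>1))"
      interpret q: qrgd n d i\<^sub>0 A Q enc dec b \<phi> C\<^sub>Q w "ls ! 0" \<delta> \<gamma> a \<eta> D \<sigma> \<theta> R by (rule Q[OF w(1)])
      obtain T where T: "par_sqrt_xi \<sigma> ^ T * D \<le> \<epsilon>"
        "real T \<le> (2 + 1 / \<kappa>) / (1 - sqrt \<sigma>) * ln (D / \<epsilon>)"
        using q.rounds[OF \<epsilon>(1) assms(3) \<epsilon>(2)] by metis
      show "\<exists>T. sdist (x T) w \<le> \<epsilon> \<and> real (qrgd_bits n b \<gamma> \<theta> R T) \<le>
          bits_const c C\<^sub>Q \<kappa> * (real n * ((real d)\<^sup>2 / p\<^sup>2) * (\<gamma> / \<delta>) *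
            ln (real n * real d * \<gamma> / (p * \<delta>)) * ln (D / \<epsilon>))"
      proof (intro exI[of _ T] conjI)
        show "sdist (x T) w \<le> \<epsilon>"
          using q.run_close[OF x0s near[OF x0 w] run, of T] T(1) by (simp add: q.close_def)
        have "0 \<le> ln (D / \<epsilon>)" using \<epsilon>(2) assms(3) by linarith
        from total_bits_bound[OF c assms(2,3) nd(1,2) \<delta>(2) q.\<gamma>(2) p q.h(1) q.h(3)[unfolded a_def]
            this of_nat_0_le_iff T(2)]
        show "real (qrgd_bits n b \<gamma> \<theta> R T) \<le>
          bits_const c C\<^sub>Q \<kappa> * (real n * ((real d)\<^sup>2 / p\<^sup>2) * (\<gamma> / \<delta>) *
            ln (real n * real d * \<gamma> / (p * \<delta>)) * ln (D / \<epsilon>))"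
          by (rule order_trans[OF q.total_bits[OF assms(2)]])
      qed
    qed
  qed
qed

end
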